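(* Let $\Delta$ be a reflexive polytope with height function $h$, let $\nu$ be a positive measure on $B$ of total mass $\mu_M(A)$, and let $\Psi$ be its Kantorovich potential. If there exists an optimal transport plan from $\mu_M$ to $\nu$ which is supported on $$\bigcup_{m\in A\cap M}\big(\mathrm{St}(m)\times\tau_m\big),\qquad( * )$$ then $\Psi$ solves the Monge-Ampère equation on $B\setminus\Sigma_\Psi$. Moreover, if $\Psi\in\mathcal P(\Delta)$ solves the Monge-Ampère equation on $B\setminus\Sigma_\Psi$ and $\nu$ does not charge $\Sigma_\Psi$, then there is an optimal transport plan from $\mu_M$ to $\nu$ supported on $( * )$; and if $\Psi'\in\mathcal P(\Delta)$ is another function solving the Monge-Ampère equation on $B\setminus\Sigma_{\Psi'}$ such that $\nu$ does not charge $\Sigma_{\Psi'}$, then $\Sigma_\Psi=\Sigma_{\Psi'}$ and $\Psi-\Psi'$ is constant on $B$.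
   Context: Let $d\ge 1$, $M\cong\mathbb Z^{d+1}$ a lattice, $N=\mathrm{Hom}(M,\mathbb Z)$, $M_{\mathbb R},N_{\mathbb R}$ the associated real vector spaces with pairing $\langle\cdot,\cdot\rangle$. A reflexive polytope $\Delta\subset M_{\mathbb R}$ is a lattice polytope with $0$ in its interior whose dual $\{n:\langle m,n\rangle\le1\ \forall m\in\Delta\}$ is a lattice polytope. A height function is $h:\Delta\cap M\to\mathbb Z$ with $h(0)=0<h(m)$ for $m\ne0$. $\Delta_h^\vee=\{n\in N_{\mathbb R}:\langle m,n\rangle\le h(m)\ \forall m\in\Delta\cap M\}$, $A=\partial\Delta$, $B=\partial\Delta_h^\vee$; $A^\circ,B^\circ$ are the unions of the relative interiors of facets and $B_{d-1}=B\setminus B^\circ$. $A_d$ is the set of facets of $\Delta$. For a facet $\sigma$ of $\Delta$, $n_\sigma\in N$ is its primitive outward normal and $\sigma^\circ$ its relative interior; for a facet $\tau$ of $\Delta_h^\vee$, $m_\tau\in A\cap M$ is its primitive outward normal. For $m\in A\cap M$, $\tau_m=\{n\in\Delta_h^\vee:\langle m,n\rangle=h(m)\}$ and $\mathrm{St}(m)$ is the union of the closed faces of $A$ containing $m$. $\mu_M$ is the measure on $A$ equal on each facet $\sigma$ to Lebesgue measure normalized by the lattice $n_\sigma^\perp\cap M$ (and giving no mass to $A\setminus A^\circ$). $\mathcal P(\Delta)$ is the set of convex $\Psi:N_{\mathbb R}\to\mathbb R$ with $\sup_{n}|\Psi(n)-\sup_{m\in\Delta\cap M}\langle m,n\rangle|<\infty$.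 For $\Psi:B\to\mathbb R$ continuous, $\Psi^c(m)=\sup_{n\in B}\langle m,n\rangle-\Psi(n)$ ($m\in A$), and for $\Phi:A\to\mathbb R$ continuous, $\Phi^c(n)=\sup_{m\in A}\langle m,n\rangle-\Phi(m)$; a function is $c$-convex if it is a $c$-transform. $c$-convex functions on $B$ are identified with elements of $\mathcal P(\Delta)$ (by restriction to $B$ and by extension through the formula $\Psi(n)=\sup_{m\in A}\langle m,n\rangle-\Psi^c(m)$). For $m\in A$, $\partial^c\Psi^c(m)$ is the set of $n\in B$ with $\Psi^c(m')\ge\Psi^c(m)+\langle m'-m,n\rangle$ for all $m'\in A$. The Kantorovich potential of $\nu$ is the maximizer, unique up to constants, of $J(\Psi)=-\int_A\Psi^c\,\mu_M-\int_B\Psi\,\nu$ over $c$-convex $\Psi$ on $B$. An optimal transport plan from $\mu_M$ to $\nu$ is a positive measure on $A\times B$ with marginals $\mu_M,\nu$ minimizing $-\int\langle m,n\rangle\gamma$. For $\Psi\in\mathcal P(\Delta)$ and $\sigma\in A_d$: $U_{\sigma,\Psi}=B\setminus\partial^c\Psi^c(A\setminus\sigma^\circ)$ (an open subset of $B$ contained in $\bigcup_{m\in\sigma\cap M}\tau_m$; these sets are pairwise disjoint), and $\Sigma_\Psi=B_{d-1}\setminus\bigcup_{\sigma}U_{\sigma,\Psi}$. For $\sigma\in A_d$, $\beta_\sigma(n)=(\langle m_1,n\rangle,\dots,\langle m_d,n\rangle)$ where $m_1,\dots,m_d$ is a $\mathbb Z$-basis of $n_\sigma^\perp\cap M$; $\beta_\sigma$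 is injective on $\bigcup_{m\in\sigma\cap M}\tau_m$ and $\beta_\sigma^{-1}$ denotes the inverse there. For $\Psi\in\mathcal P(\Delta)$ and $m\in\sigma$ (viewed as a linear function on $N_{\mathbb R}$), $(\Psi-m)\circ\beta_\sigma^{-1}$ is convex on $\beta_\sigma(\bigcup_{m'\in\sigma\cap M}\tau_{m'})$. We say $\Psi\in\mathcal P(\Delta)$ solves the Monge-Ampère equation on $B\setminus\Sigma_\Psi$ if (i) for each facet $\tau$ of $\Delta_h^\vee$ with relative interior $\tau^\circ$, each $\sigma\in A_d$ with $m_\tau\in\sigma$ and each measurable $E\subset\tau^\circ$, $|\partial(\Psi\circ\beta_\sigma^{-1}|_{\beta_\sigma(\tau^\circ)})(\beta_\sigma(E))|=\nu(E)$; and (ii) for each $\sigma\in A_d$, $m\in\sigma$ and measurable $E\subset U_{\sigma,\Psi}$, $|\partial((\Psi-m)\circ\beta_\sigma^{-1})(\beta_\sigma(E))|=\nu(E)$. Here $\partial$ is the multivalued subgradient and $|\cdot|$ Lebesgue measure on $\mathbb R^d$. *)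

theory Defs
  imports "HOL-Analysis.Analysis"
begin

text \<open>
  The lattices \<open>M\<close> and \<open>N = Hom(M, \<int>)\<close> are both identified with the integer points of
  \<open>real ^ 'n\<close>, the pairing being the standard inner product. The type \<open>'n\<close> indexes the \<open>d + 1\<close>
  coordinates of \<open>M\<close>, the type \<open>'k\<close> the \<open>d\<close> coordinates on a facet.
\<close>

section \<open>Polytopes and lattices\<close>

definition int_lattice :: "(real ^ 'n) set" where
  "int_lattice = {v. \<forall>i. v $ i \<in> \<int>}"

definition lattice_polytope :: "(real ^ 'n) set \<Rightarrow> bool" where
  "lattice_polytope P \<longleftrightarrow> (\<exists>V. finite V \<and> V \<subseteq> int_lattice \<and> P = convex hull V)"

definition dual_polytope :: "(real ^ 'n) set \<Rightarrow> (real ^ 'n) set" where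
  "dual_polytope P = {n. \<forall>m\<in>P. m \<bullet> n \<le> 1}"

definition reflexive_polytope :: "(real ^ 'n) set \<Rightarrow> bool" where
  "reflexive_polytope P \<longleftrightarrow>
     lattice_polytope P \<and> 0 \<in> interior P \<and> lattice_polytope (dual_polytope P)"

text \<open>Only the values of \<open>h\<close> on the lattice points of \<open>\<Delta>\<close> are ever used.\<close>

definition height_function :: "(real ^ 'n) set \<Rightarrow> (real ^ 'n \<Rightarrow> int) \<Rightarrow> bool" where
  "height_function \<Delta> h \<longleftrightarrow> h 0 = 0 \<and> (\<forall>m\<in>\<Delta> \<inter> int_lattice. m \<noteq> 0 \<longrightarrow> 0 < h m)"

definition dual_h :: "(real ^ 'n) set \<Rightarrow> (real ^ 'n \<Rightarrow> int) \<Rightarrow> (real ^ 'n) set" where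
  "dual_h \<Delta> h = {n. \<forall>m\<in>\<Delta> \<inter> int_lattice. m \<bullet> n \<le> of_int (h m)}"

definition bdA :: "(real ^ 'n) set \<Rightarrow> (real ^ 'n) set" where
  "bdA \<Delta> = frontier \<Delta>"

definition bdB :: "(real ^ 'n) set \<Rightarrow> (real ^ 'n \<Rightarrow> int) \<Rightarrow> (real ^ 'n) set" where
  "bdB \<Delta> h = frontier (dual_h \<Delta> h)"

definition bdB_sing :: "(real ^ 'n) set \<Rightarrow> (real ^ 'n \<Rightarrow> int) \<Rightarrow> (real ^ 'n) set" where
  "bdB_sing \<Delta> h = bdB \<Delta> h - (\<Union>\<tau>\<in>{\<tau>. \<tau> facet_of dual_h \<Delta> h}. rel_interior \<tau>)"

definition primitive_vec :: "real ^ 'n \<Rightarrow> bool" where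
  "primitive_vec v \<longleftrightarrow>
     v \<in> int_lattice \<and> (\<forall>w\<in>int_lattice. \<forall>k::int. v = of_int k *\<^sub>R w \<longrightarrow> \<bar>k\<bar> = 1)"

definition primitive_normal :: "(real ^ 'n) set \<Rightarrow> (real ^ 'n) set \<Rightarrow> real ^ 'n" where
  "primitive_normal P F =
     (THE v. primitive_vec v \<and> (\<exists>c. P \<subseteq> {x. v \<bullet> x \<le> c} \<and> F = P \<inter> {x. v \<bullet> x = c}))"

definition tau_of :: "(real ^ 'n) set \<Rightarrow> (real ^ 'n \<Rightarrow> int) \<Rightarrow> real ^ 'n \<Rightarrow> (real ^ 'n) set" where
  "tau_of \<Delta> h m = {n \<in> dual_h \<Delta> h. m \<bullet> n = of_int (h m)}"

text \<open>The closed faces of the boundary of \<open>\<Delta>\<close> are the proper faces of \<open>\<Delta>\<close>.\<close>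

definition star_of :: "(real ^ 'n) set \<Rightarrow> real ^ 'n \<Rightarrow> (real ^ 'n) set" where
  "star_of \<Delta> m = \<Union>{F. F face_of \<Delta> \<and> F \<noteq> \<Delta> \<and> m \<in> F}"

definition support_set ::
    "(real ^ 'n) set \<Rightarrow> (real ^ 'n \<Rightarrow> int) \<Rightarrow> ((real ^ 'n) \<times> (real ^ 'n)) set" where
  "support_set \<Delta> h = (\<Union>m\<in>bdA \<Delta> \<inter> int_lattice. star_of \<Delta> m \<times> tau_of \<Delta> h m)"

section \<open>Lattice coordinates on facets and the measure on the boundary\<close>

definition Z_basis :: "('k::finite \<Rightarrow> real ^ 'n) \<Rightarrow> (real ^ 'n) set \<Rightarrow> bool" where
  "Z_basis b L \<longleftrightarrow>
     range b \<subseteq> L \<and> (\<forall>v\<in>L. \<exists>!k::'k \<Rightarrow> int. v = (\<Sum>i\<in>UNIV. of_int (k i) *\<^sub>R b i))"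

definition facet_bases ::
    "(real ^ 'n) set \<Rightarrow> ((real ^ 'n) set \<Rightarrow> 'k::finite \<Rightarrow> real ^ 'n) \<Rightarrow> bool" where
  "facet_bases \<Delta> b \<longleftrightarrow>
     (\<forall>\<sigma>. \<sigma> facet_of \<Delta> \<longrightarrow>
        Z_basis (b \<sigma>) {m \<in> int_lattice. m \<bullet> primitive_normal \<Delta> \<sigma> = 0})"

text \<open>
  The affine parametrisation of the hyperplane spanned by \<open>\<sigma>\<close> which carries \<open>\<int>\<^sup>d\<close> to a translate
  of the lattice of integer vectors parallel to \<open>\<sigma>\<close>. Up to translations and unimodular changes of
  coordinates in the source it depends neither on the base point nor on the lattice basis, so
  \<open>mu_M\<close> below depends on neither.
\<close>

definition facet_chart ::
    "((real ^ 'n) set \<Rightarrow> 'k::finite \<Rightarrow> real ^ 'n) \<Rightarrow> (real ^ 'n) set \<Rightarrow> real ^ 'k \<Rightarrow> real ^ 'n" where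
  "facet_chart b \<sigma> x = (SOME p. p \<in> \<sigma>) + (\<Sum>i\<in>UNIV. (x $ i) *\<^sub>R b \<sigma> i)"

definition mu_M ::
    "(real ^ 'n) set \<Rightarrow> ((real ^ 'n) set \<Rightarrow> 'k::finite \<Rightarrow> real ^ 'n) \<Rightarrow> (real ^ 'n) measure" where
  "mu_M \<Delta> b = measure_of (bdA \<Delta>) (sets (restrict_space borel (bdA \<Delta>)))
     (\<lambda>E. \<Sum>\<sigma> | \<sigma> facet_of \<Delta>. emeasure lborel (facet_chart b \<sigma> -` (E \<inter> \<sigma>)))"

definition beta ::
    "((real ^ 'n) set \<Rightarrow> 'k::finite \<Rightarrow> real ^ 'n) \<Rightarrow> (real ^ 'n) set \<Rightarrow> real ^ 'n \<Rightarrow> real ^ 'k" where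
  "beta b \<sigma> n = (\<chi> i. b \<sigma> i \<bullet> n)"

definition beta_dom ::
    "(real ^ 'n) set \<Rightarrow> (real ^ 'n \<Rightarrow> int) \<Rightarrow> (real ^ 'n) set \<Rightarrow> (real ^ 'n) set" where
  "beta_dom \<Delta> h \<sigma> = (\<Union>m\<in>\<sigma> \<inter> int_lattice. tau_of \<Delta> h m)"

definition beta_inv ::
    "(real ^ 'n) set \<Rightarrow> (real ^ 'n \<Rightarrow> int) \<Rightarrow> ((real ^ 'n) set \<Rightarrow> 'k::finite \<Rightarrow> real ^ 'n)
      \<Rightarrow> (real ^ 'n) set \<Rightarrow> real ^ 'k \<Rightarrow> real ^ 'n" where
  "beta_inv \<Delta> h b \<sigma> = inv_into (beta_dom \<Delta> h \<sigma>) (beta b \<sigma>)"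

section \<open>c-transforms, Kantorovich potentials and transport plans\<close>

definition P_class :: "(real ^ 'n) set \<Rightarrow> (real ^ 'n \<Rightarrow> real) set" where
  "P_class \<Delta> = {\<Psi>. convex_on UNIV \<Psi> \<and>
     (\<exists>C. \<forall>n. \<bar>\<Psi> n - (SUP m\<in>\<Delta> \<inter> int_lattice. m \<bullet> n)\<bar> \<le> C)}"

definition c_transform :: "(real ^ 'n) set \<Rightarrow> (real ^ 'n \<Rightarrow> real) \<Rightarrow> real ^ 'n \<Rightarrow> real" where
  "c_transform S f x = (SUP y\<in>S. x \<bullet> y - f y)"

definition c_convex_B ::
    "(real ^ 'n) set \<Rightarrow> (real ^ 'n \<Rightarrow> int) \<Rightarrow> (real ^ 'n \<Rightarrow> real) \<Rightarrow> bool" where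
  "c_convex_B \<Delta> h \<Psi> \<longleftrightarrow>
     (\<exists>\<Phi>. continuous_on (bdA \<Delta>) \<Phi> \<and> (\<forall>n\<in>bdB \<Delta> h. \<Psi> n = c_transform (bdA \<Delta>) \<Phi> n))"

text \<open>
  The extension to all of \<open>N\<^sub>\<real>\<close> of a c-convex function on \<open>B\<close>; it only involves the values of
  \<open>\<Psi>\<close> on \<open>B\<close>.
\<close>

definition c_extension ::
    "(real ^ 'n) set \<Rightarrow> (real ^ 'n \<Rightarrow> int) \<Rightarrow> (real ^ 'n \<Rightarrow> real) \<Rightarrow> real ^ 'n \<Rightarrow> real" where
  "c_extension \<Delta> h \<Psi> = c_transform (bdA \<Delta>) (c_transform (bdB \<Delta> h) \<Psi>)"

definition c_subgradient ::
    "(real ^ 'n) set \<Rightarrow> (real ^ 'n \<Rightarrow> int) \<Rightarrow> (real ^ 'n \<Rightarrow> real) \<Rightarrow> real ^ 'n \<Rightarrow> (real ^ 'n) set" where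
  "c_subgradient \<Delta> h \<Phi> m = {n \<in> bdB \<Delta> h. \<forall>m'\<in>bdA \<Delta>. \<Phi> m' \<ge> \<Phi> m + (m' - m) \<bullet> n}"

definition kantorovich_J ::
    "(real ^ 'n) set \<Rightarrow> (real ^ 'n \<Rightarrow> int) \<Rightarrow> ((real ^ 'n) set \<Rightarrow> 'k::finite \<Rightarrow> real ^ 'n)
      \<Rightarrow> (real ^ 'n) measure \<Rightarrow> (real ^ 'n \<Rightarrow> real) \<Rightarrow> real" where
  "kantorovich_J \<Delta> h b \<nu> \<Psi> =
     - (\<integral>m. c_transform (bdB \<Delta> h) \<Psi> m \<partial>mu_M \<Delta> b) - (\<integral>n. \<Psi> n \<partial>\<nu>)"

definition kantorovich_potential ::
    "(real ^ 'n) set \<Rightarrow> (real ^ 'n \<Rightarrow> int) \<Rightarrow> ((real ^ 'n) set \<Rightarrow> 'k::finite \<Rightarrow> real ^ 'n)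
      \<Rightarrow> (real ^ 'n) measure \<Rightarrow> (real ^ 'n \<Rightarrow> real) \<Rightarrow> bool" where
  "kantorovich_potential \<Delta> h b \<nu> \<Psi> \<longleftrightarrow> c_convex_B \<Delta> h \<Psi> \<and>
     (\<forall>\<Psi>'. c_convex_B \<Delta> h \<Psi>' \<longrightarrow> kantorovich_J \<Delta> h b \<nu> \<Psi>' \<le> kantorovich_J \<Delta> h b \<nu> \<Psi>)"

definition transport_plan ::
    "(real ^ 'n) measure \<Rightarrow> (real ^ 'n) measure \<Rightarrow> ((real ^ 'n) \<times> (real ^ 'n)) measure \<Rightarrow> bool" where
  "transport_plan \<mu> \<nu> \<gamma> \<longleftrightarrow>
     sets \<gamma> = sets (restrict_space borel (space \<mu> \<times> space \<nu>)) \<and>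
     distr \<gamma> \<mu> fst = \<mu> \<and> distr \<gamma> \<nu> snd = \<nu>"

definition optimal_plan ::
    "(real ^ 'n) measure \<Rightarrow> (real ^ 'n) measure \<Rightarrow> ((real ^ 'n) \<times> (real ^ 'n)) measure \<Rightarrow> bool" where
  "optimal_plan \<mu> \<nu> \<gamma> \<longleftrightarrow> transport_plan \<mu> \<nu> \<gamma> \<and>
     (\<forall>\<gamma>'. transport_plan \<mu> \<nu> \<gamma>' \<longrightarrow> - (\<integral>z. fst z \<bullet> snd z \<partial>\<gamma>) \<le> - (\<integral>z. fst z \<bullet> snd z \<partial>\<gamma>'))"

definition exists_supported_optimal_plan ::
    "(real ^ 'n) set \<Rightarrow> (real ^ 'n \<Rightarrow> int) \<Rightarrow> ((real ^ 'n) set \<Rightarrow> 'k::finite \<Rightarrow> real ^ 'n)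
      \<Rightarrow> (real ^ 'n) measure \<Rightarrow> bool" where
  "exists_supported_optimal_plan \<Delta> h b \<nu> \<longleftrightarrow>
     (\<exists>\<gamma>. optimal_plan (mu_M \<Delta> b) \<nu> \<gamma> \<and> (AE z in \<gamma>. z \<in> support_set \<Delta> h))"

section \<open>The Monge-Ampere equation\<close>

definition U_set ::
    "(real ^ 'n) set \<Rightarrow> (real ^ 'n \<Rightarrow> int) \<Rightarrow> (real ^ 'n \<Rightarrow> real) \<Rightarrow> (real ^ 'n) set \<Rightarrow> (real ^ 'n) set"
  where
  "U_set \<Delta> h \<Psi> \<sigma> = bdB \<Delta> h -
     (\<Union>m\<in>bdA \<Delta> - rel_interior \<sigma>. c_subgradient \<Delta> h (c_transform (bdB \<Delta> h) \<Psi>) m)"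

definition Sing ::
    "(real ^ 'n) set \<Rightarrow> (real ^ 'n \<Rightarrow> int) \<Rightarrow> (real ^ 'n \<Rightarrow> real) \<Rightarrow> (real ^ 'n) set" where
  "Sing \<Delta> h \<Psi> = bdB_sing \<Delta> h - (\<Union>\<sigma>\<in>{\<sigma>. \<sigma> facet_of \<Delta>}. U_set \<Delta> h \<Psi> \<sigma>)"

text \<open>The image of \<open>X\<close> under the subgradient of a function \<open>f\<close> with domain \<open>D\<close>.\<close>

definition subgradient_image ::
    "(real ^ 'k) set \<Rightarrow> (real ^ 'k \<Rightarrow> real) \<Rightarrow> (real ^ 'k) set \<Rightarrow> (real ^ 'k) set" where
  "subgradient_image D f X = (\<Union>x\<in>X. {p. \<forall>y\<in>D. f y \<ge> f x + p \<bullet> (y - x)})"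

text \<open>
  Subgradient images of Borel sets need not be Borel, hence the completed measure \<open>lebesgue\<close>.
\<close>

definition solves_MA ::
    "(real ^ 'n) set \<Rightarrow> (real ^ 'n \<Rightarrow> int) \<Rightarrow> ((real ^ 'n) set \<Rightarrow> 'k::finite \<Rightarrow> real ^ 'n)
      \<Rightarrow> (real ^ 'n) measure \<Rightarrow> (real ^ 'n \<Rightarrow> real) \<Rightarrow> bool" where
  "solves_MA \<Delta> h b \<nu> \<Psi> \<longleftrightarrow> \<Psi> \<in> P_class \<Delta> \<and>
     (\<forall>\<tau> \<sigma> E. \<tau> facet_of dual_h \<Delta> h \<and> \<sigma> facet_of \<Delta> \<and>
        primitive_normal (dual_h \<Delta> h) \<tau> \<in> \<sigma> \<and> E \<in> sets \<nu> \<and> E \<subseteq> rel_interior \<tau> \<longrightarrow>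
        emeasure lebesgue
          (subgradient_image (beta b \<sigma> ` rel_interior \<tau>) (\<Psi> \<circ> beta_inv \<Delta> h b \<sigma>) (beta b \<sigma> ` E))
        = emeasure \<nu> E) \<and>
     (\<forall>\<sigma> m E. \<sigma> facet_of \<Delta> \<and> m \<in> \<sigma> \<and> E \<in> sets \<nu> \<and> E \<subseteq> U_set \<Delta> h \<Psi> \<sigma> \<longrightarrow>
        emeasure lebesgue
          (subgradient_image (beta b \<sigma> ` beta_dom \<Delta> h \<sigma>)
             ((\<lambda>n. \<Psi> n - m \<bullet> n) \<circ> beta_inv \<Delta> h b \<sigma>) (beta b \<sigma> ` E))
        = emeasure \<nu> E)"

end

theory Submission
  imports Defs
begin

text \<open>
  Only the restriction of \<open>\<Psi>\<close> to \<open>B\<close> matters, and the central notion is that of a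
  contact pair: \<open>n \<in> B\<close> is in contact with \<open>m\<close> if \<open>\<Psi> n' \<ge> \<Psi> n + \<langle>m, n' - n\<rangle>\<close> on \<open>B\<close>. If
  \<open>n \<in> \<tau>\<^bsub>m0\<^esub>\<close>, then the contact persists when \<open>m\<close> is moved in the direction \<open>m0\<close>, and
  one can move until \<open>m\<close> lands in the star of \<open>m0\<close>; dually \<open>n\<close> can be moved in the
  direction of the normal of a facet containing \<open>m\<close>. Hence every \<open>m \<in> A\<close> has a contact
  point \<open>n\<close> with \<open>(m, n)\<close> in the support set. It is unique off a null set, as convex
  functions have a unique subgradient almost everywhere and \<open>\<beta>\<^sub>\<sigma>\<close> is injective where
  needed. This defines a map \<open>T\<close> from \<open>A\<close> to \<open>B\<close>, and the subgradient images in the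
  Monge-Ampere equation have measure \<open>\<mu>\<^sub>M(T\<^sup>-\<^sup>1 E)\<close>, because the projection along \<open>m0\<close>
  is injective and unimodular on the star of \<open>m0\<close>. So the Monge-Ampere equation says
  that \<open>T\<close> transports \<open>\<mu>\<^sub>M\<close> to \<open>\<nu>\<close> off the singular set, and \<open>(id, T)\<close> then is a plan
  carried by contact pairs in the support set. By Kantorovich duality, obtained from
  cyclical monotonicity and Rockafellar's theorem, optimal plans are exactly those
  supported on contact pairs of a Kantorovich potential.
\<close>

section \<open>Linear maps preserving Lebesgue measure\<close>

text \<open>Both pushing moves rest on one consequence of reflexivity: a facet functional is
  integral and at most 1 on the lattice points of \<open>\<Delta>\<close>, so there it is either 1
  or at most 0. A push therefore cannot violate the constraints that it is not aimed at. The main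
  obstacle is the converse half of the measure identity: a subgradient in a chart is tested only on
  one facet of the dual polytope, or on \<open>D \<sigma>\<close>, whereas contact is tested on all
  of \<open>B\<close>. Limits of nearby contact points bridge this: they dominate every directional
  derivative available in the chart, and a separating hyperplane then puts the subgradient into the
  convex hull of the contact points of \<open>n\<close>, up to multiples of \<open>m0\<close> in the
  facet case. On the singular set the equation says nothing; there equality of total masses forces
  the transported measure to vanish together with \<open>\<nu>\<close>. Uniqueness holds because two
  solutions share a contact point for almost every \<open>m\<close>, hence by closedness for every
  \<open>m\<close>; their transforms then differ by a constant on each facet and, \<open>A\<close>
  being connected, on all of \<open>A\<close>.\<close>

lemma measure_shear:
  fixes S :: "(real ^ 'k) set" and m n :: 'k
  defines "f \<equiv> \<lambda>x :: real ^ 'k. \<chi> i. if i = m then x $ m + x $ n else x $ i"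
  assumes "m \<noteq> n" "S \<in> lmeasurable"
  shows "f ` S \<in> lmeasurable \<and> measure lebesgue (f ` S) = measure lebesgue S"
proof -
  have lin: "linear f"
    unfolding f_def by (rule linearI) (auto simp: plus_vec_def scaleR_vec_def algebra_simps)
  have box: "measure lebesgue (f ` cbox a b) = 1 * measure lebesgue (cbox a b)" for a b
  proof (cases "cbox a b = {}")
    case False
    \<comment> \<open>Moves the box so that its \<open>n\<close>-th coordinates start at 0, as
      \<open>measure_shear_interval\<close> requires; by linearity the image is only
      translated.\<close>
    define v where "v = - ((a $ n) *\<^sub>R axis n (1::real) :: real ^ 'k)"
    have tr: "cbox (v + a) (v + b) = (+) v ` cbox a b"
      by (rule cbox_translation)
    have "cbox (v + a) (v + b) \<noteq> {}"
      using False tr by simp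
    moreover have "0 \<le> (v + a) $ n"
      by (simp add: v_def)
    ultimately have "measure lebesgue (f ` cbox (v + a) (v + b)) = measure lebesgue (cbox (v + a) (v + b))"
      unfolding f_def by (rule measure_shear_interval[OF \<open>m \<noteq> n\<close>])
    moreover have "f ` cbox (v + a) (v + b) = (+) (f v) ` f ` cbox a b"
      unfolding tr by (simp add: image_image linear_add[OF lin])
    ultimately show ?thesis
      by (simp add: tr measure_translation)
  qed simp
  show ?thesis
    using measure_linear_sufficient[OF lin \<open>S \<in> lmeasurable\<close> box] by simp
qed

text \<open>The map is an involution permuting the coordinates, so it takes boxes to boxes and
  merely permutes their side lengths.\<close>

lemma measure_swap:
  fixes S :: "(real ^ 'k) set" and m n :: 'k
  defines "f \<equiv> \<lambda>x :: real ^ 'k. \<chi> i. x $ Transposition.transpose m n i"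
  assumes "S \<in> lmeasurable"
  shows "f ` S \<in> lmeasurable \<and> measure lebesgue (f ` S) = measure lebesgue S"
proof -
  have lin: "linear f"
    unfolding f_def by (rule linearI) (auto simp: plus_vec_def scaleR_vec_def algebra_simps)
  have box: "measure lebesgue (f ` cbox a b) = 1 * measure lebesgue (cbox a b)" for a b
  proof (cases "cbox a b = {}")
    case False
    have eq: "f ` cbox a b = cbox (f a) (f b)"
    proof (intro equalityI subsetI)
      fix y assume "y \<in> cbox (f a) (f b)"
      then have *: "f a $ i \<le> y $ i \<and> y $ i \<le> f b $ i" for i
        by (simp add: mem_box_cart)
      have "f y \<in> cbox a b"
        using *[of "Transposition.transpose m n _"]
        by (auto simp: mem_box_cart f_def)
      moreover have "f (f y) = y"
        by (simp add: f_def vec_eq_iff)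
      ultimately show "y \<in> f ` cbox a b"
        by (metis imageI)
    qed (auto simp: mem_box_cart f_def)
    have ne: "f ` cbox a b \<noteq> {}"
      using False by blast
    have "(\<Prod>i\<in>UNIV. f b $ i - f a $ i) = (\<Prod>i\<in>UNIV. b $ i - a $ i)"
      unfolding f_def
      using prod.permute[OF permutes_swap_id[of m UNIV n], of "\<lambda>i. b $ i - a $ i"]
      by (simp add: o_def)
    then show ?thesis
      using ne False by (simp add: eq content_cbox_cart)
  qed simp
  show ?thesis
    using measure_linear_sufficient[OF lin \<open>S \<in> lmeasurable\<close> box] by simp
qed

lemma abs_det_shear:
  fixes m n :: "'k::finite"
  assumes "m \<noteq> n"
  shows "\<bar>det (matrix (\<lambda>x :: real ^ 'k. \<chi> i. if i = m then x $ m + x $ n else x $ i))\<bar> = 1"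
proof -
  have "matrix (\<lambda>x :: real ^ 'k. \<chi> i. if i = m then x $ m + x $ n else x $ i)
      = (\<chi> k. if k = m then row m (mat 1) + 1 *s row n (mat 1) else row k (mat 1))"
    by (auto simp: vec_eq_iff matrix_def row_def mat_def axis_def)
  then show ?thesis
    using det_row_operation[OF assms, of "mat 1" "1::real"] by simp
qed

lemma abs_det_swap:
  fixes m n :: "'k::finite"
  shows "\<bar>det (matrix (\<lambda>x :: real ^ 'k. \<chi> i. x $ Transposition.transpose m n i))\<bar> = 1"
proof -
  have "matrix (\<lambda>x :: real ^ 'k. \<chi> i. x $ Transposition.transpose m n i)
      = (\<chi> i. mat 1 $ Transposition.transpose m n i)"
    by (auto simp: vec_eq_iff matrix_def mat_def axis_def)
  then show ?thesis
    by (simp add: det_permute_rows permutes_swap_id sign_swap_id abs_mult)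
qed

text \<open>The library version requires a well-ordered index type.\<close>

lemma measure_linear_image_finite:
  fixes f :: "real ^ 'k \<Rightarrow> real ^ 'k"
  assumes "linear f" "S \<in> lmeasurable"
  shows "f ` S \<in> lmeasurable \<and> measure lebesgue (f ` S) = \<bar>det (matrix f)\<bar> * measure lebesgue S"
proof -
  have "\<forall>S\<in>lmeasurable. f ` S \<in> lmeasurable \<and>
      measure lebesgue (f ` S) = \<bar>det (matrix f)\<bar> * measure lebesgue S"
  proof (rule induct_linear_elementary[OF \<open>linear f\<close>])
    fix f g :: "real ^ 'k \<Rightarrow> real ^ 'k"
    assume "linear f" "linear g"
      and f: "\<forall>S\<in>lmeasurable. f ` S \<in> lmeasurable \<and>
        measure lebesgue (f ` S) = \<bar>det (matrix f)\<bar> * measure lebesgue S"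
      and g: "\<forall>S\<in>lmeasurable. g ` S \<in> lmeasurable \<and>
        measure lebesgue (g ` S) = \<bar>det (matrix g)\<bar> * measure lebesgue S"
    show "\<forall>S\<in>lmeasurable. (f \<circ> g) ` S \<in> lmeasurable \<and>
        measure lebesgue ((f \<circ> g) ` S) = \<bar>det (matrix (f \<circ> g))\<bar> * measure lebesgue S"
      unfolding matrix_compose[OF \<open>linear g\<close> \<open>linear f\<close>] det_mul image_comp[symmetric] abs_mult
      using f g by (simp add: mult.assoc)
  next
    fix f :: "real ^ 'k \<Rightarrow> real ^ 'k" and i
    assume "linear f" and 0: "\<And>x. f x $ i = 0"
    have "\<not> surj f"
      using 0 by (metis (full_types) one_neq_zero surjE vec_component)
    then have "\<not> inj f"
      using linear_injective_imp_surjective[OF \<open>linear f\<close>] by blast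
    then have "det (matrix f) = 0"
      using det_nz_iff_inj[OF \<open>linear f\<close>] by blast
    moreover have "negligible (f ` S)" for S
      using negligible_linear_singular_image[OF \<open>linear f\<close> \<open>\<not> inj f\<close>] .
    ultimately show "\<forall>S\<in>lmeasurable. f ` S \<in> lmeasurable \<and>
        measure lebesgue (f ` S) = \<bar>det (matrix f)\<bar> * measure lebesgue S"
      by (auto simp: negligible_iff_measure)
  next
    fix c :: "'k \<Rightarrow> real"
    show "\<forall>S\<in>lmeasurable. (\<lambda>a. \<chi> i. c i * a $ i) ` S \<in> lmeasurable \<and>
        measure lebesgue ((\<lambda>a. \<chi> i. c i * a $ i) ` S)
          = \<bar>det (matrix (\<lambda>a. \<chi> i. c i * a $ i))\<bar> * measure lebesgue S"
      by (auto simp: measurable_stretch measure_stretch axis_def matrix_def det_diagonal)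
  next
    fix m n :: 'k assume "m \<noteq> n"
    show "\<forall>S\<in>lmeasurable. (\<lambda>x. \<chi> i. x $ Transposition.transpose m n i) ` S \<in> lmeasurable \<and>
        measure lebesgue ((\<lambda>x :: real ^ 'k. \<chi> i. x $ Transposition.transpose m n i) ` S)
          = \<bar>det (matrix (\<lambda>x :: real ^ 'k. \<chi> i. x $ Transposition.transpose m n i))\<bar> * measure lebesgue S"
      using measure_swap[of _ m n] abs_det_swap[of m n] by simp
    show "\<forall>S\<in>lmeasurable. (\<lambda>x. \<chi> i. if i = m then x $ m + x $ n else x $ i) ` S \<in> lmeasurable \<and>
        measure lebesgue ((\<lambda>x :: real ^ 'k. \<chi> i. if i = m then x $ m + x $ n else x $ i) ` S)
          = \<bar>det (matrix (\<lambda>x :: real ^ 'k. \<chi> i. if i = m then x $ m + x $ n else x $ i))\<bar>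
            * measure lebesgue S"
      using measure_shear[OF \<open>m \<noteq> n\<close>] abs_det_shear[OF \<open>m \<noteq> n\<close>] by simp
  qed
  then show ?thesis
    using assms(2) by blast
qed

section \<open>Unimodular maps\<close>

lemma det_in_Ints:
  fixes A :: "real ^ 'k ^ 'k"
  assumes "\<And>i j. A $ i $ j \<in> \<int>"
  shows "det A \<in> \<int>"
  unfolding det_def by (intro Ints_sum Ints_mult Ints_prod) (auto intro: assms)

text \<open>Both determinants are integers and their product is 1, so each is a unit of the ring of
  integers.\<close>

lemma abs_det_unimodular:
  fixes f g :: "real ^ 'k \<Rightarrow> real ^ 'k"
  assumes "linear f" "linear g" "\<And>x. g (f x) = x"
    and "\<And>i j. f (axis j 1) $ i \<in> \<int>" "\<And>i j. g (axis j 1) $ i \<in> \<int>"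
  shows "\<bar>det (matrix f)\<bar> = 1"
proof -
  have "matrix g ** matrix f = mat 1"
    using matrix_compose[OF assms(1,2)] assms(3) by (simp add: o_def matrix_id_mat_1[unfolded id_def])
  then have *: "det (matrix g) * det (matrix f) = 1"
    by (metis det_I det_mul)
  have "det (matrix f) \<in> \<int>" "det (matrix g) \<in> \<int>"
    by (auto intro!: det_in_Ints simp: matrix_def assms)
  then obtain p q where "det (matrix f) = of_int p" "det (matrix g) = of_int q"
    by (auto elim!: Ints_cases)
  moreover from this * have "q * p = 1"
    by (metis of_int_1 of_int_eq_iff of_int_mult)
  ultimately show ?thesis
    by (metis abs_1 abs_zmult_eq_1 mult.commute of_int_1 of_int_abs)
qed

lemma emeasure_unimodular_affine_image:
  fixes f :: "real ^ 'k \<Rightarrow> real ^ 'k"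
  assumes "linear f" "\<bar>det (matrix f)\<bar> = 1" "S \<in> lmeasurable"
  shows "(\<lambda>x. c + f x) ` S \<in> lmeasurable"
    and "emeasure lebesgue ((\<lambda>x. c + f x) ` S) = emeasure lebesgue S"
proof -
  have eq: "(\<lambda>x. c + f x) ` S = (+) c ` f ` S"
    by (simp add: image_image)
  have f: "f ` S \<in> lmeasurable" "measure lebesgue (f ` S) = measure lebesgue S"
    using measure_linear_image_finite[OF assms(1,3)] assms(2) by auto
  then show l: "(\<lambda>x. c + f x) ` S \<in> lmeasurable"
    unfolding eq by (intro measurable_translation)
  have "measure lebesgue ((\<lambda>x. c + f x) ` S) = measure lebesgue S"
    using f unfolding eq by (simp add: measure_translation)
  then show "emeasure lebesgue ((\<lambda>x. c + f x) ` S) = emeasure lebesgue S"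
    using l assms(3) by (simp add: emeasure_eq_measure2)
qed

text \<open>Nullity without Fubini: the translates \<open>S + v/j\<close> are disjoint, of equal measure and
  contained in a bounded set.\<close>

lemma negligible_if_lines_meet_once:
  fixes S :: "'a::euclidean_space set"
  assumes "compact S" "\<And>x t. x \<in> S \<Longrightarrow> 0 < t \<Longrightarrow> x + t *\<^sub>R v \<notin> S"
  shows "negligible S"
proof -
  define s where "s j = 1 / (real j + 1)" for j :: nat
  \<comment> \<open>The factor 1 only serves to match the form of
    \<open>emeasure_lebesgue_affine\<close>.\<close>
  define C where "C j = (\<lambda>x. 1 *\<^sub>R x + s j *\<^sub>R v) ` S" for j
  have sinj: "s i \<noteq> s j" if "i \<noteq> j" for i j
    using that by (auto simp: s_def field_simps)
  have s01: "0 < s j" "s j \<le> 1" for j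
    by (auto simp: s_def)
  have comp: "compact (C j)" for j
    unfolding C_def by (intro compact_continuous_image continuous_intros assms)
  then have meas: "C j \<in> sets lebesgue" for j
    by (simp add: borel_compact)
  have em: "emeasure lebesgue (C j) = emeasure lebesgue S" for j
    unfolding C_def using emeasure_lebesgue_affine[of 1 "s j *\<^sub>R v" S] by simp
  have "disjoint_family C"
  proof (rule ccontr)
    assume "\<not> disjoint_family C"
    then obtain i j where "i \<noteq> j" "C i \<inter> C j \<noteq> {}"
      unfolding disjoint_family_on_def by blast
    then obtain x y where xy: "x \<in> S" "y \<in> S" "x + s i *\<^sub>R v = y + s j *\<^sub>R v"
      unfolding C_def by force
    show False
    proof (cases "s i > s j")
      case True
      then have "y = x + (s i - s j) *\<^sub>R v"
        using xy(3) by (simp add: algebra_simps)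
      then show False
        using assms(2)[OF xy(1), of "s i - s j"] xy(2) True by simp
    next
      case False
      then have "s j - s i > 0"
        using sinj[OF \<open>i \<noteq> j\<close>] by linarith
      moreover have "x = y + (s j - s i) *\<^sub>R v"
        using xy(3) by (simp add: algebra_simps)
      ultimately show False
        using assms(2)[OF xy(2), of "s j - s i"] xy(1) by simp
    qed
  qed
  then have sum: "(\<Sum>j. emeasure lebesgue (C j)) = emeasure lebesgue (\<Union>j. C j)"
    by (intro suminf_emeasure) (auto simp: meas)
  obtain B where B: "\<And>x. x \<in> S \<Longrightarrow> norm x \<le> B"
    using compact_imp_bounded[OF assms(1)] unfolding bounded_iff by blast
  have "(\<Union>j. C j) \<subseteq> cball 0 (B + norm v)"
  proof
    fix y assume "y \<in> (\<Union>j. C j)"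
    then obtain x j where "x \<in> S" "y = x + s j *\<^sub>R v"
      unfolding C_def by auto
    then have "norm y \<le> norm x + s j * norm v"
      using norm_triangle_ineq[of x "s j *\<^sub>R v"] s01[of j] by simp
    also have "\<dots> \<le> B + norm v"
      using B[OF \<open>x \<in> S\<close>] mult_right_mono[OF s01(2)[of j], of "norm v"] by simp
    finally show "y \<in> cball 0 (B + norm v)"
      by simp
  qed
  then have "emeasure lebesgue (\<Union>j. C j) \<le> emeasure lebesgue (cball 0 (B + norm v) :: 'a set)"
    by (intro emeasure_mono) auto
  also have "\<dots> < \<infinity>"
    using emeasure_bounded_finite[of "cball 0 (B + norm v) :: 'a set"] by simp
  \<comment> \<open>Infinitely many copies of the measure of \<open>S\<close> have a finite sum, so
    that measure is 0.\<close>
  finally have "(\<Sum>j::nat. ennreal 1) * emeasure lebesgue S < top"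
    using sum unfolding ennreal_suminf_multc[symmetric] by (simp add: em)
  moreover have "(\<Sum>j::nat. ennreal 1) = top"
    by (intro summable_iff_suminf_neq_top) (auto simp: summable_const_iff)
  ultimately have "emeasure lebesgue S = 0"
    by (simp add: ennreal_top_mult split: if_split_asm)
  with borel_compact[OF assms(1)] show ?thesis
    by (simp add: negligible_iff_null_sets null_sets_def)
qed

section \<open>Suprema of affine functions\<close>

lemma c_transform_eqI:
  assumes "y \<in> S" "\<And>y'. y' \<in> S \<Longrightarrow> x \<bullet> y' - f y' \<le> x \<bullet> y - f y"
  shows "c_transform S f x = x \<bullet> y - f y"
  unfolding c_transform_def by (rule cSup_eq_maximum) (use assms in auto)

lemma c_transform_attained:
  assumes "compact S" "S \<noteq> {}" "continuous_on S f"
  obtains y where "y \<in> S" "c_transform S f x = x \<bullet> y - f y"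
    "\<And>y'. y' \<in> S \<Longrightarrow> x \<bullet> y' - f y' \<le> x \<bullet> y - f y"
proof -
  have "continuous_on S (\<lambda>y. x \<bullet> y - f y)"
    by (intro continuous_intros assms)
  then obtain y where y: "y \<in> S" "\<forall>y'\<in>S. x \<bullet> y' - f y' \<le> x \<bullet> y - f y"
    using continuous_attains_sup[OF assms(1,2)] by blast
  then show ?thesis
    using that[of y] c_transform_eqI[of y S x f] by blast
qed

lemma c_transform_ge:
  assumes "compact S" "continuous_on S f" "y \<in> S"
  shows "x \<bullet> y - f y \<le> c_transform S f x"
proof -
  obtain y0 where "y0 \<in> S" "c_transform S f x = x \<bullet> y0 - f y0"
    "\<And>y'. y' \<in> S \<Longrightarrow> x \<bullet> y' - f y' \<le> x \<bullet> y0 - f y0"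
    using c_transform_attained[OF assms(1) _ assms(2), of x] assms(3) by blast
  then show ?thesis
    using assms(3) by auto
qed

text \<open>A supremum of affine functions whose slopes have norm at most \<open>K\<close>.\<close>

lemma c_transform_lipschitz:
  assumes "compact S" "S \<noteq> {}" "continuous_on S f" "\<And>y. y \<in> S \<Longrightarrow> norm y \<le> K"
  shows "\<bar>c_transform S f x - c_transform S f x'\<bar> \<le> K * norm (x - x')"
proof -
  have *: "c_transform S f x - c_transform S f x' \<le> K * norm (x - x')" for x x'
  proof -
    obtain y where y: "y \<in> S" "c_transform S f x = x \<bullet> y - f y"
      using c_transform_attained[OF assms(1-3)] by metis
    then have "c_transform S f x - c_transform S f x' \<le> (x - x') \<bullet> y"
      using c_transform_ge[OF assms(1,3) y(1), of x'] by (simp add: inner_diff_left)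
    also have "\<dots> \<le> norm (x - x') * norm y"
      by (rule norm_cauchy_schwarz)
    also have "\<dots> \<le> norm (x - x') * K"
      using assms(4)[OF y(1)] by (rule mult_left_mono) simp
    finally show ?thesis
      by (simp add: mult.commute)
  qed
  show ?thesis
    using *[of x x'] *[of x' x] by (simp add: abs_le_iff norm_minus_commute)
qed

lemma continuous_on_lipschitz:
  fixes f :: "'a::real_normed_vector \<Rightarrow> real"
  assumes "\<And>x x'. x \<in> S \<Longrightarrow> x' \<in> S \<Longrightarrow> \<bar>f x - f x'\<bar> \<le> K * norm (x - x')"
  shows "continuous_on S f"
proof (rule lipschitz_on_continuous_on)
  \<comment> \<open>A Lipschitz constant has to be non-negative, and \<open>K\<close> may be
    negative.\<close>
  show "(max K 0)-lipschitz_on S f"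
  proof (rule lipschitz_onI)
    fix x y assume "x \<in> S" "y \<in> S"
    then have "\<bar>f x - f y\<bar> \<le> K * norm (x - y)"
      by (rule assms)
    also have "\<dots> \<le> max K 0 * norm (x - y)"
      by (intro mult_right_mono) auto
    finally show "dist (f x) (f y) \<le> max K 0 * dist x y"
      by (simp add: dist_norm)
  qed simp
qed

lemma c_transform_continuous_on:
  assumes "compact S" "S \<noteq> {}" "continuous_on S f"
  shows "continuous_on T (c_transform S f)"
proof -
  obtain K where "\<And>y. y \<in> S \<Longrightarrow> norm y \<le> K"
    using compact_imp_bounded[OF assms(1)] unfolding bounded_iff by blast
  then show ?thesis
    by (intro continuous_on_lipschitz c_transform_lipschitz[OF assms])
qed

lemma c_transform_convex_on:
  assumes "compact S" "S \<noteq> {}" "continuous_on S f"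
  shows "convex_on UNIV (c_transform S f)"
proof (rule convex_onI)
  fix t :: real and x x' :: "real ^ 'a" assume t: "0 < t" "t < 1"
  let ?x = "(1 - t) *\<^sub>R x + t *\<^sub>R x'"
  obtain y where y: "y \<in> S" "c_transform S f ?x = ?x \<bullet> y - f y"
    using c_transform_attained[OF assms] by metis
  have "?x \<bullet> y - f y = (1 - t) * (x \<bullet> y - f y) + t * (x' \<bullet> y - f y)"
    by (simp add: algebra_simps inner_add_left)
  also have "\<dots> \<le> (1 - t) * c_transform S f x + t * c_transform S f x'"
    using t by (intro add_mono mult_left_mono c_transform_ge[OF assms(1,3) y(1)]) auto
  finally show "c_transform S f ?x \<le> (1 - t) * c_transform S f x + t * c_transform S f x'"
    using y(2) by simp
qed simp

text \<open>Separates the point of the graph over \<open>x\<close> from the strict epigraph and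
  normalises the separating functional to a slope.\<close>

lemma convex_on_UNIV_subgradient:
  fixes f :: "'a::euclidean_space \<Rightarrow> real"
  assumes "convex_on UNIV f"
  obtains p where "\<And>y. f y \<ge> f x + p \<bullet> (y - x)"
proof -
  let ?S = "{(x, f x)}" and ?T = "{(y, r) | y r. f y < r}"
  have "convex ?T"
  proof (rule convexI)
    fix a b :: "'a \<times> real" and u v :: real
    assume ab: "a \<in> ?T" "b \<in> ?T" and uv: "0 \<le> u" "0 \<le> v" "u + v = 1"
    then have "f (u *\<^sub>R fst a + v *\<^sub>R fst b) \<le> u * f (fst a) + v * f (fst b)"
      using assms unfolding convex_on_def by auto
    also have "\<dots> < u * snd a + v * snd b"
    proof (cases "u = 0")
      case False
      then have "u * f (fst a) < u * snd a" "v * f (fst b) \<le> v * snd b"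
        using ab uv by (auto intro!: mult_left_mono)
      then show ?thesis by linarith
    qed (use ab uv in auto)
    finally show "u *\<^sub>R a + v *\<^sub>R b \<in> ?T"
      by (auto simp: prod_eq_iff)
  qed
  moreover have "?T \<noteq> {}"
    using gt_ex[of "f x"] by blast
  ultimately obtain a b where ab: "a \<noteq> 0" "a \<bullet> (x, f x) \<le> b" "\<And>z. z \<in> ?T \<Longrightarrow> b \<le> a \<bullet> z"
    using separating_hyperplane_sets[of ?S ?T] by auto
  obtain c r where a: "a = (c, r)"
    by (cases a)
  have sep: "c \<bullet> x + r * f x \<le> c \<bullet> y + r * s" if "f y < s" for y s
    using ab(2) ab(3)[of "(y, s)"] that by (simp add: a)
  have "r \<ge> 0"
    using sep[of x "f x + 1"] by (simp add: algebra_simps)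
  \<comment> \<open>A vertical hyperplane is impossible because \<open>f\<close> is finite
    everywhere: testing at \<open>x - c\<close> would give \<open>c = 0\<close>.\<close>
  moreover have "r \<noteq> 0"
  proof
    assume "r = 0"
    then have "c \<bullet> x \<le> c \<bullet> (x - c)"
      using sep[of "x - c" "f (x - c) + 1"] by simp
    then have "c = 0"
      by (metis add_le_cancel_left diff_add_cancel diff_conv_add_uminus inner_diff_right inner_gt_zero_iff le_add_same_cancel1 neg_0_le_iff_le not_le)
    then show False
      using ab(1) a \<open>r = 0\<close> by (simp add: zero_prod_def)
  qed
  ultimately have r: "r > 0"
    by simp
  have "f y \<ge> f x + (- (1 / r) *\<^sub>R c) \<bullet> (y - x)" for y
  \<comment> \<open>The strict epigraph only gives the inequality for values above
    \<open>f y\<close>.\<close>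
  proof (rule field_le_epsilon)
    fix e :: real assume "0 < e"
    then have "c \<bullet> x + r * f x \<le> c \<bullet> y + r * (f y + e)"
      by (intro sep) simp
    then have "(c \<bullet> x - c \<bullet> y) / r + f x \<le> f y + e"
      using r by (simp add: field_simps)
    then show "f x + (- (1 / r) *\<^sub>R c) \<bullet> (y - x) \<le> f y + e"
      by (simp add: inner_diff_right diff_divide_distrib algebra_simps)
  qed
  then show ?thesis
    using that by blast
qed

section \<open>Facets and primitive normals\<close>

text \<open>A face meeting the relative interior of \<open>F\<close> contains \<open>F\<close>. As
  \<open>F\<close> has codimension one, there is no dimension left for a proper face strictly above
  it.\<close>

lemma facet_eq_face:
  fixes S :: "'a::euclidean_space set"
  assumes "convex S" "F facet_of S" "G face_of S" "G \<noteq> S" "x \<in> rel_interior F" "x \<in> G"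
  shows "F = G"
proof (rule ccontr)
  have F: "F face_of S" "aff_dim F = aff_dim S - 1"
    using assms(2) by (auto simp: facet_of_def)
  have "F \<subseteq> G"
    using subset_of_face_of[OF assms(3)] F(1) face_of_imp_subset assms(5,6) by blast
  then have "F face_of G"
    using F(1) assms(3) face_of_subset face_of_imp_subset by blast
  moreover assume "F \<noteq> G"
  ultimately have "aff_dim F < aff_dim G"
    using face_of_aff_dim_lt face_of_imp_convex[OF assms(3)] by blast
  moreover have "aff_dim G < aff_dim S"
    using face_of_aff_dim_lt[OF assms(1,3,4)] .
  ultimately show False
    using F(2) by simp
qed

text \<open>A relative interior point of \<open>F\<close> is not interior to \<open>S\<close>, so
  one of the finitely many inequalities is tight there. Its tight set is a proper face, and
  \<open>facet_eq_face\<close> identifies it with \<open>F\<close>.\<close>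

lemma facet_of_halfspaces:
  fixes I :: "'a::euclidean_space set"
  assumes "finite I" "0 \<notin> I" "S = {x. \<forall>a\<in>I. a \<bullet> x \<le> c a}" "interior S \<noteq> {}" "F facet_of S"
  obtains a where "a \<in> I" "F = S \<inter> {x. a \<bullet> x = c a}"
proof -
  have "convex S"
    unfolding assms(3) by (simp add: convex_def inner_add_right)
      (smt (verit, ccfv_SIG) convex_bound_le)
  have F: "F face_of S" "F \<noteq> {}" "aff_dim F = aff_dim S - 1"
    using assms(5) by (auto simp: facet_of_def)
  then have "rel_interior F \<noteq> {}"
    using face_of_imp_convex[OF F(1)] rel_interior_eq_empty by blast
  then obtain x where x: "x \<in> rel_interior F"
    by blast
  have "x \<notin> interior S"
    using face_of_disjoint_interior[OF F(1)] x rel_interior_subset F(3) by fastforce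
  have "\<exists>a\<in>I. \<not> a \<bullet> x < c a"
  proof (rule ccontr)
    assume "\<not> ?thesis"
    then have "x \<in> (\<Inter>a\<in>I. {x. a \<bullet> x < c a})"
      by auto
    moreover have "open (\<Inter>a\<in>I. {x. a \<bullet> x < c a})"
      by (intro open_INT assms(1) ballI open_halfspace_lt)
    moreover have "(\<Inter>a\<in>I. {x. a \<bullet> x < c a}) \<subseteq> S"
      unfolding assms(3) by (auto intro: less_imp_le)
    ultimately show False
      using \<open>x \<notin> interior S\<close> interiorI by blast
  qed
  moreover have "x \<in> S"
    using x rel_interior_subset F(1) face_of_imp_subset by blast
  ultimately obtain a where a: "a \<in> I" "a \<bullet> x = c a"
    unfolding assms(3) by force
  define G where "G = S \<inter> {x. a \<bullet> x = c a}"
  have le: "y \<in> S \<Longrightarrow> a \<bullet> y \<le> c a" for y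
    using a(1) assms(3) by auto
  have G: "G face_of S"
    unfolding G_def using face_of_Int_supporting_hyperplane_le[OF \<open>convex S\<close> le] .
  have "G \<noteq> S"
  proof
    assume "G = S"
    then have "interior S \<subseteq> interior {x. a \<bullet> x = c a}"
      unfolding G_def by (intro interior_mono) auto
    moreover have "a \<noteq> 0"
      using a(1) assms(2) by auto
    ultimately show False
      using assms(4) by simp
  qed
  have "x \<in> G"
    using \<open>x \<in> S\<close> a(2) by (simp add: G_def)
  then have "F = G"
    using facet_eq_face[OF \<open>convex S\<close> assms(5) G \<open>G \<noteq> S\<close> x] by blast
  then show ?thesis
    using that a(1) G_def by blast
qed

lemma parallel_hyperplanes:
  fixes v w :: "'a::euclidean_space"
  assumes "v \<noteq> 0" "S \<noteq> {}" "S \<subseteq> {x. v \<bullet> x = c}" "aff_dim S = DIM('a) - 1" "S \<subseteq> {x. w \<bullet> x = c'}"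
  obtains t where "w = t *\<^sub>R v"
proof -
  have hull: "affine hull S \<subseteq> {x. v \<bullet> x = c}"
    using assms(3) by (simp add: affine_hyperplane hull_minimal)
  have eq: "affine hull S = {x. v \<bullet> x = c}"
    using assms hull by (intro affine_dim_equal) (auto simp: affine_hyperplane aff_dim_affine_hull)
  have sub: "{x. v \<bullet> x = c} \<subseteq> {x. w \<bullet> x = c'}"
    unfolding eq[symmetric] using assms(5) by (simp add: affine_hyperplane hull_minimal)
  \<comment> \<open>\<open>u\<close> will be the component of \<open>w\<close> orthogonal to
    \<open>v\<close>; translation by it preserves the hyperplane, on which \<open>w\<close> is
    constant.\<close>
  define t where "t = (w \<bullet> v) / (v \<bullet> v)"
  define u where "u = w - t *\<^sub>R v"
  have "u \<bullet> v = 0"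
    using assms(1) by (simp add: u_def t_def inner_diff_left)
  obtain x where x: "v \<bullet> x = c"
    using assms(2,3) by auto
  then have "v \<bullet> (x + u) = c"
    using \<open>u \<bullet> v = 0\<close> by (simp add: inner_add_right inner_commute)
  then have "w \<bullet> (x + u) = c'" "w \<bullet> x = c'"
    using sub x by auto
  then have "w \<bullet> u = 0"
    by (simp add: inner_add_right)
  moreover have "u \<bullet> u = w \<bullet> u - t * (v \<bullet> u)"
    by (simp add: u_def inner_diff_left)
  ultimately have "u = 0"
    using \<open>u \<bullet> v = 0\<close> by (simp add: inner_commute)
  then show ?thesis
    using that[of t] u_def by simp
qed

section \<open>Primitive lattice vectors\<close>

lemma inner_int_lattice:
  "v \<in> int_lattice \<Longrightarrow> w \<in> int_lattice \<Longrightarrow> v \<bullet> w \<in> \<int>"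
  unfolding int_lattice_def inner_vec_def by (auto intro!: Ints_sum)

text \<open>A divisor of \<open>v\<close> in the lattice also divides its pairing with
  \<open>u\<close>, which is 1.\<close>

lemma primitive_vecI:
  assumes "v \<in> int_lattice" "u \<in> int_lattice" "v \<bullet> u = 1"
  shows "primitive_vec v"
  unfolding primitive_vec_def
proof (intro conjI ballI allI impI)
  fix w :: "real ^ 'a" and k :: int
  assume "w \<in> int_lattice" "v = of_int k *\<^sub>R w"
  then obtain j where "w \<bullet> u = of_int j"
    using inner_int_lattice[OF _ assms(2)] Ints_cases by metis
  then have "k * j = 1"
    using assms(3) \<open>v = _\<close> by (metis inner_scaleR_left of_int_1 of_int_eq_iff of_int_mult)
  then show "\<bar>k\<bar> = 1"
    by (metis abs_zmult_eq_1 abs_1)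
qed (rule assms)

text \<open>Makes the definite description usable. A competing normal is a positive multiple of
  \<open>v\<close>; pairing with \<open>u\<close> shows that the factor is an integer, and
  primitivity that it is 1.\<close>

lemma primitive_normal_eqI:
  fixes P :: "(real ^ 'n) set"
  assumes P: "convex P" "interior P \<noteq> {}" and F: "F facet_of P"
    and v: "v \<in> int_lattice" "u \<in> int_lattice" "v \<bullet> u = 1"
    and Pv: "P \<subseteq> {x. v \<bullet> x \<le> c}" "F = P \<inter> {x. v \<bullet> x = c}"
  shows "primitive_normal P F = v"
  unfolding primitive_normal_def
proof (rule the_equality)
  show "primitive_vec v \<and> (\<exists>c. P \<subseteq> {x. v \<bullet> x \<le> c} \<and> F = P \<inter> {x. v \<bullet> x = c})"
    using primitive_vecI[OF v] Pv by blast
  fix w assume w: "primitive_vec w \<and> (\<exists>c. P \<subseteq> {x. w \<bullet> x \<le> c} \<and> F = P \<inter> {x. w \<bullet> x = c})"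
  then obtain c' where c': "P \<subseteq> {x. w \<bullet> x \<le> c'}" "F = P \<inter> {x. w \<bullet> x = c'}"
    by blast
  have "v \<noteq> 0"
    using v(3) by auto
  have F': "F \<noteq> {}" "aff_dim F = int (CARD('n)) - 1"
    using F P(2) by (auto simp: facet_of_def aff_dim_nonempty_interior)
  obtain t where t: "w = t *\<^sub>R v"
    by (rule parallel_hyperplanes[OF \<open>v \<noteq> 0\<close> F'(1), of c w c']) (use Pv c' F' in auto)
  have "w \<noteq> 0"
  proof
    assume "w = 0"
    then have "w = of_int 0 *\<^sub>R w"
      by simp
    then show False
      using w unfolding primitive_vec_def by (metis abs_0 zero_neq_one)
  qed
  obtain p where p: "p \<in> interior P"
    using P(2) by blast
  have "v \<bullet> p < c" "w \<bullet> p < c'"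
    using p interior_mono[OF Pv(1)] interior_mono[OF c'(1)] \<open>v \<noteq> 0\<close> \<open>w \<noteq> 0\<close> by auto
  moreover obtain x where "x \<in> F"
    using F'(1) by blast
  ultimately have "v \<bullet> (x - p) > 0" "t * (v \<bullet> (x - p)) > 0"
    using Pv(2) c'(2) t by (auto simp: inner_diff_right algebra_simps)
  then have "t > 0"
    by (simp add: zero_less_mult_iff)
  have "w \<bullet> u \<in> \<int>"
    using w v(2) inner_int_lattice unfolding primitive_vec_def by blast
  then obtain k where k: "t = of_int k"
    using t v(3) by (auto elim: Ints_cases)
  then have "\<bar>k\<bar> = 1"
    using w v(1) t unfolding primitive_vec_def by blast
  then show "w = v"
    using t k \<open>t > 0\<close> by (simp add: abs_if split: if_splits)
qed

section \<open>Cyclical monotonicity of optimal plans\<close>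

text \<open>Take \<open>k\<close> independent copies \<open>z\<^sub>0, \<dots>, z\<^bsub>k-1\<^esub>\<close> of a \<open>\<Gamma>\<close>-distributed point. Whenever
  \<open>z\<^sub>i \<in> W\<^sub>i\<close> for all \<open>i\<close>, permute their second components; then choose an index at random. This
  changes neither marginal, but increases the mean of \<open>C\<close>.\<close>

lemma cyclic_improvement:
  fixes \<Gamma> :: "('a::euclidean_space \<times> 'a) measure" and C :: "'a \<times> 'a \<Rightarrow> ennreal"
    and k :: nat
  assumes sets: "sets \<Gamma> = sets (restrict_space borel (S1 \<times> S2))" and fin: "finite_measure \<Gamma>"
    and C: "C \<in> borel_measurable \<Gamma>" "integral\<^sup>N \<Gamma> C < \<infinity>"
    and k: "0 < k" and s: "bij_betw s {..<k} {..<k}"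
    and W: "\<And>i. i < k \<Longrightarrow> W i \<in> sets \<Gamma>" "\<And>i. i < k \<Longrightarrow> emeasure \<Gamma> (W i) > 0"
    and d: "d > 0" "\<And>z. (\<And>i. i < k \<Longrightarrow> z i \<in> W i) \<Longrightarrow>
      (\<Sum>i<k. C (z i)) + d \<le> (\<Sum>i<k. C (fst (z i), snd (z (s i))))"
  obtains \<Gamma>' where "sets \<Gamma>' = sets \<Gamma>"
    "\<And>X. X \<times> S2 \<in> sets \<Gamma> \<Longrightarrow> emeasure \<Gamma>' (X \<times> S2) = emeasure \<Gamma> (X \<times> S2)"
    "\<And>Y. S1 \<times> Y \<in> sets \<Gamma> \<Longrightarrow> emeasure \<Gamma>' (S1 \<times> Y) = emeasure \<Gamma> (S1 \<times> Y)"
    "integral\<^sup>N \<Gamma> C < integral\<^sup>N \<Gamma>' C"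
proof -
  interpret finite_measure \<Gamma> by fact
  have space: "space \<Gamma> = S1 \<times> S2"
    using sets_eq_imp_space_eq[OF sets] by (simp add: space_restrict_space)
  have sk: "s i < k" if "i < k" for i
    using s that by (auto simp: bij_betw_def)
  have Wk: "W i \<subseteq> S1 \<times> S2" if "i < k" for i
    using sets.sets_into_space[OF W(1)[OF that]] space by simp
  define G where "G = emeasure \<Gamma> (space \<Gamma>)"
  have "0 < emeasure \<Gamma> (W 0)" "emeasure \<Gamma> (W 0) \<le> G"
    unfolding G_def using k W[of 0] by (auto intro!: emeasure_mono sets.sets_into_space)
  moreover have "G < \<infinity>"
    unfolding G_def using emeasure_finite[of "space \<Gamma>"] by (metis infinity_ennreal_def less_top)
  ultimately have G: "0 < G" "G < \<infinity>"
    by auto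
  \<comment> \<open>Normalises \<open>\<Gamma>\<close> to a probability measure, so that every
    coordinate of the product has law \<open>\<Gamma>1\<close>.\<close>
  define c where "c = inverse G"
  have Gc: "G * c = 1"
    using G unfolding c_def divide_ennreal_def[symmetric] by (intro ennreal_divide_self) auto
  have c: "0 < c"
    using Gc by (cases "c = 0") (auto simp: zero_less_iff_neq_zero)
  define \<Gamma>1 where "\<Gamma>1 = scale_measure c \<Gamma>"
  have \<Gamma>1: "sets \<Gamma>1 = sets \<Gamma>" "space \<Gamma>1 = S1 \<times> S2" "\<And>E. emeasure \<Gamma>1 E = c * emeasure \<Gamma> E"
    by (simp_all add: \<Gamma>1_def space_scale_measure space)
  have one: "emeasure \<Gamma>1 (space \<Gamma>1) = 1"
    using Gc \<Gamma>1 by (simp add: G_def space mult.commute)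
  then interpret G1: finite_measure \<Gamma>1
    by (intro finite_measureI) simp
  interpret PS: product_sigma_finite "\<lambda>_ :: nat. \<Gamma>1"
    by (rule product_sigma_finite.intro) (rule G1.sigma_finite_measure_axioms)
  define P where "P = PiM {..<k} (\<lambda>_. \<Gamma>1)"
  have emP: "emeasure P (PiE {..<k} F) = (\<Prod>i<k. emeasure \<Gamma>1 (F i))" if "\<And>i. i < k \<Longrightarrow> F i \<in> sets \<Gamma>" for F
    unfolding P_def using that \<Gamma>1(1) by (subst PS.emeasure_PiM) auto
  have spaceP: "space P = PiE {..<k} (\<lambda>_. S1 \<times> S2)"
    by (simp add: P_def space_PiM \<Gamma>1)
  have "emeasure P (space P) = 1"
    using emP[of "\<lambda>_. S1 \<times> S2"] sets.top[of \<Gamma>] one by (simp add: spaceP space \<Gamma>1(2))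
  then interpret P: finite_measure P
    by (intro finite_measureI) simp
  have comp_meas: "(\<lambda>z. z j) \<in> measurable P \<Gamma>" if "j < k" for j
    using measurable_component_singleton[of j "{..<k}" "\<lambda>_. \<Gamma>1"] that \<Gamma>1(1)
    by (simp add: P_def cong: measurable_cong_sets)
  have distr_comp: "distr P \<Gamma>1 (\<lambda>z. z j) = \<Gamma>1" if j: "j < k" for j
  proof (rule measure_eqI)
    fix E assume "E \<in> sets (distr P \<Gamma>1 (\<lambda>z. z j))"
    then have E: "E \<in> sets \<Gamma>"
      using \<Gamma>1(1) by simp
    then have E2: "E \<subseteq> S1 \<times> S2"
      using sets.sets_into_space[of E \<Gamma>] space by simp
    have "(\<lambda>z. z j) -` E \<inter> space P = PiE {..<k} (\<lambda>i. if i = j then E else S1 \<times> S2)"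
      (is "?L = ?R")
    proof (intro set_eqI iffI)
      fix z assume "z \<in> ?L"
      then show "z \<in> ?R"
        unfolding spaceP by (auto simp: PiE_iff)
    next
      fix z assume z: "z \<in> ?R"
      then have zi: "z i \<in> (if i = j then E else S1 \<times> S2)" if "i < k" for i
        using that by (simp add: PiE_iff)
      have "z j \<in> E"
        using zi[OF j] by simp
      moreover have "z i \<in> S1 \<times> S2" if "i < k" for i
        using zi[OF that] E2 by (cases "i = j") auto
      ultimately show "z \<in> ?L"
        unfolding spaceP using z by (simp add: PiE_iff)
    qed
    moreover have "emeasure P (PiE {..<k} (\<lambda>i. if i = j then E else S1 \<times> S2))
        = (\<Prod>i<k. if i = j then emeasure \<Gamma>1 E else 1)"
      using emP[of "\<lambda>i. if i = j then E else S1 \<times> S2"] E sets.top[of \<Gamma>] one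
      by (simp add: space \<Gamma>1(2) if_distrib cong: if_cong)
    ultimately show "emeasure (distr P \<Gamma>1 (\<lambda>z. z j)) E = emeasure \<Gamma>1 E"
      using E j comp_meas[OF j] \<Gamma>1(1)
      by (subst emeasure_distr) (auto simp: prod.delta cong: measurable_cong_sets)
  qed simp
  have comp: "(\<integral>\<^sup>+z. g (z j) \<partial>P) = c * integral\<^sup>N \<Gamma> g" if "j < k" "g \<in> borel_measurable \<Gamma>" for g j
  proof -
    have "(\<integral>\<^sup>+z. g (z j) \<partial>P) = integral\<^sup>N (distr P \<Gamma>1 (\<lambda>z. z j)) g"
      using that comp_meas[OF that(1)] \<Gamma>1(1)
      by (intro nn_integral_distr[symmetric]) (auto cong: measurable_cong_sets)
    then show ?thesis
      using distr_comp[OF that(1)] that(2) by (simp add: \<Gamma>1_def nn_integral_scale_measure)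
  qed
  define all where "all z \<longleftrightarrow> (\<forall>i<k. z i \<in> W i)" for z
  have all_eq: "{z \<in> space P. all z} = PiE {..<k} W"
    unfolding spaceP all_def set_eq_iff mem_Collect_eq PiE_iff Ball_def lessThan_iff using Wk by blast
  have all_sets: "{z \<in> space P. all z} \<in> sets P"
  proof -
    have "PiE {..<k} W \<in> sets (PiM {..<k} (\<lambda>_. \<Gamma>1))"
      using W(1) \<Gamma>1(1) by (intro sets_PiM_I_finite) auto
    then show ?thesis
      unfolding all_eq by (simp add: P_def)
  qed
  \<comment> \<open>The second component comes from copy \<open>s j\<close>, but only on the event
    \<open>all\<close>, which involves all copies at once.\<close>
  define f where "f j z = (if all z then (fst (z j), snd (z (s j))) else z j)" for j z
  have id_meas: "(\<lambda>z. z) \<in> borel_measurable \<Gamma>"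
    using sets measurable_restrict_space1[of "\<lambda>z. z" borel borel "S1 \<times> S2"]
    by (simp cong: measurable_cong_sets)
  have comp_borel: "(\<lambda>z. z j) \<in> borel_measurable P" if "j < k" for j
    using measurable_comp[OF comp_meas[OF that] id_meas] by (simp add: o_def)
  have pair: "(\<lambda>z. (fst (z j), snd (z (s j)))) \<in> measurable P \<Gamma>" if "j < k" for j
  proof -
    have "(\<lambda>z. fst (z j)) \<in> borel_measurable P"
      using measurable_comp[OF comp_borel[OF that] borel_measurable_continuous_onI[OF continuous_on_fst[OF continuous_on_id]]]
      by (simp add: o_def)
    moreover have "(\<lambda>z. snd (z (s j))) \<in> borel_measurable P"
      using measurable_comp[OF comp_borel[OF sk[OF that]] borel_measurable_continuous_onI[OF continuous_on_snd[OF continuous_on_id]]]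
      by (simp add: o_def)
    ultimately have "(\<lambda>z. (fst (z j), snd (z (s j)))) \<in> borel_measurable P"
      by (rule borel_measurable_Pair)
    moreover have "(\<lambda>z. (fst (z j), snd (z (s j)))) \<in> space P \<rightarrow> S1 \<times> S2"
    proof (rule funcsetI)
      fix z assume "z \<in> space P"
      then have "z j \<in> S1 \<times> S2" "z (s j) \<in> S1 \<times> S2"
        unfolding spaceP using that sk[OF that] by (auto simp: PiE_iff simp del: mem_Sigma_iff)
      then show "(fst (z j), snd (z (s j))) \<in> S1 \<times> S2"
        by (simp add: mem_Times_iff)
    qed
    ultimately have "(\<lambda>z. (fst (z j), snd (z (s j)))) \<in> measurable P (restrict_space borel (S1 \<times> S2))"
      by (intro measurable_restrict_space2)
    then show ?thesis
      using sets by (simp cong: measurable_cong_sets)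
  qed
  have f: "f j \<in> measurable P \<Gamma>" if "j < k" for j
    unfolding f_def[abs_def] using all_sets by (intro measurable_If pair comp_meas that) auto
  define Q where "Q = distr (count_space {..<k} \<Otimes>\<^sub>M P) \<Gamma> (\<lambda>(j, z). f j z)"
  have fQ: "(\<lambda>(j, z). f j z) \<in> measurable (count_space {..<k} \<Otimes>\<^sub>M P) \<Gamma>"
    by (rule measurable_pair_measure_countable1) (auto intro: f)
  have nnQ: "integral\<^sup>N Q g = (\<Sum>j<k. \<integral>\<^sup>+z. g (f j z) \<partial>P)" if g: "g \<in> borel_measurable \<Gamma>" for g
  proof -
    have "integral\<^sup>N Q g = (\<integral>\<^sup>+x. g ((\<lambda>(j, z). f j z) x) \<partial>(count_space {..<k} \<Otimes>\<^sub>M P))"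
      unfolding Q_def using fQ g by (intro nn_integral_distr) auto
    also have "\<dots> = (\<integral>\<^sup>+j. \<integral>\<^sup>+z. g ((\<lambda>(j, z). f j z) (j, z)) \<partial>P \<partial>count_space {..<k})"
      using measurable_comp[OF fQ g] by (intro P.nn_integral_fst[symmetric]) (simp add: o_def)
    finally show ?thesis
      by (simp add: nn_integral_count_space_finite)
  qed
  \<comment> \<open>The factor \<open>1 / k\<close> averages over the copies; \<open>G\<close>
    restores the total mass.\<close>
  define a where "a = ennreal (1 / real k)"
  have ak: "a * of_nat k = 1"
    using k unfolding a_def by (simp add: ennreal_of_nat_eq_real_of_nat flip: ennreal_mult)
  define \<Gamma>' where "\<Gamma>' = scale_measure (a * G) Q"
  have sQ: "sets Q = sets \<Gamma>"
    by (simp add: Q_def)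
  have nn: "integral\<^sup>N \<Gamma>' g = (a * G) * (\<Sum>j<k. \<integral>\<^sup>+z. g (f j z) \<partial>P)" if g: "g \<in> borel_measurable \<Gamma>" for g
    unfolding \<Gamma>'_def using nnQ[OF g] g sQ by (subst nn_integral_scale_measure) (auto cong: measurable_cong_sets)
  have gf: "(\<lambda>z. g (f j z)) \<in> borel_measurable P" "(\<lambda>z. g (z j)) \<in> borel_measurable P"
    if "g \<in> borel_measurable \<Gamma>" "j < k" for g :: "'a \<times> 'a \<Rightarrow> ennreal" and j
    using measurable_comp[OF f[OF that(2)] that(1)] measurable_comp[OF comp_meas[OF that(2)] that(1)]
    by (simp_all add: o_def)
  have avg: "(a * G) * (\<integral>\<^sup>+z. (\<Sum>j<k. g (z j)) \<partial>P) = integral\<^sup>N \<Gamma> g" if g: "g \<in> borel_measurable \<Gamma>" for g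
  proof -
    have "(\<integral>\<^sup>+z. (\<Sum>j<k. g (z j)) \<partial>P) = (\<Sum>j<k. c * integral\<^sup>N \<Gamma> g)"
      using gf(2)[OF g] comp[OF _ g] by (subst nn_integral_sum) auto
    also have "\<dots> = of_nat k * (c * integral\<^sup>N \<Gamma> g)"
      by simp
    finally have "(a * G) * (\<integral>\<^sup>+z. (\<Sum>j<k. g (z j)) \<partial>P) = (a * of_nat k) * (G * c) * integral\<^sup>N \<Gamma> g"
      by (simp add: ac_simps)
    then show ?thesis
      by (simp add: ak Gc)
  qed
  have sums: "(a * G) * (\<integral>\<^sup>+z. (\<Sum>j<k. g (f j z)) \<partial>P) = integral\<^sup>N \<Gamma>' g" if g: "g \<in> borel_measurable \<Gamma>" for g
    unfolding nn[OF g] using gf(1)[OF g] by (subst nn_integral_sum) auto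
  have marg: "emeasure \<Gamma>' E = emeasure \<Gamma> E"
    if E: "E \<in> sets \<Gamma>" and eq: "\<And>z. z \<in> space P \<Longrightarrow> (\<Sum>j<k. indicator E (f j z)) = (\<Sum>j<k. indicator E (z j) :: ennreal)" for E
  proof -
    have ind: "indicator E \<in> borel_measurable \<Gamma>"
      using E by simp
    have "integral\<^sup>N \<Gamma>' (indicator E) = integral\<^sup>N \<Gamma> (indicator E)"
      unfolding sums[OF ind, symmetric] avg[OF ind, symmetric] using eq by (simp cong: nn_integral_cong)
    then show ?thesis
      using E sQ by (simp add: \<Gamma>'_def)
  qed
  show ?thesis
  proof (rule that[of \<Gamma>'])
    show "sets \<Gamma>' = sets \<Gamma>"
      by (simp add: \<Gamma>'_def sQ)
    show "emeasure \<Gamma>' (X \<times> S2) = emeasure \<Gamma> (X \<times> S2)" if "X \<times> S2 \<in> sets \<Gamma>" for X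
    proof (rule marg[OF that])
      fix z assume z: "z \<in> space P"
      show "(\<Sum>j<k. indicator (X \<times> S2) (f j z)) = (\<Sum>j<k. indicator (X \<times> S2) (z j) :: ennreal)"
      proof (rule sum.cong[OF refl])
        fix j assume "j \<in> {..<k}"
        then have "z j \<in> S1 \<times> S2" "z (s j) \<in> S1 \<times> S2"
          using z sk[of j] unfolding spaceP by (auto simp: PiE_iff)
        then show "indicator (X \<times> S2) (f j z) = (indicator (X \<times> S2) (z j) :: ennreal)"
          by (auto simp: f_def indicator_def mem_Times_iff)
      qed
    qed
    show "emeasure \<Gamma>' (S1 \<times> Y) = emeasure \<Gamma> (S1 \<times> Y)" if "S1 \<times> Y \<in> sets \<Gamma>" for Y
    proof (rule marg[OF that])
      fix z assume z: "z \<in> space P"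
      have zS: "z j \<in> S1 \<times> S2" if "j < k" for j
        using z that unfolding spaceP by (auto simp: PiE_iff)
      show "(\<Sum>j<k. indicator (S1 \<times> Y) (f j z)) = (\<Sum>j<k. indicator (S1 \<times> Y) (z j) :: ennreal)"
      proof (cases "all z")
        case True
        have "(\<Sum>j<k. indicator (S1 \<times> Y) (f j z)) = (\<Sum>j<k. indicator (S1 \<times> Y) (z (s j)) :: ennreal)"
        proof (rule sum.cong[OF refl])
          fix j assume "j \<in> {..<k}"
          then have "z j \<in> S1 \<times> S2" "z (s j) \<in> S1 \<times> S2"
            using zS sk by auto
          then show "indicator (S1 \<times> Y) (f j z) = (indicator (S1 \<times> Y) (z (s j)) :: ennreal)"
            using True by (auto simp: f_def indicator_def mem_Times_iff)
        qed
        also have "\<dots> = (\<Sum>j<k. indicator (S1 \<times> Y) (z j))"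
          using sum.reindex_bij_betw[OF s, of "\<lambda>j. indicator (S1 \<times> Y) (z j)"] .
        finally show ?thesis .
      qed (simp add: f_def)
    qed
    have "integral\<^sup>N \<Gamma> C + (a * G) * (d * emeasure P {z \<in> space P. all z})
        = (a * G) * (\<integral>\<^sup>+z. (\<Sum>j<k. C (z j)) + d * indicator {z \<in> space P. all z} z \<partial>P)"
      using gf(2)[OF C(1)] all_sets unfolding avg[OF C(1), symmetric]
      by (subst nn_integral_add) (auto simp: distrib_left nn_integral_cmult_indicator)
    also have "\<dots> \<le> (a * G) * (\<integral>\<^sup>+z. (\<Sum>j<k. C (f j z)) \<partial>P)"
    proof (intro mult_left_mono nn_integral_mono)
      fix z assume z: "z \<in> space P"
      show "(\<Sum>j<k. C (z j)) + d * indicator {z \<in> space P. all z} z \<le> (\<Sum>j<k. C (f j z))"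
      proof (cases "all z")
        case True
        then show ?thesis
          using d(2)[of z] z by (simp add: f_def) (simp add: all_def)
      qed (simp add: f_def)
    qed simp
    also have "\<dots> = integral\<^sup>N \<Gamma>' C"
      by (rule sums[OF C(1)])
    finally have le: "integral\<^sup>N \<Gamma> C + (a * G) * (d * emeasure P {z \<in> space P. all z}) \<le> integral\<^sup>N \<Gamma>' C" .
    \<comment> \<open>By independence the gain occurs with a probability that is a product of
      positive factors.\<close>
    have "emeasure P {z \<in> space P. all z} = (\<Prod>i<k. c * emeasure \<Gamma> (W i))"
      unfolding all_eq using emP[of W] W(1) \<Gamma>1(3) by simp
    also have "\<dots> \<noteq> 0"
      using c W(2) by (simp add: prod_zero_iff) force
    finally have "(a * G) * (d * emeasure P {z \<in> space P. all z}) \<noteq> 0"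
      using d(1) G ak by auto
    then have "integral\<^sup>N \<Gamma> C + 0 < integral\<^sup>N \<Gamma> C + (a * G) * (d * emeasure P {z \<in> space P. all z})"
      using C(2) by (subst ennreal_add_left_cancel_less) (auto simp: zero_less_iff_neq_zero)
    from less_le_trans[OF this le] show "integral\<^sup>N \<Gamma> C < integral\<^sup>N \<Gamma>' C"
      unfolding add_0_right .
  qed
qed

text \<open>Rockafellar's potential is the supremum of the affine functions defined by the finite chains in
  \<open>S\<close> from a fixed starting point; cyclical monotonicity makes it finite.\<close>

lemma cyclically_monotone_potential:
  fixes S :: "('a::euclidean_space \<times> 'a) set"
  assumes "S \<noteq> {}"
    and cyc: "\<And>(k :: nat) z s. 0 < k \<Longrightarrow> bij_betw s {..<k} {..<k} \<Longrightarrow> (\<And>i. i < k \<Longrightarrow> z i \<in> S) \<Longrightarrow>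
      (\<Sum>i<k. fst (z i) \<bullet> snd (z (s i))) \<le> (\<Sum>i<k. fst (z i) \<bullet> snd (z i :: 'a \<times> 'a))"
    and bound: "\<And>x y. (x, y) \<in> S \<Longrightarrow> norm y \<le> K"
  obtains \<Phi> where "continuous_on UNIV \<Phi>" "\<And>x y m. (x, y) \<in> S \<Longrightarrow> \<Phi> x + (m - x) \<bullet> y \<le> \<Phi> m"
proof -
  obtain z0 where z0: "z0 \<in> S"
    using assms(1) by blast
  \<comment> \<open>Follow the increments along the chain up to \<open>z k\<close>, then use its
    slope to reach \<open>m\<close>.\<close>
  define val where "val k z m = (m - fst (z k)) \<bullet> snd (z k) + (\<Sum>i<k. (fst (z (Suc i)) - fst (z i)) \<bullet> snd (z i))"
    for k :: nat and z :: "nat \<Rightarrow> 'a \<times> 'a" and m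
  define Z where "Z k = {z. z 0 = z0 \<and> (\<forall>i\<le>k. z i \<in> S)}" for k :: nat
  define V where "V m = {val k z m | k z. z \<in> Z k}" for m
  have closed: "val k z (fst z0) \<le> 0" if z: "z \<in> Z k" for k z
  proof -
    \<comment> \<open>The cyclic shift joining the end of the chain to its start. Cyclical
      monotonicity then bounds all chains at \<open>fst z0\<close>, and the Lipschitz bound spreads
      this to every \<open>m\<close>.\<close>
    define s where "s i = (if i = 0 then k else i - 1)" for i
    have "bij_betw s {..<Suc k} {..<Suc k}"
      by (rule bij_betw_byWitness[where f' = "\<lambda>i. if i = k then 0 else Suc i"]) (auto simp: s_def)
    then have "(\<Sum>i<Suc k. fst (z i) \<bullet> snd (z (s i))) \<le> (\<Sum>i<Suc k. fst (z i) \<bullet> snd (z i))"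
      using z by (intro cyc) (auto simp: Z_def)
    moreover have "(\<Sum>i<Suc k. fst (z i) \<bullet> snd (z (s i)))
        = fst z0 \<bullet> snd (z k) + (\<Sum>i<k. fst (z (Suc i)) \<bullet> snd (z i))"
      using z by (subst sum.lessThan_Suc_shift) (simp add: s_def Z_def)
    ultimately show ?thesis
      by (simp add: val_def inner_diff_left sum_subtractf)
  qed
  have lip: "val k z m \<le> val k z m' + K * norm (m - m')" if "z \<in> Z k" for k z m m'
  proof -
    have "val k z m - val k z m' = (m - m') \<bullet> snd (z k)"
      by (simp add: val_def inner_diff_left)
    also have "\<dots> \<le> norm (m - m') * norm (snd (z k))"
      by (rule norm_cauchy_schwarz)
    also have "\<dots> \<le> norm (m - m') * K"
      using that bound[of "fst (z k)" "snd (z k)"] by (intro mult_left_mono) (auto simp: Z_def)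
    finally show ?thesis
      by (simp add: mult.commute)
  qed
  have bdd: "bdd_above (V m)" for m
  proof (rule bdd_aboveI)
    fix v assume "v \<in> V m"
    then show "v \<le> K * norm (m - fst z0)"
      using lip[of _ _ m "fst z0"] closed unfolding V_def by fastforce
  qed
  have ne: "V m \<noteq> {}" for m
    unfolding V_def Z_def using z0 by (auto intro!: exI[of _ 0] exI[of _ "\<lambda>_. z0"])
  define \<Phi> where "\<Phi> m = Sup (V m)" for m
  have lip\<Phi>: "\<Phi> m \<le> \<Phi> m' + K * norm (m - m')" for m m'
    unfolding \<Phi>_def
  proof (rule cSup_least[OF ne])
    fix v assume "v \<in> V m"
    then obtain k z where kz: "z \<in> Z k" "v = val k z m"
      unfolding V_def by blast
    then have "val k z m' \<le> Sup (V m')"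
      by (intro cSup_upper bdd) (auto simp: V_def)
    then show "v \<le> Sup (V m') + K * norm (m - m')"
      using lip[OF kz(1), of m m'] kz(2) by simp
  qed
  have "\<bar>\<Phi> m - \<Phi> m'\<bar> \<le> K * norm (m - m')" for m m'
    using lip\<Phi>[of m m'] lip\<Phi>[of m' m] by (simp add: abs_le_iff norm_minus_commute)
  then have "continuous_on UNIV \<Phi>"
    by (rule continuous_on_lipschitz)
  moreover have "\<Phi> x + (m - x) \<bullet> y \<le> \<Phi> m" if xy: "(x, y) \<in> S" for x y m
  proof -
    have "\<Phi> x \<le> \<Phi> m - (m - x) \<bullet> y"
      unfolding \<Phi>_def[of x]
    proof (rule cSup_least[OF ne])
      fix v assume "v \<in> V x"
      then obtain k z where kz: "z \<in> Z k" "v = val k z x"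
        unfolding V_def by blast
      \<comment> \<open>Appending \<open>(x, y)\<close> turns the value of a chain at
        \<open>x\<close> into the value at \<open>m\<close> of a longer chain.\<close>
      define z' where "z' = z(Suc k := (x, y))"
      have "z' \<in> Z (Suc k)"
        using kz(1) xy by (auto simp: Z_def z'_def le_Suc_eq)
      moreover have "(\<Sum>i<k. (fst (z' (Suc i)) - fst (z' i)) \<bullet> snd (z' i))
          = (\<Sum>i<k. (fst (z (Suc i)) - fst (z i)) \<bullet> snd (z i))"
        by (rule sum.cong) (auto simp: z'_def)
      then have "val (Suc k) z' m = (m - x) \<bullet> y + v"
        unfolding kz(2) by (simp add: val_def) (simp add: z'_def)
      ultimately have "(m - x) \<bullet> y + v \<in> V m"
        unfolding V_def by (metis (mono_tags, lifting) mem_Collect_eq)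
      then have "(m - x) \<bullet> y + v \<le> \<Phi> m"
        unfolding \<Phi>_def by (rule cSup_upper[OF _ bdd])
      then show "v \<le> \<Phi> m - (m - x) \<bullet> y"
        by simp
    qed
    then show ?thesis
      by simp
  qed
  ultimately show ?thesis
    by (rule that)
qed

section \<open>Reflexive polytopes\<close>

text \<open>A finite type has at least one element, so \<open>dim\<close> contains the condition
  that \<open>d\<close> is positive; \<open>A_connected\<close> relies on it.\<close>

locale reflexive_height =
  fixes \<Delta> :: "(real ^ 'n) set"
    and h :: "real ^ 'n \<Rightarrow> int"
    and b :: "(real ^ 'n) set \<Rightarrow> 'k::finite \<Rightarrow> real ^ 'n"
  assumes dim: "CARD('n) = CARD('k) + 1"
    and reflexive: "reflexive_polytope \<Delta>"
    and height: "height_function \<Delta> h"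
    and bases: "facet_bases \<Delta> b"
begin

abbreviation A where "A \<equiv> bdA \<Delta>"
abbreviation B where "B \<equiv> bdB \<Delta> h"
abbreviation P where "P \<equiv> dual_h \<Delta> h"
abbreviation AM where "AM \<equiv> bdA \<Delta> \<inter> int_lattice"
abbreviation ns where "ns \<equiv> primitive_normal \<Delta>"
abbreviation D where "D \<equiv> beta_dom \<Delta> h"

text \<open>A finite lattice set that generates the dual polytope together with 0. It contains all
  facet normals of \<open>\<Delta>\<close>, possibly among other vectors. Removing 0 leaves honest
  half-spaces, as \<open>facet_of_halfspaces\<close> requires.\<close>

definition NV :: "(real ^ 'n) set" where
  "NV = (SOME V. finite V \<and> V \<subseteq> int_lattice \<and> dual_polytope \<Delta> = convex hull V) - {0}"

lemma NV: "finite NV" "NV \<subseteq> int_lattice" "0 \<notin> NV" "NV \<subseteq> dual_polytope \<Delta>"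
  "dual_polytope \<Delta> \<subseteq> convex hull (insert 0 NV)"
proof -
  define V where "V = (SOME V. finite V \<and> V \<subseteq> int_lattice \<and> dual_polytope \<Delta> = convex hull V)"
  have V: "finite V \<and> V \<subseteq> int_lattice \<and> dual_polytope \<Delta> = convex hull V"
    unfolding V_def by (rule someI_ex)
      (use reflexive in \<open>auto simp: reflexive_polytope_def lattice_polytope_def\<close>)
  have "NV = V - {0}"
    by (simp add: NV_def V_def)
  then show "finite NV" "NV \<subseteq> int_lattice" "0 \<notin> NV" "NV \<subseteq> dual_polytope \<Delta>"
    "dual_polytope \<Delta> \<subseteq> convex hull (insert 0 NV)"
    using V hull_subset[of V convex] hull_mono[of V "insert 0 NV" convex] by auto
qed

lemma Delta_polytope: "polytope \<Delta>"
  using reflexive unfolding reflexive_polytope_def lattice_polytope_def polytope_def by blast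

lemma Delta_compact: "compact \<Delta>" and Delta_convex: "convex \<Delta>" and Delta_polyhedron: "polyhedron \<Delta>"
  using Delta_polytope
  by (auto intro: polytope_imp_compact polytope_imp_convex polytope_imp_polyhedron)

lemma zero_interior: "0 \<in> interior \<Delta>" and zero_Delta: "0 \<in> \<Delta>"
  using reflexive interior_subset unfolding reflexive_polytope_def by auto

text \<open>The bipolar theorem: a functional separating a point from \<open>\<Delta>\<close> can be
  scaled into the dual polytope, hence into the hull of \<open>NV\<close> and 0.\<close>

lemma Delta_eq: "\<Delta> = {x. \<forall>v\<in>NV. v \<bullet> x \<le> 1}"
proof (intro equalityI subsetI)
  fix x assume "x \<in> \<Delta>"
  then show "x \<in> {x. \<forall>v\<in>NV. v \<bullet> x \<le> 1}"
    using NV(4) unfolding dual_polytope_def by (auto simp: inner_commute)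
next
  fix x assume x: "x \<in> {x. \<forall>v\<in>NV. v \<bullet> x \<le> 1}"
  show "x \<in> \<Delta>"
  proof (rule ccontr)
    assume "x \<notin> \<Delta>"
    then obtain a c where ac: "a \<bullet> x < c" "\<forall>y\<in>\<Delta>. a \<bullet> y > c"
      using separating_hyperplane_closed_point[OF Delta_convex compact_imp_closed[OF Delta_compact]]
      by blast
    then have "c < 0"
      using zero_Delta by force
    \<comment> \<open>\<open>c\<close> is negative because 0 lies in \<open>\<Delta>\<close>, so
      dividing by it reverses the inequalities.\<close>
    define n where "n = (1 / c) *\<^sub>R a"
    have "y \<bullet> n \<le> 1" if "y \<in> \<Delta>" for y
      using ac(2) that \<open>c < 0\<close> by (auto simp: n_def inner_commute field_simps intro: less_imp_le)
    then have "n \<in> convex hull (insert 0 NV)"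
      using NV(5) unfolding dual_polytope_def by blast
    also have "\<dots> \<subseteq> {y. x \<bullet> y \<le> 1}"
      using x by (intro hull_minimal) (auto simp: convex_halfspace_le inner_commute[of _ x])
    finally have "x \<bullet> n \<le> 1"
      by simp
    then show False
      using ac(1) \<open>c < 0\<close> by (simp add: n_def inner_commute field_simps)
  qed
qed

lemma in_Delta_iff: "x \<in> \<Delta> \<longleftrightarrow> (\<forall>v\<in>NV. v \<bullet> x \<le> 1)"
  using Delta_eq by blast

lemma lattice_hull: obtains V where "finite V" "V \<subseteq> int_lattice" "V \<subseteq> \<Delta>" "\<Delta> = convex hull V"
  using reflexive hull_subset unfolding reflexive_polytope_def lattice_polytope_def by metis

text \<open>A linear functional that is at most 1 on a convex hull and reaches 1 does so at a
  generator. The lattice point \<open>u\<close> will certify that \<open>v\<close> is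
  primitive.\<close>

lemma facet_vertex:
  assumes "v \<in> NV" "x \<in> \<Delta>" "v \<bullet> x = 1"
  obtains u where "u \<in> \<Delta>" "u \<in> int_lattice" "v \<bullet> u = 1"
proof -
  obtain V where V: "finite V" "V \<subseteq> int_lattice" "V \<subseteq> \<Delta>" "\<Delta> = convex hull V"
    by (rule lattice_hull)
  have "\<exists>u\<in>V. \<not> v \<bullet> u < 1"
  proof (rule ccontr)
    assume "\<not> ?thesis"
    then have "convex hull V \<subseteq> {x. v \<bullet> x < 1}"
      by (intro hull_minimal) (auto simp: convex_halfspace_lt)
    then show False
      using assms V(4) by auto
  qed
  then obtain u where "u \<in> V" "v \<bullet> u \<ge> 1"
    by force
  moreover from this have "v \<bullet> u \<le> 1"
    using V(3) in_Delta_iff assms(1) by blast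
  ultimately show ?thesis
    using that[of u] V by auto
qed

text \<open>Integrality of the dual polytope enters here: every facet has lattice distance one from
  the origin.\<close>

lemma facet_Delta:
  assumes "\<sigma> facet_of \<Delta>"
  shows "ns \<sigma> \<in> NV" "\<sigma> = \<Delta> \<inter> {x. ns \<sigma> \<bullet> x = 1}"
    and facet_lattice_point: "\<exists>u\<in>\<sigma>. u \<in> int_lattice"
proof -
  obtain v where v: "v \<in> NV" "\<sigma> = \<Delta> \<inter> {x. v \<bullet> x = 1}"
    by (rule facet_of_halfspaces[OF NV(1,3) Delta_eq _ assms]) (use zero_interior in auto)
  obtain x where "x \<in> \<sigma>"
    using assms unfolding facet_of_def by blast
  then obtain u where u: "u \<in> \<Delta>" "u \<in> int_lattice" "v \<bullet> u = 1"
    using facet_vertex v by blast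
  have "ns \<sigma> = v"
    using NV(2) v u in_Delta_iff zero_interior
    by (intro primitive_normal_eqI[of \<Delta> \<sigma> v u 1] Delta_convex assms) auto
  then show "ns \<sigma> \<in> NV" "\<sigma> = \<Delta> \<inter> {x. ns \<sigma> \<bullet> x = 1}" "\<exists>u\<in>\<sigma>. u \<in> int_lattice"
    using v u by auto
qed

lemma ns_inner_facet: "\<sigma> facet_of \<Delta> \<Longrightarrow> x \<in> \<sigma> \<Longrightarrow> ns \<sigma> \<bullet> x = 1"
  using facet_Delta(2) by blast

lemma ns_inner_le: "\<sigma> facet_of \<Delta> \<Longrightarrow> x \<in> \<Delta> \<Longrightarrow> ns \<sigma> \<bullet> x \<le> 1"
  using facet_Delta(1) in_Delta_iff by blast

lemma ns_nonzero: "\<sigma> facet_of \<Delta> \<Longrightarrow> ns \<sigma> \<noteq> 0"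
  using facet_Delta(1) NV(3) by metis

lemma facet_subset: "\<sigma> facet_of \<Delta> \<Longrightarrow> \<sigma> \<subseteq> \<Delta>"
  using facet_Delta(2) by blast

lemma facet_compact: "\<sigma> facet_of \<Delta> \<Longrightarrow> compact \<sigma>"
  using face_of_imp_compact[OF Delta_convex Delta_compact] by (simp add: facet_of_def)

lemma facet_convex: "\<sigma> facet_of \<Delta> \<Longrightarrow> convex \<sigma>"
  using face_of_imp_convex by (auto simp: facet_of_def)

lemma finite_facets: "finite {\<sigma>. \<sigma> facet_of \<Delta>}"
  using finite_polytope_facets[OF Delta_polytope] .

lemma A_subset: "A \<subseteq> \<Delta>"
  unfolding bdA_def using compact_imp_closed[OF Delta_compact] frontier_subset_closed by blast

lemma A_eq_facets: "A = \<Union>{\<sigma>. \<sigma> facet_of \<Delta>}"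
  unfolding bdA_def using rel_frontier_of_polyhedron[OF Delta_polyhedron]
    rel_frontier_nonempty_interior[of \<Delta>] zero_interior by auto

lemma A_compact: "compact A"
  unfolding bdA_def using compact_frontier[OF Delta_compact] .

lemma A_nonempty: "A \<noteq> {}"
  unfolding bdA_def
  using frontier_not_empty[of \<Delta>] zero_Delta Delta_compact not_compact_UNIV by (metis empty_iff)

lemma A_facetE:
  assumes "x \<in> A"
  obtains \<sigma> where "\<sigma> facet_of \<Delta>" "x \<in> \<sigma>"
  using assms A_eq_facets by auto

lemma facet_subset_A: "\<sigma> facet_of \<Delta> \<Longrightarrow> \<sigma> \<subseteq> A"
  using A_eq_facets by auto

lemma NV_face:
  assumes "v \<in> NV"
  shows "\<Delta> \<inter> {x. v \<bullet> x = 1} face_of \<Delta>" "\<Delta> \<inter> {x. v \<bullet> x = 1} \<noteq> \<Delta>"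
proof -
  show "\<Delta> \<inter> {x. v \<bullet> x = 1} face_of \<Delta>"
    by (rule face_of_Int_supporting_hyperplane_le[OF Delta_convex]) (use in_Delta_iff assms in auto)
  have "0 \<notin> {x. v \<bullet> x = 1}"
    by simp
  then show "\<Delta> \<inter> {x. v \<bullet> x = 1} \<noteq> \<Delta>"
    using zero_Delta by blast
qed

lemma star_ofI:
  assumes "v \<in> NV" "m \<in> \<Delta>" "x \<in> \<Delta>" "v \<bullet> m = 1" "v \<bullet> x = 1"
  shows "x \<in> star_of \<Delta> m"
  unfolding star_of_def using NV_face[OF assms(1)] assms by blast

lemma star_of_facet:
  assumes "x \<in> star_of \<Delta> m"
  obtains \<sigma> where "\<sigma> facet_of \<Delta>" "x \<in> \<sigma>" "m \<in> \<sigma>"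
proof -
  obtain F where F: "F face_of \<Delta>" "F \<noteq> \<Delta>" "m \<in> F" "x \<in> F"
    using assms unfolding star_of_def by blast
  then obtain \<sigma> where "\<sigma> facet_of \<Delta>" "F \<subseteq> \<sigma>"
    using face_of_polyhedron_subset_facet[OF Delta_polyhedron F(1)] by blast
  then show ?thesis
    using that F by blast
qed

lemma facet_star_of: "\<sigma> facet_of \<Delta> \<Longrightarrow> x \<in> \<sigma> \<Longrightarrow> m \<in> \<sigma> \<Longrightarrow> x \<in> star_of \<Delta> m"
  by (rule star_ofI[OF facet_Delta(1)]) (auto simp: ns_inner_facet dest: facet_subset)

lemma star_of_subset: "star_of \<Delta> m \<subseteq> A"
  using star_of_facet facet_subset_A by blast

text \<open>The pairing is an integer below 1. This jump from 1 to 0 is what keeps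
  \<open>push_to_star\<close> and \<open>push_to_D\<close> inside the polytopes.\<close>

lemma ns_inner_lattice:
  assumes "v \<in> NV" "m \<in> \<Delta>" "m \<in> int_lattice" "v \<bullet> m \<noteq> 1"
  shows "v \<bullet> m \<le> 0"
proof -
  obtain k where k: "v \<bullet> m = of_int k"
    using inner_int_lattice[of v m] NV(2) assms by (auto elim: Ints_cases)
  have "v \<bullet> m \<le> 1"
    using assms in_Delta_iff by blast
  then show ?thesis
    using assms(4) k by auto
qed

lemma zero_not_AM: "0 \<notin> AM"
  using zero_interior unfolding bdA_def frontier_def by auto

text \<open>At an interior lattice point all functionals of \<open>NV\<close> are at most 0. If the
  point were not 0, its ray would stay in the bounded set \<open>\<Delta>\<close>.\<close>

lemma lattice_points: "\<Delta> \<inter> int_lattice = insert 0 AM"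
proof (intro equalityI subsetI)
  fix m assume m: "m \<in> \<Delta> \<inter> int_lattice"
  show "m \<in> insert 0 AM"
  proof (rule ccontr)
    assume not: "m \<notin> insert 0 AM"
    have le: "v \<bullet> m \<le> 0" if "v \<in> NV" for v
    proof (rule ns_inner_lattice[OF that])
      show "v \<bullet> m \<noteq> 1"
        using star_ofI[OF that, of m m] star_of_subset not m by blast
    qed (use m in auto)
    obtain K where K: "\<And>x. x \<in> \<Delta> \<Longrightarrow> norm x \<le> K"
      using compact_imp_bounded[OF Delta_compact] unfolding bounded_iff by blast
    have K0: "0 \<le> K"
      using K[OF zero_Delta] by simp
    define t where "t = (K + 1) / norm m"
    have "m \<noteq> 0"
      using not by auto
    then have "norm (t *\<^sub>R m) = K + 1"
      using K0 by (simp add: t_def)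
    moreover have "t *\<^sub>R m \<in> \<Delta>"
    proof -
      have "t \<ge> 0"
        using K0 by (simp add: t_def)
      then have "t * (v \<bullet> m) \<le> 0" if "v \<in> NV" for v
        using le[OF that] by (simp add: mult_nonneg_nonpos)
      then show ?thesis
        unfolding in_Delta_iff by (fastforce intro: order_trans)
    qed
    ultimately show False
      using K by fastforce
  qed
next
  fix m assume "m \<in> insert 0 AM"
  then show "m \<in> \<Delta> \<inter> int_lattice"
    using A_subset zero_Delta by (auto simp: int_lattice_def)
qed

lemma finite_int_lattice_bounded:
  assumes "bounded (S :: (real ^ 'n) set)"
  shows "finite (S \<inter> int_lattice)"
proof -
  obtain K where K: "\<And>x. x \<in> S \<Longrightarrow> norm x \<le> K"
    using assms unfolding bounded_iff by blast
  define Z where "Z = {k. k \<in> \<int> \<and> \<bar>k\<bar> \<le> K}"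
  have "finite Z"
    unfolding Z_def by (rule finite_abs_int_segment)
  have "S \<inter> int_lattice \<subseteq> {v. \<forall>i. v $ i \<in> Z}"
    using K component_le_norm_cart order_trans unfolding Z_def int_lattice_def by blast
  moreover have "{v :: real ^ 'n. \<forall>i. v $ i \<in> Z} \<subseteq> vec_lambda ` {f. range f \<subseteq> Z}"
  proof
    fix v :: "real ^ 'n" assume "v \<in> {v. \<forall>i. v $ i \<in> Z}"
    then have "vec_nth v \<in> {f. range f \<subseteq> Z}"
      by auto
    then show "v \<in> vec_lambda ` {f. range f \<subseteq> Z}"
      by (metis image_eqI vec_lambda_eta)
  qed
  moreover have "finite {f :: 'n \<Rightarrow> real. range f \<subseteq> Z}"
    using finite_PiE[of "UNIV :: 'n set" "\<lambda>_. Z"] \<open>finite Z\<close>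
    by (simp add: PiE_def extensional_def Pi_def image_subset_iff)
  ultimately show ?thesis
    by (meson finite_imageI finite_subset)
qed

lemma finite_AM: "finite AM"
  using finite_int_lattice_bounded[of A] A_compact compact_imp_bounded by blast

lemma h_pos: "m \<in> AM \<Longrightarrow> h m > 0"
  using height lattice_points zero_not_AM unfolding height_function_def by (metis insertI2)

section \<open>The dual polytope of the height function\<close>

lemma P_eq: "P = {n. \<forall>m\<in>AM. m \<bullet> n \<le> of_int (h m)}"
  unfolding dual_h_def lattice_points using height by (auto simp: height_function_def)

lemma P_convex: "convex P"
proof -
  have "P = (\<Inter>m\<in>AM. {n. m \<bullet> n \<le> of_int (h m)})"
    unfolding P_eq by auto
  then show ?thesis
    by (simp add: convex_INT convex_halfspace_le)
qed

lemma P_closed: "closed P"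
proof -
  have "P = (\<Inter>m\<in>AM. {n. m \<bullet> n \<le> of_int (h m)})"
    unfolding P_eq by auto
  then show ?thesis
    by (simp add: closed_INT closed_halfspace_le)
qed

lemma interior_P_supset: "{n. \<forall>m\<in>AM. m \<bullet> n < of_int (h m)} \<subseteq> interior P"
proof (rule interior_maximal)
  show "{n. \<forall>m\<in>AM. m \<bullet> n < of_int (h m)} \<subseteq> P"
    unfolding P_eq by (auto intro: less_imp_le)
  have "{n. \<forall>m\<in>AM. m \<bullet> n < of_int (h m)} = (\<Inter>m\<in>AM. {n. m \<bullet> n < of_int (h m)})"
    by auto
  then show "open {n. \<forall>m\<in>AM. m \<bullet> n < real_of_int (h m)}"
    by (simp only:) (intro open_INT finite_AM ballI open_halfspace_lt)
qed

lemma zero_interior_P: "0 \<in> interior P"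
  using interior_P_supset h_pos by force

text \<open>As functionals on \<open>\<Delta>\<close> the points of \<open>P\<close> are bounded by
  \<open>H\<close>, because \<open>\<Delta>\<close> is the hull of lattice points. As
  \<open>\<Delta>\<close> contains a ball of radius \<open>r\<close>, their norms are at most
  \<open>H / r\<close>.\<close>

lemma P_bounded: "bounded P"
proof -
  obtain r where r: "r > 0" "cball 0 r \<subseteq> \<Delta>"
    using zero_interior by (metis mem_interior_cball)
  obtain V where V: "finite V" "V \<subseteq> int_lattice" "V \<subseteq> \<Delta>" "\<Delta> = convex hull V"
    by (rule lattice_hull)
  define H where "H = real_of_int (Max (h ` insert 0 AM))"
  have H: "of_int (h m) \<le> H" if "m \<in> insert 0 AM" for m
    unfolding H_def using that finite_AM by (auto intro!: Max_ge)
  have "norm n \<le> H / r" if "n \<in> P" for n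
  proof (cases "n = 0")
    case False
    have "x \<bullet> n \<le> H" if "x \<in> \<Delta>" for x
    proof -
      have "V \<subseteq> {x. n \<bullet> x \<le> H}"
      proof
        fix m assume "m \<in> V"
        then have "m \<in> \<Delta> \<inter> int_lattice"
          using V by auto
        then have "m \<bullet> n \<le> of_int (h m)" "of_int (h m) \<le> H"
          using \<open>n \<in> P\<close> H lattice_points unfolding dual_h_def by auto
        then show "m \<in> {x. n \<bullet> x \<le> H}"
          by (simp add: inner_commute)
      qed
      then have "convex hull V \<subseteq> {x. n \<bullet> x \<le> H}"
        by (intro hull_minimal convex_halfspace_le)
      then show ?thesis
        using that V(4) by (auto simp: inner_commute)
    qed
    moreover have "(r / norm n) *\<^sub>R n \<in> \<Delta>"
      using r False by auto
    ultimately have "((r / norm n) *\<^sub>R n) \<bullet> n \<le> H"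
      by blast
    then have "r * norm n \<le> H"
      using False by (simp add: dot_square_norm power2_eq_square)
    then show ?thesis
      using r(1) by (simp add: field_simps)
  next
    case True
    have "0 \<le> H"
      using H[of 0] height by (simp add: height_function_def)
    then show ?thesis
      using r True by simp
  qed
  then show ?thesis
    unfolding bounded_iff by blast
qed

lemma P_compact: "compact P"
  using P_bounded P_closed by (simp add: compact_eq_bounded_closed)

lemma B_subset: "B \<subseteq> P"
  unfolding bdB_def using P_closed frontier_subset_closed by blast

lemma B_compact: "compact B"
  unfolding bdB_def using compact_frontier[OF P_compact] .

lemma tau_of_subset_B: "m \<in> AM \<Longrightarrow> tau_of \<Delta> h m \<subseteq> B"
proof
  fix n assume m: "m \<in> AM" and n: "n \<in> tau_of \<Delta> h m"
  have "m \<noteq> 0"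
    using m zero_not_AM by auto
  have "interior P \<subseteq> interior {n. m \<bullet> n \<le> of_int (h m)}"
    using m by (intro interior_mono) (auto simp: P_eq)
  then have "n \<notin> interior P"
    using n \<open>m \<noteq> 0\<close> unfolding tau_of_def by auto
  then show "n \<in> B"
    using n closure_subset unfolding tau_of_def bdB_def frontier_def by blast
qed

lemma B_tauE:
  assumes "n \<in> B"
  obtains m where "m \<in> AM" "n \<in> tau_of \<Delta> h m"
proof -
  have "n \<in> P" "n \<notin> interior P"
    using assms B_subset unfolding bdB_def frontier_def by auto
  then obtain m where "m \<in> AM" "\<not> m \<bullet> n < of_int (h m)"
    using interior_P_supset by blast
  moreover have "m \<bullet> n \<le> of_int (h m)"
    using \<open>n \<in> P\<close> \<open>m \<in> AM\<close> P_eq by blast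
  ultimately show ?thesis
    using that[of m] \<open>n \<in> P\<close> by (auto simp: tau_of_def)
qed

lemma B_nonempty: "B \<noteq> {}"
  unfolding bdB_def
  using frontier_not_empty[of P] zero_interior_P interior_subset P_compact not_compact_UNIV
  by (metis empty_iff subsetD)

lemma tau_of_face:
  assumes "m \<in> AM"
  shows "tau_of \<Delta> h m face_of P" "tau_of \<Delta> h m \<noteq> P"
proof -
  have eq: "tau_of \<Delta> h m = P \<inter> {n. m \<bullet> n = of_int (h m)}"
    by (auto simp: tau_of_def)
  show "tau_of \<Delta> h m face_of P"
    unfolding eq by (rule face_of_Int_supporting_hyperplane_le[OF P_convex]) (use P_eq assms in auto)
  have "0 \<in> P" "0 \<notin> tau_of \<Delta> h m"
    using zero_interior_P interior_subset h_pos[OF assms] by (auto simp: tau_of_def)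
  then show "tau_of \<Delta> h m \<noteq> P"
    by blast
qed

lemma tau_of_compact: "compact (tau_of \<Delta> h m)"
proof -
  have eq: "tau_of \<Delta> h m = P \<inter> {n. m \<bullet> n = of_int (h m)}"
    by (auto simp: tau_of_def)
  show ?thesis
    unfolding eq by (intro compact_Int_closed P_compact closed_hyperplane)
qed

lemma AM_facetE:
  assumes "m \<in> AM"
  obtains \<sigma> where "\<sigma> facet_of \<Delta>" "m \<in> \<sigma>"
  using assms A_facetE by blast

text \<open>The normal of any facet of \<open>\<Delta>\<close> through \<open>m\<close> pairs to 1
  with \<open>m\<close>, which makes \<open>m\<close> primitive.\<close>

lemma primitive_normal_tau:
  assumes "m \<in> AM" "tau_of \<Delta> h m facet_of P"
  shows "primitive_normal P (tau_of \<Delta> h m) = m"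
proof -
  obtain \<sigma> where "\<sigma> facet_of \<Delta>" "m \<in> \<sigma>"
    using AM_facetE[OF assms(1)] .
  then have "m \<bullet> ns \<sigma> = 1" "ns \<sigma> \<in> int_lattice"
    using ns_inner_facet facet_Delta(1) NV(2) by (auto simp: inner_commute)
  then show ?thesis
    using assms zero_interior_P P_eq
    by (intro primitive_normal_eqI[of P _ m "ns \<sigma>" "of_int (h m)"] P_convex)
      (auto simp: tau_of_def)
qed

lemma facet_P:
  assumes "\<tau> facet_of P"
  shows "primitive_normal P \<tau> \<in> AM" "\<tau> = tau_of \<Delta> h (primitive_normal P \<tau>)"
proof -
  obtain m where m: "m \<in> AM" "\<tau> = P \<inter> {x. m \<bullet> x = of_int (h m)}"
    by (rule facet_of_halfspaces[OF finite_AM zero_not_AM P_eq _ assms]) (use zero_interior_P in auto)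
  have eq: "\<tau> = tau_of \<Delta> h m"
    unfolding m(2) by (auto simp: tau_of_def)
  have "primitive_normal P \<tau> = m"
    using primitive_normal_tau[OF m(1)] assms unfolding eq by blast
  then show "primitive_normal P \<tau> \<in> AM" "\<tau> = tau_of \<Delta> h (primitive_normal P \<tau>)"
    using m(1) eq by simp_all
qed

text \<open>Only one constraint is active in the relative interior of a facet of \<open>P\<close>.
  In \<open>MA_facet\<close> this pins down the star in which the transported points lie.\<close>

lemma facet_P_rel_interior:
  assumes "\<tau> facet_of P" "n \<in> rel_interior \<tau>" "m \<in> AM" "n \<in> tau_of \<Delta> h m"
  shows "m = primitive_normal P \<tau>"
proof -
  have eq: "\<tau> = tau_of \<Delta> h m"
    using facet_eq_face[OF P_convex assms(1) tau_of_face[OF assms(3)] assms(2,4)] .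
  have "tau_of \<Delta> h m facet_of P"
    using assms(1) unfolding eq .
  then show ?thesis
    unfolding eq using primitive_normal_tau[OF assms(3)] by metis
qed

text \<open>Moving from a point of \<open>\<Delta>\<close> in the direction of a boundary lattice point \<open>m\<close>, one leaves
  \<open>\<Delta>\<close> through a facet containing \<open>m\<close>, since the other facet functionals are \<open>\<le> 0\<close> on \<open>m\<close>.\<close>

lemma push_to_star:
  assumes "x \<in> \<Delta>" "m \<in> AM"
  obtains t where "t \<ge> 0" "x + t *\<^sub>R m \<in> star_of \<Delta> m"
proof -
  define N where "N = {v \<in> NV. v \<bullet> m = 1}"
  obtain \<sigma> where \<sigma>: "\<sigma> facet_of \<Delta>" "m \<in> \<sigma>"
    using AM_facetE[OF assms(2)] .
  then have "ns \<sigma> \<in> N"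
    using ns_inner_facet facet_Delta(1) by (simp add: N_def)
  then have "finite N" "N \<noteq> {}"
    using NV(1) by (auto simp: N_def)
  \<comment> \<open>The first parameter at which one of the functionals in \<open>N\<close> reaches
    1.\<close>
  define t where "t = Min ((\<lambda>v. 1 - v \<bullet> x) ` N)"
  have "t \<in> (\<lambda>v. 1 - v \<bullet> x) ` N"
    unfolding t_def using \<open>finite N\<close> \<open>N \<noteq> {}\<close> by (intro Min_in) auto
  then obtain v where v: "v \<in> N" "t = 1 - v \<bullet> x"
    by blast
  have le: "v \<bullet> x \<le> 1" if "v \<in> NV" for v
    using assms(1) that in_Delta_iff by blast
  have "t \<ge> 0"
    using v le by (simp add: N_def)
  have m: "m \<in> \<Delta>" "m \<in> int_lattice"
    using assms(2) A_subset by auto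
  have "v' \<bullet> (x + t *\<^sub>R m) \<le> 1" if "v' \<in> NV" for v'
  proof (cases "v' \<bullet> m = 1")
    case True
    then have "t \<le> 1 - v' \<bullet> x"
      unfolding t_def using \<open>finite N\<close> that by (intro Min_le) (auto simp: N_def)
    then show ?thesis
      using True by (simp add: inner_add_right)
  next
    case False
    then have "t * (v' \<bullet> m) \<le> 0"
      using ns_inner_lattice[OF that m] \<open>t \<ge> 0\<close> by (simp add: mult_nonneg_nonpos)
    then show ?thesis
      using le[OF that] by (simp add: inner_add_right)
  qed
  then have "x + t *\<^sub>R m \<in> \<Delta>"
    unfolding in_Delta_iff by blast
  then have "x + t *\<^sub>R m \<in> star_of \<Delta> m"
    using v m by (intro star_ofI[of v]) (auto simp: N_def inner_add_right)
  then show ?thesis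
    using that \<open>t \<ge> 0\<close> by blast
qed

section \<open>Moving points of the dual polytope along facet normals\<close>

lemma facet_lattice_subset: "\<sigma> facet_of \<Delta> \<Longrightarrow> \<sigma> \<inter> int_lattice \<subseteq> AM"
  using facet_subset_A[of \<sigma>] by blast

lemma D_subset_B: "\<sigma> facet_of \<Delta> \<Longrightarrow> D \<sigma> \<subseteq> B"
  unfolding beta_dom_def using tau_of_subset_B facet_lattice_subset by blast

text \<open>The height over \<open>n\<close>, in the direction of the normal of \<open>\<sigma>\<close>, of the graph formed by \<open>D \<sigma>\<close>.\<close>

definition gap :: "(real ^ 'n) set \<Rightarrow> real ^ 'n \<Rightarrow> real" where
  "gap \<sigma> n = Min ((\<lambda>m. of_int (h m) - m \<bullet> n) ` (\<sigma> \<inter> int_lattice))"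

lemma facet_lattice_finite:
  assumes "\<sigma> facet_of \<Delta>"
  shows "finite (\<sigma> \<inter> int_lattice)" "\<sigma> \<inter> int_lattice \<noteq> {}"
  using finite_subset[OF facet_lattice_subset[OF assms] finite_AM] facet_lattice_point[OF assms]
  by auto

lemma gap_attained:
  assumes "\<sigma> facet_of \<Delta>"
  obtains m where "m \<in> \<sigma> \<inter> int_lattice" "gap \<sigma> n = of_int (h m) - m \<bullet> n"
proof -
  have "gap \<sigma> n \<in> (\<lambda>m. of_int (h m) - m \<bullet> n) ` (\<sigma> \<inter> int_lattice)"
    unfolding gap_def using facet_lattice_finite[OF assms] by (intro Min_in) auto
  then show ?thesis
    using that by blast
qed

lemma gap_le:
  assumes "\<sigma> facet_of \<Delta>" "m \<in> \<sigma> \<inter> int_lattice"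
  shows "gap \<sigma> n \<le> of_int (h m) - m \<bullet> n"
  unfolding gap_def using facet_lattice_finite(1)[OF assms(1)] assms(2) by (intro Min_le) auto

text \<open>The shift makes the first constraint from \<open>\<sigma>\<close> tight. The other
  constraints are a hypothesis, because the lemma is also applied to points outside
  \<open>P\<close>, where the gap may be negative.\<close>

lemma gap_D:
  assumes "\<sigma> facet_of \<Delta>"
    and "\<And>m. m \<in> AM \<Longrightarrow> m \<notin> \<sigma> \<Longrightarrow> m \<bullet> (n + gap \<sigma> n *\<^sub>R ns \<sigma>) \<le> of_int (h m)"
  shows "n + gap \<sigma> n *\<^sub>R ns \<sigma> \<in> D \<sigma>"
proof -
  have eq: "m \<bullet> (n + gap \<sigma> n *\<^sub>R ns \<sigma>) = m \<bullet> n + gap \<sigma> n" if "m \<in> \<sigma>" for m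
    using ns_inner_facet[OF assms(1) that] by (simp add: inner_add_right inner_commute)
  have "n + gap \<sigma> n *\<^sub>R ns \<sigma> \<in> P"
    unfolding P_eq
  proof (intro CollectI ballI)
    fix m assume "m \<in> AM"
    then show "m \<bullet> (n + gap \<sigma> n *\<^sub>R ns \<sigma>) \<le> of_int (h m)"
      using assms(2) eq gap_le[OF assms(1), of m n] by (cases "m \<in> \<sigma>") auto
  qed
  moreover obtain m where m: "m \<in> \<sigma> \<inter> int_lattice" "gap \<sigma> n = of_int (h m) - m \<bullet> n"
    using gap_attained[OF assms(1)] .
  moreover have "m \<bullet> (n + gap \<sigma> n *\<^sub>R ns \<sigma>) = of_int (h m)"
    using eq[of m] m by simp
  ultimately show ?thesis
    unfolding beta_dom_def tau_of_def by blast
qed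

text \<open>Lattice points off \<open>\<sigma>\<close> pair with \<open>ns \<sigma>\<close> to at
  most 0, so moving forward along \<open>ns \<sigma>\<close> preserves their constraints.\<close>

lemma push_to_D:
  assumes "n \<in> P" "\<sigma> facet_of \<Delta>"
  shows "gap \<sigma> n \<ge> 0" "n + gap \<sigma> n *\<^sub>R ns \<sigma> \<in> D \<sigma>"
proof -
  have le: "m \<bullet> n \<le> of_int (h m)" if "m \<in> AM" for m
    using assms(1) that P_eq by blast
  show "gap \<sigma> n \<ge> 0"
    using gap_attained[OF assms(2)] le facet_lattice_subset[OF assms(2)]
    by (metis diff_ge_0_iff_ge subsetD)
  show "n + gap \<sigma> n *\<^sub>R ns \<sigma> \<in> D \<sigma>"
  proof (rule gap_D[OF assms(2)])
    fix m assume m: "m \<in> AM" "m \<notin> \<sigma>"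
    then have "m \<in> \<Delta>"
      using A_subset by auto
    then have "ns \<sigma> \<bullet> m \<le> 0"
      using m facet_Delta[OF assms(2)] by (intro ns_inner_lattice) auto
    then have "gap \<sigma> n * (m \<bullet> ns \<sigma>) \<le> 0"
      using \<open>gap \<sigma> n \<ge> 0\<close> by (simp add: mult_nonneg_nonpos inner_commute)
    then show "m \<bullet> (n + gap \<sigma> n *\<^sub>R ns \<sigma>) \<le> of_int (h m)"
      using le[OF m(1)] by (simp add: inner_add_right)
  qed
qed

lemma continuous_gap:
  assumes "\<sigma> facet_of \<Delta>"
  shows "continuous_on UNIV (gap \<sigma>)"
proof -
  have "continuous_on UNIV (\<lambda>n. Min ((\<lambda>m. of_int (h m) - m \<bullet> n) ` M))"
    if "finite M" "M \<noteq> {}" for M :: "(real ^ 'n) set"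
    using that
  proof (induction M rule: finite_ne_induct)
    case (insert m M)
    then have "Min ((\<lambda>m. of_int (h m) - m \<bullet> n) ` insert m M)
        = min (of_int (h m) - m \<bullet> n) (Min ((\<lambda>m. of_int (h m) - m \<bullet> n) ` M))" for n
      by simp
    then show ?case
      using insert by (auto intro!: continuous_intros continuous_on_min)
  qed (auto intro!: continuous_intros)
  then show ?thesis
    unfolding gap_def[abs_def] using facet_lattice_finite[OF assms] by blast
qed

section \<open>Lattice coordinates on facets\<close>

text \<open>The linear part of the chart of \<open>\<sigma>\<close>, and at the same time the
  adjoint of \<open>beta b \<sigma>\<close>; see \<open>comb_inner\<close>.\<close>

definition comb :: "(real ^ 'n) set \<Rightarrow> real ^ 'k \<Rightarrow> real ^ 'n" where
  "comb \<sigma> p = (\<Sum>i\<in>UNIV. (p $ i) *\<^sub>R b \<sigma> i)"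

lemma linear_comb: "linear (comb \<sigma>)"
  unfolding comb_def
  by (rule linearI) (auto simp: scaleR_add_left sum.distrib scaleR_sum_right)

lemma comb_axis: "comb \<sigma> (axis i 1) = b \<sigma> i"
proof -
  have "comb \<sigma> (axis i 1) = (\<Sum>j\<in>UNIV. if j = i then b \<sigma> j else 0)"
    unfolding comb_def by (intro sum.cong) (auto simp: axis_def)
  then show ?thesis
    by simp
qed

lemma comb_inner: "comb \<sigma> p \<bullet> n = p \<bullet> beta b \<sigma> n"
proof -
  have "p \<bullet> beta b \<sigma> n = (\<Sum>i\<in>UNIV. p $ i * (b \<sigma> i \<bullet> n))"
    unfolding beta_def by (subst inner_vec_def) simp
  then show ?thesis
    by (simp add: comb_def inner_sum_left)
qed

lemma linear_beta: "linear (beta b \<sigma>)"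
  unfolding beta_def by (rule linearI) (auto simp: vec_eq_iff inner_add_right)

lemma b_lattice:
  assumes "\<sigma> facet_of \<Delta>"
  shows "b \<sigma> i \<in> int_lattice" "b \<sigma> i \<bullet> ns \<sigma> = 0"
  using bases assms unfolding facet_bases_def Z_basis_def by blast+

lemma lattice_comb:
  assumes "\<sigma> facet_of \<Delta>" "w \<in> int_lattice" "w \<bullet> ns \<sigma> = 0"
  obtains p where "w = comb \<sigma> p" "\<And>i. p $ i \<in> \<int>"
proof -
  obtain k :: "'k \<Rightarrow> int" where "w = (\<Sum>i\<in>UNIV. of_int (k i) *\<^sub>R b \<sigma> i)"
    using bases assms unfolding facet_bases_def Z_basis_def by blast
  then show ?thesis
    using that[of "\<chi> i. of_int (k i)"] by (simp add: comb_def)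
qed

text \<open>A lattice point \<open>u\<close> of \<open>\<sigma>\<close> splits the lattice into
  \<open>\<int> u\<close> and the integer vectors orthogonal to \<open>ns \<sigma>\<close>. Applying
  the projection along \<open>u\<close> to the standard basis yields enough lattice vectors to span
  the hyperplane.\<close>

lemma comb_range:
  assumes "\<sigma> facet_of \<Delta>"
  shows "range (comb \<sigma>) = {x. x \<bullet> ns \<sigma> = 0}"
proof (intro equalityI subsetI)
  fix x assume "x \<in> range (comb \<sigma>)"
  then show "x \<in> {x. x \<bullet> ns \<sigma> = 0}"
    using b_lattice(2)[OF assms] by (auto simp: comb_def inner_sum_left)
next
  fix x assume x: "x \<in> {x. x \<bullet> ns \<sigma> = 0}"
  obtain u where u: "u \<in> \<sigma>" "u \<in> int_lattice"
    using facet_lattice_point[OF assms] by blast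
  have sub: "subspace (range (comb \<sigma>))"
    using linear_comb by (metis linear_subspace_image subspace_UNIV)
  have "axis i 1 - (axis i 1 \<bullet> ns \<sigma>) *\<^sub>R u \<in> range (comb \<sigma>)" for i
  proof -
    have "ns \<sigma> \<in> int_lattice"
      using facet_Delta(1)[OF assms] NV(2) by blast
    moreover have "axis i 1 \<bullet> ns \<sigma> = ns \<sigma> $ i"
      by (simp add: inner_axis')
    ultimately have "axis i 1 - (axis i 1 \<bullet> ns \<sigma>) *\<^sub>R u \<in> int_lattice"
      using u(2) unfolding int_lattice_def by (auto simp: axis_def)
    moreover have "(axis i 1 - (axis i 1 \<bullet> ns \<sigma>) *\<^sub>R u) \<bullet> ns \<sigma> = 0"
      using ns_inner_facet[OF assms u(1)] by (simp add: inner_diff_left inner_commute[of u])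
    ultimately show ?thesis
      using lattice_comb[OF assms] by (metis rangeI)
  qed
  then have "(\<Sum>i\<in>UNIV. (x $ i) *\<^sub>R (axis i 1 - (axis i 1 \<bullet> ns \<sigma>) *\<^sub>R u)) \<in> range (comb \<sigma>)"
    by (intro subspace_sum subspace_scale sub)
  also have "(\<Sum>i\<in>UNIV. (x $ i) *\<^sub>R (axis i 1 - (axis i 1 \<bullet> ns \<sigma>) *\<^sub>R u))
      = (\<Sum>i\<in>UNIV. (x $ i) *\<^sub>R axis i 1) - (x \<bullet> ns \<sigma>) *\<^sub>R u"
    by (simp add: scaleR_diff_right sum_subtractf inner_axis' inner_vec_def[of x] scaleR_sum_left)
  also have "(\<Sum>i\<in>UNIV. (x $ i) *\<^sub>R axis i 1) = x"
    using basis_expansion[of x] by (simp add: scalar_mult_eq_scaleR)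
  finally show "x \<in> range (comb \<sigma>)"
    using x by simp
qed

lemma inj_comb:
  assumes "\<sigma> facet_of \<Delta>"
  shows "inj (comb \<sigma>)"
proof -
  have "dim (range (comb \<sigma>)) = CARD('k)"
    using comb_range[OF assms] dim_hyperplane[OF ns_nonzero[OF assms]] dim
    by (simp add: inner_commute)
  moreover have "(*v) (matrix (comb \<sigma>)) = comb \<sigma>"
    using linear_comb by (intro matrix_vector_mul) (simp add: linear_matrix_vector_mul_eq)
  ultimately show ?thesis
    using full_rank_injective[of "matrix (comb \<sigma>)"] by (simp add: rank_dim_range)
qed

text \<open>\<open>beta b \<sigma>\<close> determines all pairings with the hyperplane orthogonal to
  \<open>ns \<sigma>\<close>, so its fibres are lines parallel to
  \<open>ns \<sigma>\<close>.\<close>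

lemma beta_eq_iff:
  assumes "\<sigma> facet_of \<Delta>" "beta b \<sigma> n = beta b \<sigma> n'"
  obtains t where "n' = n + t *\<^sub>R ns \<sigma>"
proof -
  have orth: "x \<bullet> (n' - n) = 0" if "x \<bullet> ns \<sigma> = 0" for x
  proof -
    have "x \<in> range (comb \<sigma>)"
      unfolding comb_range[OF assms(1)] using that by simp
    then obtain p where "x = comb \<sigma> p"
      by (rule rangeE)
    then show ?thesis
      using assms(2) by (simp add: comb_inner inner_diff_right)
  qed
  define t where "t = ((n' - n) \<bullet> ns \<sigma>) / (ns \<sigma> \<bullet> ns \<sigma>)"
  define u where "u = (n' - n) - t *\<^sub>R ns \<sigma>"
  have u: "u \<bullet> ns \<sigma> = 0"
    using ns_nonzero[OF assms(1)] by (simp add: u_def t_def inner_diff_left)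
  then have "u \<bullet> (n' - n) = 0"
    by (rule orth)
  moreover have "u \<bullet> u = u \<bullet> (n' - n) - t * (u \<bullet> ns \<sigma>)"
    by (subst (2) u_def) (simp only: inner_diff_right inner_scaleR_right)
  ultimately have "u = 0"
    using u by simp
  then have "n' = n + t *\<^sub>R ns \<sigma>"
    unfolding u_def by (simp add: algebra_simps)
  then show ?thesis
    by (rule that)
qed

text \<open>\<open>D \<sigma>\<close> meets a line parallel to \<open>ns \<sigma>\<close> only in
  the last point of that line in \<open>P\<close>: going further would violate the constraint that
  is already tight.\<close>

lemma inj_on_beta_D:
  assumes "\<sigma> facet_of \<Delta>"
  shows "inj_on (beta b \<sigma>) (D \<sigma>)"
proof (rule inj_onI)
  have le: "t \<le> 0" if n: "n \<in> D \<sigma>" "n + t *\<^sub>R ns \<sigma> \<in> D \<sigma>" for n t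
  proof -
    obtain m where m: "m \<in> \<sigma> \<inter> int_lattice" "n \<in> tau_of \<Delta> h m"
      using n(1) unfolding beta_dom_def by blast
    have "n + t *\<^sub>R ns \<sigma> \<in> P"
      using n(2) D_subset_B[OF assms] B_subset by blast
    then have "m \<bullet> (n + t *\<^sub>R ns \<sigma>) \<le> of_int (h m)"
      using m(1) facet_lattice_subset[OF assms] P_eq by blast
    moreover have "m \<bullet> ns \<sigma> = 1"
      using ns_inner_facet[OF assms] m(1) by (simp add: inner_commute)
    ultimately show ?thesis
      using m(2) by (simp add: tau_of_def inner_add_right)
  qed
  fix n n' assume n: "n \<in> D \<sigma>" "n' \<in> D \<sigma>" "beta b \<sigma> n = beta b \<sigma> n'"
  obtain t where t: "n' = n + t *\<^sub>R ns \<sigma>"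
    using beta_eq_iff[OF assms n(3)] .
  then have "n = n' + (- t) *\<^sub>R ns \<sigma>"
    by simp
  then have "t \<le> 0" "- t \<le> 0"
    using le[of n t] le[of n' "- t"] n t by auto
  then show "n = n'"
    using t by simp
qed

lemma beta_inv_beta:
  "\<sigma> facet_of \<Delta> \<Longrightarrow> n \<in> D \<sigma> \<Longrightarrow> beta_inv \<Delta> h b \<sigma> (beta b \<sigma> n) = n"
  using inv_into_f_f[OF inj_on_beta_D] by (simp add: beta_inv_def)

section \<open>Affine charts of the facets\<close>

abbreviation chart where "chart \<equiv> facet_chart b"

lemma chart_eq: "chart \<sigma> y = (SOME p. p \<in> \<sigma>) + comb \<sigma> y"
  by (simp add: facet_chart_def comb_def)

lemma chart_base: "\<sigma> facet_of \<Delta> \<Longrightarrow> (SOME p. p \<in> \<sigma>) \<in> \<sigma>"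
  unfolding facet_of_def by (metis some_in_eq)

lemma ns_chart:
  assumes "\<sigma> facet_of \<Delta>"
  shows "ns \<sigma> \<bullet> chart \<sigma> y = 1"
proof -
  have "comb \<sigma> y \<in> {x. x \<bullet> ns \<sigma> = 0}"
    unfolding comb_range[OF assms, symmetric] by (rule rangeI)
  then have "comb \<sigma> y \<bullet> ns \<sigma> = 0"
    by simp
  then show ?thesis
    using ns_inner_facet[OF assms chart_base[OF assms]]
    by (simp add: chart_eq inner_add_right inner_commute)
qed

lemma chart_surj:
  assumes "\<sigma> facet_of \<Delta>" "ns \<sigma> \<bullet> x = 1"
  obtains y where "chart \<sigma> y = x"
proof -
  have "(x - (SOME p. p \<in> \<sigma>)) \<bullet> ns \<sigma> = 0"
    using assms(2) ns_inner_facet[OF assms(1) chart_base[OF assms(1)]]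
    by (metis diff_self inner_commute inner_diff_right)
  then have "x - (SOME p. p \<in> \<sigma>) \<in> range (comb \<sigma>)"
    unfolding comb_range[OF assms(1)] by simp
  then obtain y where "x - (SOME p. p \<in> \<sigma>) = comb \<sigma> y"
    by (rule rangeE)
  then show ?thesis
    using that[of y] by (simp add: chart_eq algebra_simps)
qed

lemma continuous_chart: "continuous_on S (chart \<sigma>)"
  unfolding chart_eq
  by (intro continuous_intros linear_continuous_on linear_comb[unfolded linear_conv_bounded_linear])

lemma closed_chart_vimage: "closed S \<Longrightarrow> closed (chart \<sigma> -` S)"
  using continuous_closed_vimage[of S "chart \<sigma>"] continuous_chart[of UNIV \<sigma>]
  by (simp add: continuous_on_eq_continuous_at)

lemma compact_chart_vimage:
  assumes "\<sigma> facet_of \<Delta>" "compact S"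
  shows "compact (chart \<sigma> -` S)"
proof -
  obtain g where g: "linear g" "g \<circ> comb \<sigma> = id"
    using linear_injective_left_inverse[OF linear_comb inj_comb[OF assms(1)]] by blast
  have "chart \<sigma> -` S \<subseteq> (\<lambda>x. g (x - (SOME p. p \<in> \<sigma>))) ` S"
  proof
    fix y assume "y \<in> chart \<sigma> -` S"
    moreover have "g (chart \<sigma> y - (SOME p. p \<in> \<sigma>)) = y"
      using g(2) by (simp add: chart_eq fun_eq_iff)
    ultimately show "y \<in> (\<lambda>x. g (x - (SOME p. p \<in> \<sigma>))) ` S"
      by (metis imageI vimageE)
  qed
  moreover have "continuous_on S (\<lambda>x. g (x - (SOME p. p \<in> \<sigma>)))"
    by (rule linear_continuous_on_compose[OF _ g(1)]) (intro continuous_intros)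
  then have "compact ((\<lambda>x. g (x - (SOME p. p \<in> \<sigma>))) ` S)"
    using assms(2) by (rule compact_continuous_image)
  ultimately have "bounded (chart \<sigma> -` S)"
    using bounded_subset compact_imp_bounded by blast
  then show ?thesis
    using closed_chart_vimage[OF compact_imp_closed[OF assms(2)]] by (simp add: compact_eq_bounded_closed)
qed

section \<open>Contact pairs\<close>

text \<open>For \<open>m \<in> A\<close> and \<open>\<Psi>\<close> c-convex this says that \<open>n\<close> is a c-subgradient of \<open>\<Psi>\<^sup>c\<close> at \<open>m\<close>; the
  point is that it makes sense, and is a convex condition, for all \<open>m\<close>.\<close>

definition con :: "(real ^ 'n \<Rightarrow> real) \<Rightarrow> real ^ 'n \<Rightarrow> real ^ 'n \<Rightarrow> bool" where
  "con \<Psi> m n \<longleftrightarrow> n \<in> B \<and> (\<forall>n'\<in>B. \<Psi> n + m \<bullet> (n' - n) \<le> \<Psi> n')"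

text \<open>The common property of c-convex functions on \<open>B\<close> and of members of
  \<open>P_class \<Delta>\<close>, so that both kinds of potential are treated at once.\<close>

definition adm :: "(real ^ 'n \<Rightarrow> real) \<Rightarrow> bool" where
  "adm \<Psi> \<longleftrightarrow> continuous_on B \<Psi> \<and> (\<forall>n\<in>B. \<exists>m\<in>A. con \<Psi> m n)"

lemma con_B: "con \<Psi> m n \<Longrightarrow> n \<in> B"
  by (simp add: con_def)

lemma conD: "con \<Psi> m n \<Longrightarrow> n' \<in> B \<Longrightarrow> \<Psi> n + m \<bullet> (n' - n) \<le> \<Psi> n'"
  by (simp add: con_def)

lemma con_cong: "(\<And>n. n \<in> B \<Longrightarrow> \<Psi> n = \<Psi>' n) \<Longrightarrow> con \<Psi> m n \<longleftrightarrow> con \<Psi>' m n"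
  by (auto simp: con_def)

lemma con_c_transform:
  assumes "con \<Psi> m n"
  shows "c_transform B \<Psi> m = m \<bullet> n - \<Psi> n"
  by (rule c_transform_eqI) (use assms in \<open>auto simp: con_def inner_diff_right algebra_simps\<close>)

lemma con_iff:
  assumes "continuous_on B \<Psi>" "n \<in> B"
  shows "con \<Psi> m n \<longleftrightarrow> c_transform B \<Psi> m \<le> m \<bullet> n - \<Psi> n"
proof
  assume le: "c_transform B \<Psi> m \<le> m \<bullet> n - \<Psi> n"
  have "m \<bullet> n' - \<Psi> n' \<le> m \<bullet> n - \<Psi> n" if "n' \<in> B" for n'
    using c_transform_ge[OF B_compact assms(1) that, of m] le by simp
  then show "con \<Psi> m n"
    using assms(2) by (auto simp: con_def inner_diff_right algebra_simps)
qed (simp add: con_c_transform)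

lemma con_exists:
  assumes "continuous_on B \<Psi>"
  obtains n where "con \<Psi> m n"
proof -
  obtain n where n: "n \<in> B" "c_transform B \<Psi> m = m \<bullet> n - \<Psi> n"
    using c_transform_attained[OF B_compact B_nonempty assms] by metis
  show ?thesis
    by (rule that[of n]) (simp add: con_iff[OF assms n(1)] n(2))
qed

lemma convex_con: "convex {m. con \<Psi> m n}"
proof (cases "n \<in> B")
  case True
  have "{m. con \<Psi> m n} = (\<Inter>n'\<in>B. {m. (n' - n) \<bullet> m \<le> \<Psi> n' - \<Psi> n})"
    using True by (auto simp: con_def inner_commute algebra_simps)
  then show ?thesis
    by (simp add: convex_INT convex_halfspace_le)
qed (simp add: con_def)

text \<open>\<open>m0\<close> is an outer normal of \<open>P\<close> at \<open>n\<close>, and adding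
  outer normals preserves subgradients.\<close>

lemma con_push:
  assumes "con \<Psi> m n" "m0 \<in> AM" "n \<in> tau_of \<Delta> h m0" "t \<ge> 0"
  shows "con \<Psi> (m + t *\<^sub>R m0) n"
  unfolding con_def
proof (intro conjI ballI)
  fix n' assume n': "n' \<in> B"
  then have "m0 \<bullet> n' \<le> of_int (h m0)"
    using B_subset assms(2) P_eq by blast
  then have "m0 \<bullet> (n' - n) \<le> 0"
    using assms(3) by (simp add: tau_of_def inner_diff_right)
  then have "t * (m0 \<bullet> (n' - n)) \<le> 0"
    using assms(4) by (simp add: mult_nonneg_nonpos)
  then show "\<Psi> n + (m + t *\<^sub>R m0) \<bullet> (n' - n) \<le> \<Psi> n'"
    using conD[OF assms(1) n'] by (simp add: inner_add_left)
qed (rule con_B[OF assms(1)])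

text \<open>Along \<open>ns \<sigma>\<close> the potential grows with slope at most 1, because
  contact points lie in \<open>\<Delta>\<close>, while the pairing with \<open>m\<close> grows with
  slope exactly 1.\<close>

lemma con_push_D:
  assumes "adm \<Psi>" "con \<Psi> m n" "\<sigma> facet_of \<Delta>" "m \<in> \<sigma>"
  shows "con \<Psi> m (n + gap \<sigma> n *\<^sub>R ns \<sigma>)" "n + gap \<sigma> n *\<^sub>R ns \<sigma> \<in> D \<sigma>"
proof -
  let ?n = "n + gap \<sigma> n *\<^sub>R ns \<sigma>"
  have n: "n \<in> B" "n \<in> P"
    using con_B[OF assms(2)] B_subset by auto
  show D: "?n \<in> D \<sigma>"
    using push_to_D[OF n(2) assms(3)] by blast
  then have "?n \<in> B"
    using D_subset_B[OF assms(3)] by blast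
  then obtain m' where m': "m' \<in> A" "con \<Psi> m' ?n"
    using assms(1) unfolding adm_def by blast
  have "\<Psi> ?n + m' \<bullet> (n - ?n) \<le> \<Psi> n"
    using conD[OF m'(2) n(1)] .
  moreover have "gap \<sigma> n * (m' \<bullet> ns \<sigma>) \<le> gap \<sigma> n * 1"
    using push_to_D(1)[OF n(2) assms(3)] ns_inner_le[OF assms(3), of m'] m'(1) A_subset
    by (intro mult_left_mono) (auto simp: inner_commute)
  ultimately have le: "\<Psi> ?n \<le> \<Psi> n + gap \<sigma> n"
    by simp
  show "con \<Psi> m ?n"
    unfolding con_def
  proof (intro conjI ballI)
    fix n' assume "n' \<in> B"
    then have "\<Psi> n + m \<bullet> (n' - n) \<le> \<Psi> n'"
      by (rule conD[OF assms(2)])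
    moreover have "m \<bullet> (n' - ?n) = m \<bullet> (n' - n) - gap \<sigma> n"
      using ns_inner_facet[OF assms(3,4)] by (simp add: inner_diff_right inner_add_right inner_commute)
    ultimately show "\<Psi> ?n + m \<bullet> (n' - ?n) \<le> \<Psi> n'"
      using le by simp
  qed fact
qed

text \<open>For the harder direction, a contact point \<open>m'\<close> of \<open>n\<close> recovers
  \<open>\<Psi> n\<close> from the transform; testing the c-subgradient inequality at
  \<open>m'\<close> then gives equality in the Fenchel inequality at \<open>m\<close>.\<close>

lemma c_subgradient_iff:
  assumes "adm \<Psi>" "m \<in> A"
  shows "n \<in> c_subgradient \<Delta> h (c_transform B \<Psi>) m \<longleftrightarrow> con \<Psi> m n"
proof
  have cont: "continuous_on B \<Psi>"
    using assms(1) by (simp add: adm_def)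
  assume con: "con \<Psi> m n"
  show "n \<in> c_subgradient \<Delta> h (c_transform B \<Psi>) m"
    unfolding c_subgradient_def
    using con_B[OF con] con_c_transform[OF con] c_transform_ge[OF B_compact cont con_B[OF con]]
    by (auto simp: inner_diff_left)
next
  have cont: "continuous_on B \<Psi>"
    using assms(1) by (simp add: adm_def)
  assume n: "n \<in> c_subgradient \<Delta> h (c_transform B \<Psi>) m"
  then have "n \<in> B"
    by (simp add: c_subgradient_def)
  then obtain m' where m': "m' \<in> A" "con \<Psi> m' n"
    using assms(1) unfolding adm_def by blast
  then have "c_transform B \<Psi> m \<le> m \<bullet> n - \<Psi> n"
    using n con_c_transform[OF m'(2)] unfolding c_subgradient_def
    by (fastforce simp: inner_diff_left)
  then show "con \<Psi> m n"
    using con_iff[OF cont \<open>n \<in> B\<close>] by simp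
qed

lemma closed_con:
  assumes "continuous_on B \<Psi>"
  shows "closed {(m, n). con \<Psi> m n}"
proof -
  have eq: "{(m, n). con \<Psi> m n}
      = (\<Inter>n'\<in>B. {z \<in> UNIV \<times> B. \<Psi> (snd z) + fst z \<bullet> (n' - snd z) \<le> \<Psi> n'})"
    using B_nonempty by (auto simp: con_def)
  have c: "continuous_on (UNIV \<times> B) (\<lambda>z. \<Psi> (snd z))"
    by (rule continuous_on_compose2[OF assms]) (auto intro!: continuous_intros)
  have "closed {z \<in> UNIV \<times> B. \<Psi> (snd z) + fst z \<bullet> (n' - snd z) \<le> \<Psi> n'}" for n'
    by (intro continuous_on_closed_Collect_le continuous_intros c closed_Times closed_UNIV
        compact_imp_closed B_compact)
  then show ?thesis
    unfolding eq by (simp add: closed_INT)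
qed

lemma con_limit:
  assumes "continuous_on B \<Psi>" "\<And>j. con \<Psi> (m j) (n j)" "m \<longlonglongrightarrow> m'" "n \<longlonglongrightarrow> n'"
  shows "con \<Psi> m' n'"
proof -
  have "(\<lambda>j. (m j, n j)) \<longlonglongrightarrow> (m', n')"
    using assms(3,4) by (rule tendsto_Pair)
  then have "(m', n') \<in> {(m, n). con \<Psi> m n}"
    using closed_sequentially[OF closed_con[OF assms(1)], of "\<lambda>j. (m j, n j)"] assms(2) by blast
  then show ?thesis
    by simp
qed

lemma compact_con:
  assumes "continuous_on B \<Psi>" "compact S"
  shows "compact {(m, n). m \<in> S \<and> con \<Psi> m n}"
proof -
  have "{(m, n). m \<in> S \<and> con \<Psi> m n} = (S \<times> B) \<inter> {(m, n). con \<Psi> m n}"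
    using con_B by auto
  then show ?thesis
    using compact_Int_closed[OF compact_Times[OF assms(2) B_compact] closed_con[OF assms(1)]] by simp
qed

lemma compact_con_image:
  assumes "continuous_on B \<Psi>" "compact S"
  shows "compact {n. \<exists>m\<in>S. con \<Psi> m n}"
proof -
  have "{n. \<exists>m\<in>S. con \<Psi> m n} = snd ` {(m, n). m \<in> S \<and> con \<Psi> m n}"
    by force
  then show ?thesis
    using compact_continuous_image[OF continuous_on_snd[OF continuous_on_id] compact_con[OF assms]]
    by simp
qed

subsection \<open>Admissible functions\<close>

text \<open>By the growth condition every subgradient at \<open>n\<close> lies in
  \<open>\<Delta>\<close>. Pushing it along the normal of a constraint active at \<open>n\<close>
  moves it into \<open>A\<close> without losing contact.\<close>

lemma adm_P_class:
  assumes "\<Psi> \<in> P_class \<Delta>"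
  shows "adm \<Psi>"
  unfolding adm_def
proof (intro conjI ballI)
  have conv: "convex_on UNIV \<Psi>"
    using assms by (simp add: P_class_def)
  show "continuous_on B \<Psi>"
    using continuous_on_subset[OF convex_on_continuous[OF open_UNIV conv]] by blast
  fix n assume n: "n \<in> B"
  obtain p where p: "\<And>n'. \<Psi> n' \<ge> \<Psi> n + p \<bullet> (n' - n)"
    using convex_on_UNIV_subgradient[OF conv] by metis
  obtain C where C: "\<And>n. \<bar>\<Psi> n - (SUP m\<in>\<Delta> \<inter> int_lattice. m \<bullet> n)\<bar> \<le> C"
    using assms by (auto simp: P_class_def)
  have "p \<in> \<Delta>"
    unfolding in_Delta_iff
  proof
    fix v assume v: "v \<in> NV"
    have bound: "\<Psi> (n + t *\<^sub>R v) \<le> (\<Sum>m\<in>AM. \<bar>m \<bullet> n\<bar>) + t + C" if "t \<ge> 0" for t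
    proof -
      have "(SUP m\<in>\<Delta> \<inter> int_lattice. m \<bullet> (n + t *\<^sub>R v)) \<le> (\<Sum>m\<in>AM. \<bar>m \<bullet> n\<bar>) + t"
      proof (rule cSUP_least)
        show "\<Delta> \<inter> int_lattice \<noteq> {}"
          using lattice_points by simp
        fix m assume m: "m \<in> \<Delta> \<inter> int_lattice"
        have "m \<bullet> n \<le> (\<Sum>m\<in>AM. \<bar>m \<bullet> n\<bar>)"
        proof (cases "m = 0")
          case False
          then have "m \<in> AM"
            using m lattice_points by blast
          then have "\<bar>m \<bullet> n\<bar> \<le> (\<Sum>m\<in>AM. \<bar>m \<bullet> n\<bar>)"
            using finite_AM by (intro member_le_sum) auto
          then show ?thesis
            by linarith
        qed (simp add: sum_nonneg)
        moreover have "t * (v \<bullet> m) \<le> t * 1"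
          using m v that in_Delta_iff by (intro mult_left_mono) auto
        ultimately show "m \<bullet> (n + t *\<^sub>R v) \<le> (\<Sum>m\<in>AM. \<bar>m \<bullet> n\<bar>) + t"
          by (simp add: inner_add_right inner_commute)
      qed
      then show ?thesis
        using C[of "n + t *\<^sub>R v"] by linarith
    qed
    show "v \<bullet> p \<le> 1"
    proof (rule ccontr)
      assume "\<not> v \<bullet> p \<le> 1"
      \<comment> \<open>\<open>E\<close> is the constant in the upper growth bound minus
        \<open>\<Psi> n\<close>. The chosen \<open>t\<close> makes the excess of the linear lower
        bound equal to \<open>\<bar>E\<bar> + 1\<close>, hence too large.\<close>
      define E where "E = (\<Sum>m\<in>AM. \<bar>m \<bullet> n\<bar>) + C - \<Psi> n"
      define t where "t = (\<bar>E\<bar> + 1) / (v \<bullet> p - 1)"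
      have "t \<ge> 0"
        using \<open>\<not> v \<bullet> p \<le> 1\<close> by (simp add: t_def)
      then have "t * (v \<bullet> p) \<le> t + E"
        using bound[of t] p[of "n + t *\<^sub>R v"] by (simp add: E_def inner_commute)
      then have "t * (v \<bullet> p - 1) \<le> E"
        by (simp add: algebra_simps)
      moreover have "t * (v \<bullet> p - 1) = \<bar>E\<bar> + 1"
        using \<open>\<not> v \<bullet> p \<le> 1\<close> by (simp add: t_def)
      ultimately show False
        by linarith
    qed
  qed
  obtain m0 where m0: "m0 \<in> AM" "n \<in> tau_of \<Delta> h m0"
    using B_tauE[OF n] .
  obtain t where t: "t \<ge> 0" "p + t *\<^sub>R m0 \<in> star_of \<Delta> m0"
    using push_to_star[OF \<open>p \<in> \<Delta>\<close> m0(1)] .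
  have "con \<Psi> p n"
    using n p by (simp add: con_def)
  then have "con \<Psi> (p + t *\<^sub>R m0) n"
    using con_push m0 t(1) by blast
  then show "\<exists>m\<in>A. con \<Psi> m n"
    using t(2) star_of_subset by blast
qed

lemma adm_c_transform:
  assumes "continuous_on A \<Phi>" "\<And>n. n \<in> B \<Longrightarrow> \<Psi> n = c_transform A \<Phi> n"
  shows "adm \<Psi>"
  unfolding adm_def
proof (intro conjI ballI)
  show "continuous_on B \<Psi>"
    using c_transform_continuous_on[OF A_compact A_nonempty assms(1)] assms(2)
    by (simp cong: continuous_on_cong)
  fix n assume n: "n \<in> B"
  obtain m where m: "m \<in> A" "c_transform A \<Phi> n = n \<bullet> m - \<Phi> m"
    using c_transform_attained[OF A_compact A_nonempty assms(1)] by metis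
  have "con \<Psi> m n"
    unfolding con_def
  proof (intro conjI ballI n)
    fix n' assume n': "n' \<in> B"
    have "n' \<bullet> m - \<Phi> m \<le> c_transform A \<Phi> n'"
      using c_transform_ge[OF A_compact assms(1) m(1)] .
    then show "\<Psi> n + m \<bullet> (n' - n) \<le> \<Psi> n'"
      using assms(2) n n' m(2) by (simp add: inner_diff_right inner_commute)
  qed
  then show "\<exists>m\<in>A. con \<Psi> m n"
    using m(1) by blast
qed

lemma adm_c_convex: "c_convex_B \<Delta> h \<Psi> \<Longrightarrow> adm \<Psi>"
  unfolding c_convex_B_def using adm_c_transform by blast

lemma continuous_c_transform_B: "adm \<Psi> \<Longrightarrow> continuous_on S (c_transform B \<Psi>)"
  using c_transform_continuous_on[OF B_compact B_nonempty] by (simp add: adm_def)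

lemma c_extension_eq:
  assumes "adm \<Psi>" "n \<in> B"
  shows "c_extension \<Delta> h \<Psi> n = \<Psi> n"
proof -
  obtain m where m: "m \<in> A" "con \<Psi> m n"
    using assms unfolding adm_def by blast
  have cont: "continuous_on B \<Psi>"
    using assms by (simp add: adm_def)
  have "c_extension \<Delta> h \<Psi> n = n \<bullet> m - c_transform B \<Psi> m"
    unfolding c_extension_def
  proof (rule c_transform_eqI[OF m(1)])
    fix m' assume "m' \<in> A"
    show "n \<bullet> m' - c_transform B \<Psi> m' \<le> n \<bullet> m - c_transform B \<Psi> m"
      using con_c_transform[OF m(2)] c_transform_ge[OF B_compact cont assms(2), of m']
      by (simp add: inner_commute)
  qed
  then show ?thesis
    using con_c_transform[OF m(2)] by (simp add: inner_commute)
qed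

text \<open>Up to a bound on the transform this is the support function of \<open>A\<close>, and
  \<open>\<Delta>\<close> is the hull of its lattice points. The lattice point 0 is not in
  \<open>A\<close>; it is dominated because some \<open>a\<close> in \<open>AM\<close> pairs
  non-negatively with \<open>n\<close>, as 0 is interior to \<open>\<Delta>\<close>.\<close>

lemma c_extension_P_class:
  assumes "adm \<Psi>"
  shows "c_extension \<Delta> h \<Psi> \<in> P_class \<Delta>"
  unfolding P_class_def
proof (intro CollectI conjI)
  define \<Phi> where "\<Phi> = c_transform B \<Psi>"
  have cont: "continuous_on A \<Phi>"
    unfolding \<Phi>_def by (rule continuous_c_transform_B[OF assms])
  show "convex_on UNIV (c_extension \<Delta> h \<Psi>)"
    unfolding c_extension_def
    by (rule c_transform_convex_on[OF A_compact A_nonempty cont[unfolded \<Phi>_def]])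
  have "bounded (\<Phi> ` A)"
    by (intro compact_imp_bounded compact_continuous_image cont A_compact)
  then obtain C where C: "\<And>m. m \<in> A \<Longrightarrow> \<bar>\<Phi> m\<bar> \<le> C"
    unfolding bounded_iff by auto
  have C0: "0 \<le> C"
    using C A_nonempty by fastforce
  have "\<bar>c_extension \<Delta> h \<Psi> n - (SUP m\<in>\<Delta> \<inter> int_lattice. m \<bullet> n)\<bar> \<le> C" for n
  proof -
    let ?s = "SUP m\<in>\<Delta> \<inter> int_lattice. m \<bullet> n"
    obtain m where m: "m \<in> A" "c_extension \<Delta> h \<Psi> n = n \<bullet> m - \<Phi> m"
      "\<And>m'. m' \<in> A \<Longrightarrow> n \<bullet> m' - \<Phi> m' \<le> n \<bullet> m - \<Phi> m"
      using c_transform_attained[OF A_compact A_nonempty cont, of n]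
      unfolding c_extension_def \<Phi>_def by metis
    have bdd: "bdd_above ((\<lambda>m. m \<bullet> n) ` (\<Delta> \<inter> int_lattice))"
      unfolding lattice_points using finite_AM by (intro bdd_above_finite) auto
    obtain V where V: "finite V" "V \<subseteq> int_lattice" "V \<subseteq> \<Delta>" "\<Delta> = convex hull V"
      by (rule lattice_hull)
    have "V \<subseteq> {x. n \<bullet> x \<le> ?s}"
    proof
      fix x assume "x \<in> V"
      then have "x \<in> \<Delta> \<inter> int_lattice"
        using V by auto
      then have "x \<bullet> n \<le> ?s"
        using bdd by (intro cSUP_upper)
      then show "x \<in> {x. n \<bullet> x \<le> ?s}"
        by (simp add: inner_commute)
    qed
    then have "convex hull V \<subseteq> {x. n \<bullet> x \<le> ?s}"
      by (intro hull_minimal convex_halfspace_le)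
    moreover have "m \<in> convex hull V"
      using m(1) A_subset V(4) by auto
    ultimately have "n \<bullet> m \<le> ?s"
      by blast
    then have 1: "c_extension \<Delta> h \<Psi> n \<le> ?s + C"
      using m(2) C[OF m(1)] by simp
    have "?s \<le> c_extension \<Delta> h \<Psi> n + C"
    proof (rule cSUP_least)
      fix x assume x: "x \<in> \<Delta> \<inter> int_lattice"
      show "x \<bullet> n \<le> c_extension \<Delta> h \<Psi> n + C"
      proof (cases "x = 0")
        case False
        then have "x \<in> A"
          using x lattice_points by blast
        then show ?thesis
          using m(2) m(3)[of x] C[of x] by (simp add: inner_commute)
      next
        case True
        have "\<exists>a\<in>AM. 0 \<le> n \<bullet> a"
        proof (rule ccontr)
          assume neg: "\<not> ?thesis"
          have "AM \<noteq> {}"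
            using B_nonempty B_tauE by blast
          then have "n \<noteq> 0"
            using neg by fastforce
          have "V \<subseteq> {x. n \<bullet> x \<le> 0}"
          proof
            fix x assume "x \<in> V"
            then have "x \<in> insert 0 AM"
              using V lattice_points by blast
            then show "x \<in> {x. n \<bullet> x \<le> 0}"
              using neg by (cases "x = 0") (auto simp: not_le intro: less_imp_le)
          qed
          then have sub: "\<Delta> \<subseteq> {x. n \<bullet> x \<le> 0}"
            unfolding V(4) by (intro hull_minimal convex_halfspace_le)
          obtain r where r: "r > 0" "cball 0 r \<subseteq> \<Delta>"
            using zero_interior by (metis mem_interior_cball)
          then have "(r / norm n) *\<^sub>R n \<in> \<Delta>"
            using \<open>n \<noteq> 0\<close> by auto
          then have "(r / norm n) * (n \<bullet> n) \<le> 0"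
            using sub by auto
          moreover have "(r / norm n) * (n \<bullet> n) > 0"
            using r \<open>n \<noteq> 0\<close> by (intro mult_pos_pos) (simp_all add: inner_gt_zero_iff)
          ultimately show False
            by linarith
        qed
        then obtain a where a: "a \<in> A" "n \<bullet> a \<ge> 0"
          by blast
        then show ?thesis
          using True m(2) m(3)[OF a(1)] C[OF a(1)] by simp
      qed
    qed (use lattice_points in simp)
    then show ?thesis
      using 1 by linarith
  qed
  then show "\<exists>C. \<forall>n. \<bar>c_extension \<Delta> h \<Psi> n - (SUP m\<in>\<Delta> \<inter> int_lattice. m \<bullet> n)\<bar> \<le> C"
    by blast
qed

section \<open>The transport map\<close>

text \<open>A star is a union of facets, so the support set can be regrouped by facets. In this form
  it is a finite union of compact products, and \<open>beta\<close> is injective on each second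
  factor.\<close>

lemma support_set_iff:
  "(m, n) \<in> support_set \<Delta> h \<longleftrightarrow> (\<exists>\<sigma>. \<sigma> facet_of \<Delta> \<and> m \<in> \<sigma> \<and> n \<in> D \<sigma>)"
proof
  assume "(m, n) \<in> support_set \<Delta> h"
  then obtain m0 where m0: "m0 \<in> AM" "m \<in> star_of \<Delta> m0" "n \<in> tau_of \<Delta> h m0"
    unfolding support_set_def by blast
  obtain \<sigma> where "\<sigma> facet_of \<Delta>" "m \<in> \<sigma>" "m0 \<in> \<sigma>"
    using star_of_facet[OF m0(2)] .
  then show "\<exists>\<sigma>. \<sigma> facet_of \<Delta> \<and> m \<in> \<sigma> \<and> n \<in> D \<sigma>"
    using m0 unfolding beta_dom_def by blast
next
  assume "\<exists>\<sigma>. \<sigma> facet_of \<Delta> \<and> m \<in> \<sigma> \<and> n \<in> D \<sigma>"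
  then obtain \<sigma> where \<sigma>: "\<sigma> facet_of \<Delta>" "m \<in> \<sigma>" "n \<in> D \<sigma>"
    by blast
  then obtain m0 where m0: "m0 \<in> \<sigma> \<inter> int_lattice" "n \<in> tau_of \<Delta> h m0"
    unfolding beta_dom_def by blast
  then have "m0 \<in> AM" "m \<in> star_of \<Delta> m0"
    using facet_lattice_subset[OF \<sigma>(1)] facet_star_of[OF \<sigma>(1,2)] by auto
  then show "(m, n) \<in> support_set \<Delta> h"
    using m0 unfolding support_set_def by blast
qed

lemma D_compact: "\<sigma> facet_of \<Delta> \<Longrightarrow> compact (D \<sigma>)"
  unfolding beta_dom_def using facet_lattice_finite(1) by (intro compact_UN tau_of_compact)

lemma support_set_compact: "compact (support_set \<Delta> h)"
proof -
  have "support_set \<Delta> h = (\<Union>\<sigma>\<in>{\<sigma>. \<sigma> facet_of \<Delta>}. \<sigma> \<times> D \<sigma>)"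
    using support_set_iff by auto
  then show ?thesis
    using finite_facets by (auto intro!: compact_UN compact_Times facet_compact D_compact)
qed

lemma support_set_subset: "support_set \<Delta> h \<subseteq> A \<times> B"
  using support_set_iff facet_subset_A D_subset_B by fastforce

definition rel :: "(real ^ 'n \<Rightarrow> real) \<Rightarrow> real ^ 'n \<Rightarrow> real ^ 'n \<Rightarrow> bool" where
  "rel \<Psi> m n \<longleftrightarrow> con \<Psi> m n \<and> (m, n) \<in> support_set \<Delta> h"

lemma rel_exists:
  assumes "adm \<Psi>" "m \<in> A"
  obtains n where "rel \<Psi> m n"
proof -
  obtain \<sigma> where \<sigma>: "\<sigma> facet_of \<Delta>" "m \<in> \<sigma>"
    using A_facetE[OF assms(2)] .
  obtain n where n: "con \<Psi> m n"
    using con_exists assms(1) unfolding adm_def by metis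
  then have "rel \<Psi> m (n + gap \<sigma> n *\<^sub>R ns \<sigma>)"
    using con_push_D[OF assms(1) n \<sigma>] support_set_iff \<sigma> unfolding rel_def by blast
  then show ?thesis
    by (rule that)
qed

lemma rel_compact:
  assumes "adm \<Psi>" "closed T"
  shows "compact {(m, n). rel \<Psi> m n \<and> n \<in> T}"
proof -
  have "{(m, n). rel \<Psi> m n \<and> n \<in> T} = support_set \<Delta> h \<inter> ({(m, n). con \<Psi> m n} \<inter> (UNIV \<times> T))"
    unfolding rel_def by auto
  moreover have "closed ({(m, n). con \<Psi> m n} \<inter> (UNIV \<times> T))"
    using assms unfolding adm_def by (intro closed_Int closed_con closed_Times) auto
  ultimately show ?thesis
    using compact_Int_closed[OF support_set_compact] by simp
qed

text \<open>The transform has, at these points of \<open>\<sigma>\<close>, subgradients on both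
  sides of the window from \<open>r\<close> to \<open>s\<close> in direction
  \<open>b \<sigma> i\<close>. Rational windows give countably many compact sets that cover all
  points with two different values.\<close>

definition kink :: "(real ^ 'n \<Rightarrow> real) \<Rightarrow> (real ^ 'n) set \<Rightarrow> 'k \<Rightarrow> real \<Rightarrow> real \<Rightarrow> (real ^ 'n) set" where
  "kink \<Psi> \<sigma> i r s =
     {m \<in> \<sigma>. \<exists>n n'. con \<Psi> m n \<and> con \<Psi> m n' \<and> b \<sigma> i \<bullet> n \<le> r \<and> s \<le> b \<sigma> i \<bullet> n'}"

text \<open>Outside this set a point of \<open>A\<close> lies on a single facet, and all its contact
  points have the same image under \<open>beta\<close>.\<close>

definition bad :: "(real ^ 'n \<Rightarrow> real) \<Rightarrow> (real ^ 'n) set" where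
  "bad \<Psi> = (\<Union>\<sigma>\<in>{\<sigma>. \<sigma> facet_of \<Delta>}.
     (\<Union>\<sigma>'\<in>{\<sigma>'. \<sigma>' facet_of \<Delta> \<and> \<sigma>' \<noteq> \<sigma>}. \<sigma> \<inter> \<sigma>') \<union>
     (\<Union>i. \<Union>(r, s)\<in>{(r, s). r \<in> \<rat> \<and> s \<in> \<rat> \<and> r < s}. kink \<Psi> \<sigma> i r s))"

lemma bad_iff:
  "m \<in> bad \<Psi> \<longleftrightarrow> (\<exists>\<sigma>. \<sigma> facet_of \<Delta> \<and> m \<in> \<sigma> \<and>
     ((\<exists>\<sigma>'. \<sigma>' facet_of \<Delta> \<and> \<sigma>' \<noteq> \<sigma> \<and> m \<in> \<sigma>') \<or>
      (\<exists>i r s. r \<in> \<rat> \<and> s \<in> \<rat> \<and> r < s \<and> m \<in> kink \<Psi> \<sigma> i r s)))"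
proof -
  define K where "K \<sigma> = (\<Union>i. \<Union>(r, s)\<in>{(r, s). r \<in> \<rat> \<and> s \<in> \<rat> \<and> r < s}. kink \<Psi> \<sigma> i r s)" for \<sigma>
  have K: "m \<in> K \<sigma> \<longleftrightarrow> (\<exists>i r s. r \<in> \<rat> \<and> s \<in> \<rat> \<and> r < s \<and> m \<in> kink \<Psi> \<sigma> i r s)" for \<sigma>
    unfolding K_def by auto
  have sub: "m \<in> kink \<Psi> \<sigma> i r s \<Longrightarrow> m \<in> \<sigma>" for \<sigma> i r s
    by (simp add: kink_def)
  have split: "m \<in> bad \<Psi> \<longleftrightarrow> (\<exists>\<sigma>. \<sigma> facet_of \<Delta> \<and>
      ((\<exists>\<sigma>'. \<sigma>' facet_of \<Delta> \<and> \<sigma>' \<noteq> \<sigma> \<and> m \<in> \<sigma> \<and> m \<in> \<sigma>') \<or> m \<in> K \<sigma>))"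
    unfolding bad_def K_def[symmetric] by auto
  have "m \<in> K \<sigma> \<longleftrightarrow> m \<in> \<sigma> \<and> m \<in> K \<sigma>" for \<sigma>
    using K sub by blast
  then show ?thesis
    unfolding split K by meson
qed

lemma kink_compact:
  assumes "adm \<Psi>" "\<sigma> facet_of \<Delta>"
  shows "compact (kink \<Psi> \<sigma> i r s)"
proof -
  have cont: "continuous_on B \<Psi>"
    using assms(1) by (simp add: adm_def)
  define S where "S T = fst ` ({(m, n). m \<in> \<sigma> \<and> con \<Psi> m n} \<inter> (UNIV \<times> T))" for T :: "(real ^ 'n) set"
  have S: "compact (S T)" if "closed T" for T
    unfolding S_def using that
    by (intro compact_continuous_image continuous_on_fst continuous_on_id compact_Int_closed
        compact_con[OF cont] facet_compact assms closed_Times closed_UNIV)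
  have S_iff: "m \<in> S T \<longleftrightarrow> m \<in> \<sigma> \<and> (\<exists>n\<in>T. con \<Psi> m n)" for m T
    unfolding S_def by force
  have "kink \<Psi> \<sigma> i r s = S {n. b \<sigma> i \<bullet> n \<le> r} \<inter> S {n. b \<sigma> i \<bullet> n \<ge> s}"
    unfolding kink_def set_eq_iff Int_iff S_iff mem_Collect_eq by (simp add: Bex_def) meson
  then show ?thesis
    by (simp add: compact_Int S closed_halfspace_le closed_halfspace_ge)
qed

text \<open>Subgradients are monotone: along direction \<open>b \<sigma> i\<close> the pairings
  found at a later point are at least those found at an earlier one. A value of at least
  \<open>s\<close> can therefore not be followed by one of at most \<open>r\<close>.\<close>

lemma negligible_kink:
  assumes "adm \<Psi>" "\<sigma> facet_of \<Delta>" "r < s"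
  shows "negligible (chart \<sigma> -` kink \<Psi> \<sigma> i r s)"
proof (rule negligible_if_lines_meet_once[where v = "axis i 1"])
  show "compact (chart \<sigma> -` kink \<Psi> \<sigma> i r s)"
    by (intro compact_chart_vimage assms kink_compact)
  fix y t assume y: "y \<in> chart \<sigma> -` kink \<Psi> \<sigma> i r s" and t: "0 < (t::real)"
  show "y + t *\<^sub>R axis i 1 \<notin> chart \<sigma> -` kink \<Psi> \<sigma> i r s"
  proof
    assume "y + t *\<^sub>R axis i 1 \<in> chart \<sigma> -` kink \<Psi> \<sigma> i r s"
    moreover have "chart \<sigma> (y + t *\<^sub>R axis i 1) = chart \<sigma> y + t *\<^sub>R b \<sigma> i"
      by (simp add: chart_eq linear_add[OF linear_comb] linear_cmul[OF linear_comb] comb_axis)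
    ultimately obtain n where n: "con \<Psi> (chart \<sigma> y + t *\<^sub>R b \<sigma> i) n" "b \<sigma> i \<bullet> n \<le> r"
      unfolding kink_def by auto
    obtain n' where n': "con \<Psi> (chart \<sigma> y) n'" "s \<le> b \<sigma> i \<bullet> n'"
      using y unfolding kink_def by auto
    have "t * (b \<sigma> i \<bullet> (n' - n)) \<le> 0"
      using conD[OF n(1) con_B[OF n'(1)]] conD[OF n'(1) con_B[OF n(1)]]
      by (simp add: inner_add_left inner_diff_right algebra_simps)
    moreover have "b \<sigma> i \<bullet> (n' - n) > 0"
      using n(2) n'(2) assms(3) by (simp add: inner_diff_right)
    ultimately show False
      using t by (simp add: mult_le_0_iff)
  qed
qed

text \<open>In the chart of \<open>\<sigma>\<close> the second facet satisfies an affine equation.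
  If the equation were trivial, the two normals would be parallel and both pair to 1 with the base
  point, hence be equal.\<close>

lemma negligible_facet_Int:
  assumes "\<sigma> facet_of \<Delta>" "\<sigma>' facet_of \<Delta>" "\<sigma>' \<noteq> \<sigma>"
  shows "negligible (chart \<sigma> -` (\<sigma> \<inter> \<sigma>'))"
proof (rule negligible_subset)
  let ?p = "SOME p. p \<in> \<sigma>"
  let ?a = "beta b \<sigma> (ns \<sigma>')"
  have in': "y \<in> \<sigma>' \<longleftrightarrow> y \<in> \<Delta> \<and> ns \<sigma>' \<bullet> y = 1" for y
    using facet_Delta(2)[OF assms(2)] by blast
  have chart: "ns \<sigma>' \<bullet> chart \<sigma> y = ns \<sigma>' \<bullet> ?p + ?a \<bullet> y" for y
    using comb_inner[of \<sigma> y "ns \<sigma>'"] by (simp add: chart_eq inner_add_right inner_commute)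
  show "chart \<sigma> -` (\<sigma> \<inter> \<sigma>') \<subseteq> {y. ?a \<bullet> y = 1 - ns \<sigma>' \<bullet> ?p}"
    using chart in' by force
  have "?a \<noteq> 0 \<or> 1 - ns \<sigma>' \<bullet> ?p \<noteq> 0"
  proof (rule ccontr)
    assume "\<not> ?thesis"
    then have a0: "?a = 0" "ns \<sigma>' \<bullet> ?p = 1"
      by auto
    then have "beta b \<sigma> 0 = ?a"
      using linear_0[OF linear_beta] by metis
    then obtain t where t: "ns \<sigma>' = t *\<^sub>R ns \<sigma>"
      using beta_eq_iff[OF assms(1)] by (metis add_0)
    then have "t = 1"
      using a0(2) ns_inner_facet[OF assms(1) chart_base[OF assms(1)]] by simp
    then show False
      using t facet_Delta(2)[OF assms(1)] facet_Delta(2)[OF assms(2)] assms(3) by simp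
  qed
  then show "negligible {y. ?a \<bullet> y = 1 - ns \<sigma>' \<bullet> ?p}"
    by (rule negligible_hyperplane)
qed

lemma bad_fsigma:
  assumes "adm \<Psi>"
  shows "bad \<Psi> \<in> sets borel" "bad \<Psi> \<subseteq> A"
proof -
  have kink: "kink \<Psi> \<sigma> i r s \<in> sets borel" if "\<sigma> facet_of \<Delta>" for \<sigma> i r s
    using kink_compact[OF assms that] by (rule borel_compact)
  have "countable {(r, s). r \<in> \<rat> \<and> s \<in> \<rat> \<and> r < (s::real)}"
    by (rule countable_subset[OF _ countable_SIGMA[OF countable_rat countable_rat]]) auto
  then show "bad \<Psi> \<in> sets borel"
    unfolding bad_def using finite_facets
    by (intro sets.finite_UN sets.Un sets.countable_UN'' sets.Int)
      (auto intro: kink borel_compact facet_compact finite_subset[OF _ finite_facets])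
  show "bad \<Psi> \<subseteq> A"
    using bad_iff facet_subset_A by blast
qed

lemma negligible_bad:
  assumes "adm \<Psi>" "\<sigma> facet_of \<Delta>"
  shows "negligible (chart \<sigma> -` (bad \<Psi> \<inter> \<sigma>))"
proof (rule negligible_subset)
  let ?R = "{(r, s). r \<in> \<rat> \<and> s \<in> \<rat> \<and> r < (s::real)}"
  let ?N1 = "\<Union>\<sigma>'\<in>{\<sigma>'. \<sigma>' facet_of \<Delta> \<and> \<sigma>' \<noteq> \<sigma>}. chart \<sigma> -` (\<sigma> \<inter> \<sigma>')"
  let ?N2 = "\<Union>i. \<Union>(r, s)\<in>?R. chart \<sigma> -` kink \<Psi> \<sigma> i r s"
  show "chart \<sigma> -` (bad \<Psi> \<inter> \<sigma>) \<subseteq> ?N1 \<union> ?N2"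
  proof
    fix y assume y: "y \<in> chart \<sigma> -` (bad \<Psi> \<inter> \<sigma>)"
    show "y \<in> ?N1 \<union> ?N2"
    proof (cases "\<exists>\<sigma>'. \<sigma>' facet_of \<Delta> \<and> \<sigma>' \<noteq> \<sigma> \<and> chart \<sigma> y \<in> \<sigma>'")
      case True
      then show ?thesis
        using y by auto
    next
      case False
      have "chart \<sigma> y \<in> bad \<Psi>"
        using y by simp
      then obtain \<sigma>' where \<sigma>': "\<sigma>' facet_of \<Delta>" "chart \<sigma> y \<in> \<sigma>'"
        "(\<exists>\<sigma>''. \<sigma>'' facet_of \<Delta> \<and> \<sigma>'' \<noteq> \<sigma>' \<and> chart \<sigma> y \<in> \<sigma>'') \<or>
         (\<exists>i r s. r \<in> \<rat> \<and> s \<in> \<rat> \<and> r < s \<and> chart \<sigma> y \<in> kink \<Psi> \<sigma>' i r s)"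
        unfolding bad_iff by blast
      then have "\<sigma>' = \<sigma>"
        using False by blast
      then obtain i r s where "(r, s) \<in> ?R" "chart \<sigma> y \<in> kink \<Psi> \<sigma> i r s"
        using \<sigma>'(3) False by blast
      then have "y \<in> ?N2"
        by blast
      then show ?thesis
        by blast
    qed
  qed
  have cR: "countable ?R"
    by (rule countable_subset[OF _ countable_SIGMA[OF countable_rat countable_rat]]) auto
  have "negligible (chart \<sigma> -` kink \<Psi> \<sigma> i (fst z) (snd z))" if "z \<in> ?R" for i z
    using that by (intro negligible_kink assms) auto
  then have "negligible (\<Union>z\<in>?R. chart \<sigma> -` kink \<Psi> \<sigma> i (fst z) (snd z))" for i
    using cR by (intro negligible_countable_Union) auto
  then have "negligible (\<Union>i. \<Union>z\<in>?R. chart \<sigma> -` kink \<Psi> \<sigma> i (fst z) (snd z))"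
    by (intro negligible_Union) auto
  then have "negligible ?N2"
    by (simp add: case_prod_unfold)
  moreover have "negligible ?N1"
  proof (rule negligible_Union)
    have "finite {\<sigma>'. \<sigma>' facet_of \<Delta> \<and> \<sigma>' \<noteq> \<sigma>}"
      by (rule finite_subset[OF _ finite_facets]) blast
    then show "finite ((\<lambda>\<sigma>'. chart \<sigma> -` (\<sigma> \<inter> \<sigma>')) ` {\<sigma>'. \<sigma>' facet_of \<Delta> \<and> \<sigma>' \<noteq> \<sigma>})"
      by (rule finite_imageI)
    fix t assume "t \<in> (\<lambda>\<sigma>'. chart \<sigma> -` (\<sigma> \<inter> \<sigma>')) ` {\<sigma>'. \<sigma>' facet_of \<Delta> \<and> \<sigma>' \<noteq> \<sigma>}"
    then show "negligible t"
      using negligible_facet_Int[OF assms(2)] by blast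
  qed
  ultimately show "negligible (?N1 \<union> ?N2)"
    by (intro negligible_Un)
qed

text \<open>Both contact points lie in \<open>D \<sigma>\<close> for the only facet containing
  \<open>m\<close>. A difference in some \<open>beta\<close> coordinate would leave room for two
  rationals and put \<open>m\<close> into a kink set.\<close>

lemma rel_unique:
  assumes "adm \<Psi>" "m \<notin> bad \<Psi>" "rel \<Psi> m n" "rel \<Psi> m n'"
  shows "n = n'"
proof -
  obtain \<sigma> where \<sigma>: "\<sigma> facet_of \<Delta>" "m \<in> \<sigma>" "n \<in> D \<sigma>"
    using assms(3) support_set_iff unfolding rel_def by blast
  obtain \<sigma>' where \<sigma>': "\<sigma>' facet_of \<Delta>" "m \<in> \<sigma>'" "n' \<in> D \<sigma>'"
    using assms(4) support_set_iff unfolding rel_def by blast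
  have "\<sigma>' = \<sigma>"
    using assms(2) \<sigma>(1,2) \<sigma>'(1,2) unfolding bad_iff by metis
  have not_less: "\<not> b \<sigma> i \<bullet> n < b \<sigma> i \<bullet> n'" if n: "con \<Psi> m n" "con \<Psi> m n'" for i n n'
  proof
    assume "b \<sigma> i \<bullet> n < b \<sigma> i \<bullet> n'"
    then obtain s where s: "s \<in> \<rat>" "b \<sigma> i \<bullet> n < s" "s < b \<sigma> i \<bullet> n'"
      using Rats_dense_in_real by blast
    then obtain r where r: "r \<in> \<rat>" "b \<sigma> i \<bullet> n < r" "r < s"
      using Rats_dense_in_real by blast
    have "m \<in> kink \<Psi> \<sigma> i r s"
      unfolding kink_def using n \<sigma>(2) r s by (auto intro: less_imp_le)
    then have "m \<in> bad \<Psi>"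
      unfolding bad_iff using \<sigma>(1,2) r(1,3) s(1) by metis
    then show False
      using assms(2) by blast
  qed
  have "b \<sigma> i \<bullet> n = b \<sigma> i \<bullet> n'" for i
    using not_less[of n n' i] not_less[of n' n i] assms(3,4) unfolding rel_def by linarith
  then have "beta b \<sigma> n = beta b \<sigma> n'"
    by (simp add: beta_def)
  then show ?thesis
    using inj_on_beta_D[OF \<sigma>(1)] \<sigma>(3) \<sigma>'(3) unfolding \<open>\<sigma>' = \<sigma>\<close> inj_on_def by blast
qed

text \<open>The default on the exceptional set is a fixed point of \<open>B\<close>, which keeps the
  map total, Borel and with values in \<open>B\<close>.\<close>

definition T :: "(real ^ 'n \<Rightarrow> real) \<Rightarrow> real ^ 'n \<Rightarrow> real ^ 'n" where
  "T \<Psi> m = (if m \<in> A - bad \<Psi> then SOME n. rel \<Psi> m n else (SOME n. n \<in> B))"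

lemma rel_T: "adm \<Psi> \<Longrightarrow> m \<in> A - bad \<Psi> \<Longrightarrow> rel \<Psi> m (T \<Psi> m)"
  using rel_exists[of \<Psi> m] someI_ex[of "rel \<Psi> m"] by (auto simp: T_def)

lemma rel_iff_T: "adm \<Psi> \<Longrightarrow> m \<in> A - bad \<Psi> \<Longrightarrow> rel \<Psi> m n \<longleftrightarrow> n = T \<Psi> m"
  using rel_T rel_unique by blast

lemma T_in_B: "adm \<Psi> \<Longrightarrow> T \<Psi> m \<in> B"
proof (cases "m \<in> A - bad \<Psi>")
  case True
  assume "adm \<Psi>"
  then have "con \<Psi> m (T \<Psi> m)"
    using rel_T True unfolding rel_def by blast
  then show ?thesis
    by (rule con_B)
next
  case False
  then show ?thesis
    unfolding T_def if_not_P[OF False] using B_nonempty some_in_eq by metis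
qed

text \<open>A closed graph argument: the preimage of a closed set is cut out by the projection of a
  compact set of related pairs.\<close>

lemma continuous_on_T:
  assumes "adm \<Psi>"
  shows "continuous_on (A - bad \<Psi>) (T \<Psi>)"
proof (subst continuous_on_closed_invariant, intro allI impI)
  fix F :: "(real ^ 'n) set" assume "closed F"
  define G where "G = fst ` {(m, n). rel \<Psi> m n \<and> n \<in> F}"
  have "compact G"
    unfolding G_def
    by (intro compact_continuous_image continuous_on_fst continuous_on_id rel_compact assms \<open>closed F\<close>)
  moreover have "m \<in> G \<longleftrightarrow> T \<Psi> m \<in> F" if "m \<in> A - bad \<Psi>" for m
    unfolding G_def using rel_iff_T[OF assms that] by (auto simp: image_iff)
  ultimately show "\<exists>G. closed G \<and> G \<inter> (A - bad \<Psi>) = T \<Psi> -` F \<inter> (A - bad \<Psi>)"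
    using compact_imp_closed by blast
qed

lemma T_measurable:
  assumes "adm \<Psi>"
  shows "T \<Psi> \<in> borel_measurable borel"
proof -
  have bm: "bad \<Psi> \<in> sets borel" "A \<in> sets borel"
    using bad_fsigma[OF assms] borel_compact[OF A_compact] by auto
  have "T \<Psi> \<in> borel_measurable (restrict_space borel (A - bad \<Psi>))"
    using continuous_on_T[OF assms] by (rule borel_measurable_continuous_on_restrict)
  moreover have "T \<Psi> \<in> borel_measurable (restrict_space borel (- (A - bad \<Psi>)))"
    by (subst measurable_cong[where g = "\<lambda>_. SOME n. n \<in> B"]) (auto simp: T_def space_restrict_space)
  ultimately show ?thesis
    using bm by (subst measurable_piecewise_restrict_iff[where C = "{A - bad \<Psi>, - (A - bad \<Psi>)}"]) auto
qed

section \<open>The measure on the boundary\<close>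

abbreviation mu where "mu \<equiv> mu_M \<Delta> b"

lemma sets_restrict_borel_iff:
  assumes "S \<in> sets borel"
  shows "E \<in> sets (restrict_space borel S) \<longleftrightarrow> E \<in> sets borel \<and> E \<subseteq> S"
  using assms by (subst sets_restrict_space_iff) auto

lemma A_borel: "A \<in> sets borel" and B_borel: "B \<in> sets borel"
  using borel_compact A_compact B_compact by auto

lemma chart_measurable: "chart \<sigma> \<in> borel_measurable borel"
  using continuous_chart by (rule borel_measurable_continuous_onI)

lemma chart_vimage_borel: "E \<in> sets borel \<Longrightarrow> chart \<sigma> -` E \<in> sets borel"
  using measurable_sets[OF chart_measurable, of E \<sigma>] by simp

lemma facet_borel: "\<sigma> facet_of \<Delta> \<Longrightarrow> \<sigma> \<in> sets borel"
  using borel_compact facet_compact by blast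

lemma space_mu: "space mu = A" and sets_mu: "sets mu = sets (restrict_space borel A)"
proof -
  have "sets (restrict_space borel A) \<subseteq> Pow A"
    using sets_restrict_borel_iff[OF A_borel] by auto
  then show "space mu = A" "sets mu = sets (restrict_space borel A)"
    unfolding mu_M_def
    using sets.sigma_sets_eq[of "restrict_space borel A"]
    by (simp_all add: space_measure_of sets_measure_of space_restrict_space)
qed

lemma sets_mu_iff: "E \<in> sets mu \<longleftrightarrow> E \<in> sets borel \<and> E \<subseteq> A"
  unfolding sets_mu by (rule sets_restrict_borel_iff[OF A_borel])

lemma emeasure_mu:
  assumes "E \<in> sets borel" "E \<subseteq> A"
  shows "emeasure mu E = (\<Sum>\<sigma> | \<sigma> facet_of \<Delta>. emeasure lborel (chart \<sigma> -` (E \<inter> \<sigma>)))"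
  unfolding mu_M_def
proof (rule emeasure_measure_of_sigma)
  let ?M = "sets (restrict_space borel A)"
  let ?f = "\<lambda>E. \<Sum>\<sigma> | \<sigma> facet_of \<Delta>. emeasure lborel (chart \<sigma> -` (E \<inter> \<sigma>))"
  show "sigma_algebra A ?M"
    using sets.sigma_algebra_axioms[of "restrict_space borel A"] by (simp add: space_restrict_space)
  show "positive ?M ?f"
    by (simp add: positive_def)
  show "E \<in> ?M"
    using assms sets_restrict_borel_iff[OF A_borel] by blast
  show "countably_additive ?M ?f"
  proof (rule countably_additiveI)
    fix F :: "nat \<Rightarrow> (real ^ 'n) set" assume F: "range F \<subseteq> ?M" "disjoint_family F"
    have Fb: "F i \<in> sets borel" for i
      using F(1) sets_restrict_borel_iff[OF A_borel] by blast
    have "(\<Sum>i. emeasure lborel (chart \<sigma> -` (F i \<inter> \<sigma>))) = emeasure lborel (chart \<sigma> -` ((\<Union>i. F i) \<inter> \<sigma>))"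
      if "\<sigma> facet_of \<Delta>" for \<sigma>
    proof -
      have "range (\<lambda>i. chart \<sigma> -` (F i \<inter> \<sigma>)) \<subseteq> sets lborel"
        using Fb facet_borel[OF that] chart_vimage_borel by auto
      moreover have "disjoint_family (\<lambda>i. chart \<sigma> -` (F i \<inter> \<sigma>))"
        using F(2) unfolding disjoint_family_on_def by blast
      moreover have "(\<Union>i. chart \<sigma> -` (F i \<inter> \<sigma>)) = chart \<sigma> -` ((\<Union>i. F i) \<inter> \<sigma>)"
        by blast
      ultimately show ?thesis
        using suminf_emeasure[of "\<lambda>i. chart \<sigma> -` (F i \<inter> \<sigma>)" lborel] by simp
    qed
    then show "(\<Sum>i. ?f (F i)) = ?f (\<Union>i. F i)"
      by (subst suminf_sum) (auto intro!: sum.cong)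
  qed
qed

lemma chart_part_borel:
  assumes "\<sigma> facet_of \<Delta>" "E \<in> sets borel"
  shows "chart \<sigma> -` (E \<inter> \<sigma>) \<in> sets borel"
  using chart_vimage_borel[OF sets.Int[OF assms(2) facet_borel[OF assms(1)]]] .

lemma chart_part_lmeasurable:
  assumes "\<sigma> facet_of \<Delta>" "E \<in> sets borel"
  shows "chart \<sigma> -` (E \<inter> \<sigma>) \<in> lmeasurable"
proof (rule bounded_set_imp_lmeasurable)
  show "bounded (chart \<sigma> -` (E \<inter> \<sigma>))"
    by (rule bounded_subset[OF compact_imp_bounded[OF compact_chart_vimage[OF assms(1) facet_compact[OF assms(1)]]]]) auto
  show "chart \<sigma> -` (E \<inter> \<sigma>) \<in> sets lebesgue"
    using chart_part_borel[OF assms] by (intro sets_completionI_sets) simp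
qed

lemma emeasure_chart_part:
  assumes "\<sigma> facet_of \<Delta>" "E \<in> sets borel"
  shows "emeasure lebesgue (chart \<sigma> -` (E \<inter> \<sigma>)) = emeasure lborel (chart \<sigma> -` (E \<inter> \<sigma>))"
  using chart_part_borel[OF assms] by simp

lemma emeasure_mu_bad:
  assumes "adm \<Psi>"
  shows "emeasure mu (bad \<Psi>) = 0"
proof -
  have "emeasure lborel (chart \<sigma> -` (bad \<Psi> \<inter> \<sigma>)) = 0" if "\<sigma> facet_of \<Delta>" for \<sigma>
    using negligible_bad[OF assms that] emeasure_chart_part[OF that bad_fsigma(1)[OF assms]]
    by (simp add: negligible_iff_null_sets null_sets_def)
  then show ?thesis
    using bad_fsigma[OF assms] by (simp add: emeasure_mu)
qed

lemma emeasure_mu_finite: "emeasure mu A < \<infinity>"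
proof -
  have "emeasure lborel (chart \<sigma> -` (A \<inter> \<sigma>)) < top" if "\<sigma> facet_of \<Delta>" for \<sigma>
  proof -
    have "emeasure lebesgue (chart \<sigma> -` (A \<inter> \<sigma>)) < top"
      using chart_part_lmeasurable[OF that A_borel]
      unfolding fmeasurable_def mem_Collect_eq infinity_ennreal_def by (rule conjunct2)
    then show ?thesis
      unfolding emeasure_chart_part[OF that A_borel] .
  qed
  then have "\<forall>\<sigma>\<in>{\<sigma>. \<sigma> facet_of \<Delta>}. emeasure lborel (chart \<sigma> -` (A \<inter> \<sigma>)) < top"
    by blast
  then show ?thesis
    unfolding emeasure_mu[OF A_borel order_refl] infinity_ennreal_def
      ennreal_sum_less_top[OF finite_facets] .
qed

lemma facet_unique_if_not_bad:
  "m \<notin> bad \<Psi> \<Longrightarrow> \<sigma> facet_of \<Delta> \<Longrightarrow> \<sigma>' facet_of \<Delta> \<Longrightarrow> m \<in> \<sigma> \<Longrightarrow> m \<in> \<sigma>' \<Longrightarrow> \<sigma> = \<sigma>'"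
  unfolding bad_iff by metis

text \<open>The bookkeeping shared by \<open>MA_facet\<close> and \<open>MA_U_set\<close>. The set
  \<open>S\<close> lies between a disjoint union of unimodular images of \<open>W\<close> and the
  same union enlarged by images of \<open>bad \<Psi>\<close>. The latter are null, so completeness
  makes \<open>S\<close> measurable. Facets outside \<open>F\<close> miss \<open>W\<close>, since
  its points lie on a single facet.\<close>

lemma emeasure_lebesgue_images:
  assumes adm: "adm \<Psi>" and W: "W \<in> sets borel" "W \<subseteq> A - bad \<Psi>"
    and F: "F \<subseteq> {\<sigma>. \<sigma> facet_of \<Delta>}" "W \<subseteq> \<Union>F"
    and L: "\<And>\<sigma>. \<sigma> \<in> F \<Longrightarrow> linear (L \<sigma>)" "\<And>\<sigma>. \<sigma> \<in> F \<Longrightarrow> \<bar>det (matrix (L \<sigma>))\<bar> = 1"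
    and disj: "\<And>\<sigma> \<sigma>'. \<sigma> \<in> F \<Longrightarrow> \<sigma>' \<in> F \<Longrightarrow> \<sigma> \<noteq> \<sigma>' \<Longrightarrow>
      (\<lambda>y. c \<sigma> + L \<sigma> y) ` chart \<sigma> -` (W \<inter> \<sigma>) \<inter> (\<lambda>y. c \<sigma>' + L \<sigma>' y) ` chart \<sigma>' -` (W \<inter> \<sigma>') = {}"
    and S: "(\<Union>\<sigma>\<in>F. (\<lambda>y. c \<sigma> + L \<sigma> y) ` chart \<sigma> -` (W \<inter> \<sigma>)) \<subseteq> S"
      "S \<subseteq> (\<Union>\<sigma>\<in>F. (\<lambda>y. c \<sigma> + L \<sigma> y) ` chart \<sigma> -` ((W \<union> bad \<Psi>) \<inter> \<sigma>))"
  shows "emeasure lebesgue S = emeasure mu W"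
proof -
  define I where "I \<sigma> E = (\<lambda>y. c \<sigma> + L \<sigma> y) ` chart \<sigma> -` (E \<inter> \<sigma>)" for \<sigma> E
  have finF: "finite F"
    using finite_subset[OF F(1) finite_facets] .
  have img: "I \<sigma> E \<in> lmeasurable" "emeasure lebesgue (I \<sigma> E) = emeasure lebesgue (chart \<sigma> -` (E \<inter> \<sigma>))"
    if "\<sigma> \<in> F" "E \<in> sets borel" for \<sigma> E
  proof -
    have "chart \<sigma> -` (E \<inter> \<sigma>) \<in> lmeasurable"
      using chart_part_lmeasurable F(1) that by blast
    then show "I \<sigma> E \<in> lmeasurable"
        "emeasure lebesgue (I \<sigma> E) = emeasure lebesgue (chart \<sigma> -` (E \<inter> \<sigma>))"
      unfolding I_def using emeasure_unimodular_affine_image[OF L[OF that(1)]] by blast+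
  qed
  define U where "U = (\<Union>\<sigma>\<in>F. I \<sigma> W)"
  define N where "N = (\<Union>\<sigma>\<in>F. I \<sigma> (bad \<Psi>))"
  have bm: "bad \<Psi> \<in> sets borel"
    using bad_fsigma(1)[OF adm] .
  have U: "U \<in> sets lebesgue"
    unfolding U_def using img(1)[OF _ W(1)] finF by (intro sets.finite_UN) (auto simp: fmeasurable_def)
  have "I \<sigma> (bad \<Psi>) \<in> null_sets lebesgue" if "\<sigma> \<in> F" for \<sigma>
    using img[OF that bm] negligible_bad[OF adm, of \<sigma>] F(1) that
    by (auto simp: null_sets_def fmeasurable_def negligible_iff_null_sets)
  then have N: "N \<in> null_sets lebesgue"
    unfolding N_def using finF by (intro null_sets.finite_UN)
  have "I \<sigma> (W \<union> bad \<Psi>) = I \<sigma> W \<union> I \<sigma> (bad \<Psi>)" for \<sigma>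
    unfolding I_def Int_Un_distrib2 vimage_Un image_Un ..
  then have "S \<subseteq> U \<union> N"
    using S(2) unfolding U_def N_def I_def[symmetric] by auto
  moreover have "U \<subseteq> S"
    using S(1) unfolding U_def I_def .
  ultimately have "S - U \<subseteq> N"
    by blast
  then have "S - U \<in> null_sets lebesgue" "S = U \<union> (S - U)"
    using N null_sets_completion_subset \<open>U \<subseteq> S\<close> by auto
  then have "emeasure lebesgue S = emeasure lebesgue U"
    using emeasure_Un_null_set[OF U] by metis
  also have "\<dots> = (\<Sum>\<sigma>\<in>F. emeasure lebesgue (I \<sigma> W))"
    unfolding U_def
  proof (rule sum_emeasure[symmetric])
    show "(\<lambda>\<sigma>. I \<sigma> W) ` F \<subseteq> sets lebesgue"
      using img(1)[OF _ W(1)] by (auto simp: fmeasurable_def)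
    show "disjoint_family_on (\<lambda>\<sigma>. I \<sigma> W) F"
      unfolding disjoint_family_on_def I_def using disj by blast
  qed (rule finF)
  also have "\<dots> = (\<Sum>\<sigma>\<in>F. emeasure lborel (chart \<sigma> -` (W \<inter> \<sigma>)))"
    using F(1) img(2)[OF _ W(1)] emeasure_chart_part[OF _ W(1)] by (intro sum.cong) auto
  also have "\<dots> = (\<Sum>\<sigma> | \<sigma> facet_of \<Delta>. emeasure lborel (chart \<sigma> -` (W \<inter> \<sigma>)))"
  proof (rule sum.mono_neutral_left[OF finite_facets F(1)], rule ballI)
    fix \<sigma> assume \<sigma>: "\<sigma> \<in> {\<sigma>. \<sigma> facet_of \<Delta>} - F"
    have "W \<inter> \<sigma> = {}"
    proof (rule ccontr)
      assume "W \<inter> \<sigma> \<noteq> {}"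
      then obtain m where m: "m \<in> W" "m \<in> \<sigma>"
        by blast
      then obtain \<sigma>' where "\<sigma>' \<in> F" "m \<in> \<sigma>'"
        using F(2) by blast
      then have "\<sigma>' = \<sigma>"
        using facet_unique_if_not_bad[of m \<Psi> \<sigma>' \<sigma>] m W(2) F(1) \<sigma> by blast
      then show False
        using \<sigma> \<open>\<sigma>' \<in> F\<close> by blast
    qed
    then show "emeasure lborel (chart \<sigma> -` (W \<inter> \<sigma>)) = 0"
      by simp
  qed
  also have "\<dots> = emeasure mu W"
    using W by (subst emeasure_mu) auto
  finally show ?thesis .
qed

section \<open>Subgradients and contact pairs\<close>

definition pull :: "(real ^ 'n \<Rightarrow> real) \<Rightarrow> (real ^ 'n) set \<Rightarrow> (real ^ 'n) set" where
  "pull \<Psi> E = {m \<in> A - bad \<Psi>. T \<Psi> m \<in> E}"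

lemma pull_borel:
  assumes "adm \<Psi>" "E \<in> sets borel"
  shows "pull \<Psi> E \<in> sets borel" "pull \<Psi> E \<subseteq> A - bad \<Psi>"
proof -
  have "pull \<Psi> E = (A - bad \<Psi>) \<inter> (T \<Psi> -` E \<inter> space borel)"
    by (auto simp: pull_def)
  then show "pull \<Psi> E \<in> sets borel"
    using measurable_sets[OF T_measurable[OF assms(1)] assms(2)] bad_fsigma[OF assms(1)] A_borel by auto
qed (auto simp: pull_def)

text \<open>Removes the chart from the definition: \<open>comb \<sigma>\<close> is adjoint to
  \<open>beta b \<sigma>\<close>, so the inequality can be read on \<open>S\<close> itself.\<close>

lemma subgradient_image_iff:
  assumes "\<sigma> facet_of \<Delta>" "S \<subseteq> D \<sigma>" "E \<subseteq> D \<sigma>"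
  shows "p \<in> subgradient_image (beta b \<sigma> ` S) (f \<circ> beta_inv \<Delta> h b \<sigma>) (beta b \<sigma> ` E) \<longleftrightarrow>
    (\<exists>n\<in>E. \<forall>n'\<in>S. f n + comb \<sigma> p \<bullet> (n' - n) \<le> f n')"
proof -
  have inv: "beta_inv \<Delta> h b \<sigma> (beta b \<sigma> n) = n" if "n \<in> S \<union> E" for n
    using beta_inv_beta[OF assms(1)] assms(2,3) that by blast
  have "p \<in> subgradient_image (beta b \<sigma> ` S) (f \<circ> beta_inv \<Delta> h b \<sigma>) (beta b \<sigma> ` E) \<longleftrightarrow>
    (\<exists>n\<in>E. \<forall>n'\<in>S. f (beta_inv \<Delta> h b \<sigma> (beta b \<sigma> n'))
       \<ge> f (beta_inv \<Delta> h b \<sigma> (beta b \<sigma> n)) + p \<bullet> (beta b \<sigma> n' - beta b \<sigma> n))"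
    by (simp add: subgradient_image_def)
  also have "\<dots> \<longleftrightarrow> (\<exists>n\<in>E. \<forall>n'\<in>S. f n + comb \<sigma> p \<bullet> (n' - n) \<le> f n')"
    using inv by (simp add: comb_inner linear_diff[OF linear_beta])
  finally show ?thesis .
qed

text \<open>The substitute for Danskin's formula: directional derivatives of \<open>\<Psi>\<close> at \<open>n\<close> along \<open>B\<close> are
  attained by contact points of \<open>n\<close>.\<close>

lemma limit_contact:
  assumes "adm \<Psi>" "\<And>j. s j \<in> B" "s \<longlonglongrightarrow> n"
    and "\<And>j. \<Psi> n + x \<bullet> (s j - n) \<le> \<Psi> (s j)" "n \<in> B"
  obtains m r where "strict_mono r" "\<And>j. m j \<in> A" "\<And>j. con \<Psi> (m j) (s (r j))"
    "\<And>j. x \<bullet> (s (r j) - n) \<le> m j \<bullet> (s (r j) - n)" "convergent m" "lim m \<in> A" "con \<Psi> (lim m) n"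
proof -
  have "\<forall>j. \<exists>m\<in>A. con \<Psi> m (s j)"
    using assms(1,2) by (simp add: adm_def)
  then obtain m where m: "\<And>j. m j \<in> A" "\<And>j. con \<Psi> (m j) (s j)"
    by metis
  obtain l r where lr: "l \<in> A" "strict_mono r" "(m \<circ> r) \<longlonglongrightarrow> l"
    using A_compact m(1) unfolding compact_def by metis
  \<comment> \<open>Compares contact at \<open>s j\<close>, tested at \<open>n\<close>, with the
    subgradient inequality at \<open>n\<close>, tested at \<open>s j\<close>.\<close>
  have le: "x \<bullet> (s j - n) \<le> m j \<bullet> (s j - n)" for j
    using conD[OF m(2) assms(5)] assms(4) by (smt (verit) inner_diff_right)
  have "lim (m \<circ> r) = l"
    using lr(3) by (rule limI)
  moreover have "con \<Psi> l n"
  proof (rule con_limit)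
    show "continuous_on B \<Psi>"
      using assms(1) by (simp add: adm_def)
    show "con \<Psi> ((m \<circ> r) j) ((s \<circ> r) j)" for j
      using m(2) by simp
    show "(s \<circ> r) \<longlonglongrightarrow> n"
      using LIMSEQ_subseq_LIMSEQ[OF assms(3) lr(2)] .
  qed (rule lr(3))
  ultimately show ?thesis
    using that[of r "m \<circ> r"] m le lr by (simp add: convergentI)
qed

lemma compact_contact_set:
  assumes "adm \<Psi>"
  shows "compact {m \<in> A. con \<Psi> m n}"
proof -
  have eq: "{m \<in> A. con \<Psi> m n} = fst ` ({(m, n). m \<in> A \<and> con \<Psi> m n} \<inter> (UNIV \<times> {n}))"
    by force
  have cont: "continuous_on B \<Psi>"
    using assms by (simp add: adm_def)
  show ?thesis
    unfolding eq
    by (intro compact_continuous_image continuous_on_fst continuous_on_id compact_Int_closed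
        compact_con[OF cont A_compact] closed_Times closed_UNIV closed_singleton)
qed

text \<open>Contact is a convex condition on the first argument. Convex combinations may leave
  \<open>A\<close>, but stay in \<open>\<Delta>\<close>.\<close>

lemma contact_hull:
  assumes "x \<in> convex hull {m \<in> A. con \<Psi> m n}"
  shows "con \<Psi> x n" "x \<in> \<Delta>"
proof -
  have "convex hull {m \<in> A. con \<Psi> m n} \<subseteq> {m. con \<Psi> m n}"
    by (rule hull_minimal) (auto simp: convex_con)
  then show "con \<Psi> x n"
    using assms by blast
  have "convex hull {m \<in> A. con \<Psi> m n} \<subseteq> \<Delta>"
    by (rule hull_minimal) (use A_subset Delta_convex in auto)
  then show "x \<in> \<Delta>"
    using assms by blast
qed

subsection \<open>Facets of the dual polytope\<close>

lemma affine_hull_facet_P: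
  assumes "\<tau> facet_of P"
  shows "affine hull \<tau> = {x. primitive_normal P \<tau> \<bullet> x = of_int (h (primitive_normal P \<tau>))}"
proof (rule affine_dim_equal)
  let ?m = "primitive_normal P \<tau>"
  have "\<tau> \<subseteq> {x. ?m \<bullet> x = of_int (h ?m)}"
    using facet_P(2)[OF assms] unfolding tau_of_def by blast
  then show "affine hull \<tau> \<subseteq> {x. ?m \<bullet> x = of_int (h ?m)}"
    by (simp add: affine_hyperplane hull_minimal)
  have "?m \<noteq> 0"
    using facet_P(1)[OF assms] zero_not_AM by metis
  then have "aff_dim {x. ?m \<bullet> x = of_int (h ?m)} = DIM(real ^ 'n) - 1"
    by simp
  moreover have "aff_dim P = DIM(real ^ 'n)"
    by (rule aff_dim_nonempty_interior) (use zero_interior_P in blast)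
  then have "aff_dim \<tau> = DIM(real ^ 'n) - 1"
    using assms DIM_positive[where 'a = "real ^ 'n"] by (simp add: facet_of_def of_nat_diff)
  ultimately show "aff_dim (affine hull \<tau>) = aff_dim {x. ?m \<bullet> x = of_int (h ?m)}"
    by simp
  show "affine hull \<tau> \<noteq> {}"
    using assms by (auto simp: facet_of_def)
qed (simp_all add: affine_hyperplane)

text \<open>On \<open>\<tau>\<close> a subgradient is visible only modulo \<open>m0\<close>. Contact
  points dominate it in all directions along \<open>\<tau>\<close>, so separation places it in the
  hull of the contact points plus the line through \<open>m0\<close>; pushing along
  \<open>m0\<close> then reaches the star.\<close>

lemma subgradient_facet_P:
  assumes "adm \<Psi>" "\<tau> facet_of P" "n \<in> rel_interior \<tau>"
    and sub: "\<And>n'. n' \<in> rel_interior \<tau> \<Longrightarrow> \<Psi> n + x \<bullet> (n' - n) \<le> \<Psi> n'"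
  defines "m0 \<equiv> primitive_normal P \<tau>"
  obtains y s where "y \<in> star_of \<Delta> m0" "con \<Psi> y n" "y = x + s *\<^sub>R m0"
proof -
  have m0: "m0 \<in> AM" "\<tau> = tau_of \<Delta> h m0"
    using facet_P[OF assms(2)] by (simp_all add: m0_def)
  have \<tau>B: "rel_interior \<tau> \<subseteq> B"
    using rel_interior_subset[of \<tau>] tau_of_subset_B[OF m0(1)] m0(2) by auto
  have n: "n \<in> B" "n \<in> tau_of \<Delta> h m0"
    using assms(3) \<tau>B rel_interior_subset m0(2) by auto
  have dir: "\<exists>l. l \<in> A \<and> con \<Psi> l n \<and> x \<bullet> v \<le> l \<bullet> v" if v: "m0 \<bullet> v = 0" for v
  proof -
    have "openin (top_of_set (affine hull \<tau>)) (rel_interior \<tau>)"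
      by (rule openin_rel_interior)
    then obtain e where e: "e > 0" "ball n e \<inter> affine hull \<tau> \<subseteq> rel_interior \<tau>"
      using assms(3) unfolding openin_contains_ball by blast
    \<comment> \<open>The \<open>+ 1\<close> covers \<open>v = 0\<close> and keeps all
      \<open>s j\<close> strictly within distance \<open>e\<close> of \<open>n\<close>.\<close>
    define d where "d = e / (norm v + 1)"
    define s where "s j = n + (d / (real j + 1)) *\<^sub>R v" for j :: nat
    have d: "d > 0"
      using e by (simp add: d_def add_nonneg_pos)
    have s_in: "s j \<in> rel_interior \<tau>" for j
    proof -
      have "norm ((d / (real j + 1)) *\<^sub>R v) \<le> d * norm v"
        using d by (simp add: field_simps mult_left_mono)
      also have "\<dots> < e"
        using e(1) by (simp add: d_def divide_less_eq add_nonneg_pos)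
      finally have "s j \<in> ball n e"
        by (simp add: s_def dist_norm)
      moreover have "m0 \<bullet> n = of_int (h m0)"
        using n(2) by (simp add: tau_of_def)
      then have "s j \<in> affine hull \<tau>"
        unfolding affine_hull_facet_P[OF assms(2)] using v by (simp add: s_def inner_add_right flip: m0_def)
      ultimately show ?thesis
        using e(2) by blast
    qed
    have "(\<lambda>j. d / (real j + 1)) \<longlonglongrightarrow> 0"
      using tendsto_mult_right_zero[OF LIMSEQ_inverse_real_of_nat, of d]
      by (simp add: divide_inverse add.commute)
    then have "(\<lambda>j. n + (d / (real j + 1)) *\<^sub>R v) \<longlonglongrightarrow> n + 0 *\<^sub>R v"
      by (intro tendsto_intros)
    then have lim: "s \<longlonglongrightarrow> n"
      by (simp add: s_def[abs_def])
    obtain m r where m: "strict_mono r" "\<And>j. m j \<in> A" "\<And>j. con \<Psi> (m j) (s (r j))"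
      "\<And>j. x \<bullet> (s (r j) - n) \<le> m j \<bullet> (s (r j) - n)" "convergent m" "lim m \<in> A" "con \<Psi> (lim m) n"
      by (rule limit_contact[OF assms(1) _ lim _ n(1), where x = x])
        (use s_in \<tau>B sub in auto)
    have "x \<bullet> v \<le> m j \<bullet> v" for j
    proof -
      have "(d / (real (r j) + 1)) * (x \<bullet> v) \<le> (d / (real (r j) + 1)) * (m j \<bullet> v)"
        using m(4)[of j] by (simp add: s_def)
      moreover have "d / (real (r j) + 1) > 0"
        using d by simp
      ultimately show ?thesis
        by (simp only: mult_le_cancel_left_pos)
    qed
    moreover have "(\<lambda>j. m j \<bullet> v) \<longlonglongrightarrow> lim m \<bullet> v"
      using m(5) by (intro tendsto_intros) (simp add: convergent_LIMSEQ_iff)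
    ultimately have "x \<bullet> v \<le> lim m \<bullet> v"
      by (intro LIMSEQ_le_const) auto
    then show ?thesis
      using m by blast
  qed
  define K where "K = convex hull {m \<in> A. con \<Psi> m n}"
  define C where "C = (\<Union>y\<in>K. \<Union>z\<in>span {m0}. {y + z})"
  have "x \<in> C"
  proof (rule ccontr)
    assume "x \<notin> C"
    have "closed C"
      unfolding C_def K_def
      by (intro compact_closed_sums compact_convex_hull compact_contact_set assms(1) closed_span)
    moreover have "convex C"
      unfolding C_def K_def by (intro convex_sums convex_convex_hull) (simp add: subspace_imp_convex)
    ultimately obtain a c where ac: "a \<bullet> x < c" "\<And>y. y \<in> C \<Longrightarrow> a \<bullet> y > c"
      using separating_hyperplane_closed_point \<open>x \<notin> C\<close> by metis
    have C: "y + t *\<^sub>R m0 \<in> C" if "y \<in> A" "con \<Psi> y n" for y t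
    proof -
      have "y \<in> K"
        unfolding K_def using that by (intro hull_inc) simp
      moreover have "t *\<^sub>R m0 \<in> span {m0}"
        by (intro span_scale span_base) simp
      ultimately show ?thesis
        unfolding C_def by blast
    qed
    obtain y where y: "y \<in> A" "con \<Psi> y n"
      using assms(1) n(1) unfolding adm_def by blast
    \<comment> \<open>\<open>C\<close> contains lines in direction \<open>m0\<close>, on which a
      half-space functional must be constant. Hence \<open>a\<close> is a direction along
      \<open>\<tau>\<close>, to which \<open>dir\<close> applies.\<close>
    have "a \<bullet> m0 = 0"
    proof (rule ccontr)
      assume neq: "a \<bullet> m0 \<noteq> 0"
      have "a \<bullet> (y + ((c - a \<bullet> y) / (a \<bullet> m0)) *\<^sub>R m0) > c"
        using ac(2) C y by blast
      then show False
        using neq by (simp add: inner_add_right)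
    qed
    then obtain l where l: "l \<in> A" "con \<Psi> l n" "x \<bullet> (- a) \<le> l \<bullet> (- a)"
      using dir[of "- a"] by (auto simp: inner_commute)
    have "a \<bullet> l > c"
      using ac(2)[OF C[OF l(1,2), of 0]] by simp
    then show False
      using l(3) ac(1) by (simp add: inner_commute)
  qed
  then obtain y t where y: "y \<in> K" "x = y + t *\<^sub>R m0"
    unfolding C_def by (auto simp: span_singleton)
  then obtain u where u: "u \<ge> 0" "y + u *\<^sub>R m0 \<in> star_of \<Delta> m0"
    using push_to_star[of y m0] contact_hull m0(1) unfolding K_def by metis
  have "con \<Psi> (y + u *\<^sub>R m0) n"
    using con_push[OF _ m0(1) n(2) u(1)] contact_hull(1) y(1) unfolding K_def by blast
  moreover have "y + u *\<^sub>R m0 = x + (u - t) *\<^sub>R m0"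
    using y(2) by (simp add: algebra_simps)
  ultimately show ?thesis
    using that u(2) by blast
qed

text \<open>Projection along \<open>m0\<close> identifies every facet containing \<open>m0\<close> with a subset of the same
  \<open>d\<close>-dimensional space, in a way compatible with the lattices.\<close>

lemma projection_along:
  assumes \<sigma>: "\<sigma> facet_of \<Delta>" "m0 \<in> \<sigma>"
  obtains Q where "linear Q" "\<And>x. comb \<sigma> (Q x) = x - (ns \<sigma> \<bullet> x) *\<^sub>R m0" "\<And>p. Q (comb \<sigma> p) = p"
    "Q m0 = 0" "\<And>x y. Q x = Q y \<Longrightarrow> \<exists>s. x = y + s *\<^sub>R m0"
proof -
  obtain g where g: "linear g" "g \<circ> comb \<sigma> = id"
    using linear_injective_left_inverse[OF linear_comb inj_comb[OF \<sigma>(1)]] by blast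
  have g': "g (comb \<sigma> p) = p" for p
    using g(2) by (simp add: fun_eq_iff)
  define R where "R x = x - (ns \<sigma> \<bullet> x) *\<^sub>R m0" for x
  have linR: "linear R"
    unfolding R_def by (rule linearI) (auto simp: inner_add_right algebra_simps)
  have ns0: "ns \<sigma> \<bullet> m0 = 1"
    using ns_inner_facet[OF \<sigma>] .
  have comb_R: "comb \<sigma> (g (R x)) = R x" for x
  proof -
    have "R x \<bullet> ns \<sigma> = 0"
      using ns0 unfolding R_def by (subst inner_commute) (simp add: inner_diff_right)
    then have "R x \<in> range (comb \<sigma>)"
      unfolding comb_range[OF \<sigma>(1)] by simp
    then show ?thesis
      using g' by auto
  qed
  have ns_comb: "ns \<sigma> \<bullet> comb \<sigma> p = 0" for p
  proof -
    have "comb \<sigma> p \<in> {x. x \<bullet> ns \<sigma> = 0}"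
      unfolding comb_range[OF \<sigma>(1), symmetric] by (rule rangeI)
    then show ?thesis
      by (simp add: inner_commute)
  qed
  show ?thesis
  proof (rule that[of "g \<circ> R"])
    show "linear (g \<circ> R)"
      using linR g(1) by (rule linear_compose)
    show "comb \<sigma> ((g \<circ> R) x) = x - (ns \<sigma> \<bullet> x) *\<^sub>R m0" for x
      using comb_R[of x] by (simp add: R_def)
    show "(g \<circ> R) (comb \<sigma> p) = p" for p
      using g' ns_comb by (simp add: R_def)
    show "(g \<circ> R) m0 = 0"
      using ns0 linear_0[OF g(1)] by (simp add: R_def)
    fix x y assume "(g \<circ> R) x = (g \<circ> R) y"
    then have "R x = R y"
      using comb_R by (metis comp_apply)
    then have "x = y + (ns \<sigma> \<bullet> x - ns \<sigma> \<bullet> y) *\<^sub>R m0"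
      by (simp add: R_def algebra_simps)
    then show "\<exists>s. x = y + s *\<^sub>R m0" ..
  qed
qed

text \<open>Modulo \<open>m0\<close> both facet lattices become the quotient of the full lattice by
  \<open>\<int> m0\<close>. The two changes of basis are integral and inverse to each other.\<close>

lemma projection_unimodular:
  assumes \<sigma>: "\<sigma> facet_of \<Delta>" "m0 \<in> \<sigma>" and \<sigma>': "\<sigma>' facet_of \<Delta>" "m0 \<in> \<sigma>'" and m0: "m0 \<in> int_lattice"
    and Q: "linear Q" "\<And>x. comb \<sigma> (Q x) = x - (ns \<sigma> \<bullet> x) *\<^sub>R m0"
  shows "\<bar>det (matrix (\<lambda>y. Q (comb \<sigma>' y)))\<bar> = 1"
proof -
  obtain Q' where Q': "linear Q'" "\<And>x. comb \<sigma>' (Q' x) = x - (ns \<sigma>' \<bullet> x) *\<^sub>R m0" "\<And>p. Q' (comb \<sigma>' p) = p"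
    "Q' m0 = 0"
    using projection_along[OF \<sigma>'] by metis
  have int: "Q'' (b \<sigma>2 j) $ i \<in> \<int>"
    if "\<sigma>1 facet_of \<Delta>" "\<sigma>2 facet_of \<Delta>" "m0 \<in> \<sigma>1" "\<And>x. comb \<sigma>1 (Q'' x) = x - (ns \<sigma>1 \<bullet> x) *\<^sub>R m0"
    for \<sigma>1 \<sigma>2 Q'' j i
  proof -
    note \<sigma>1 = that(1)
    have "ns \<sigma>1 \<bullet> b \<sigma>2 j \<in> \<int>"
      using facet_Delta(1)[OF that(1)] NV(2) b_lattice(1)[OF that(2)] inner_int_lattice by blast
    then have "b \<sigma>2 j - (ns \<sigma>1 \<bullet> b \<sigma>2 j) *\<^sub>R m0 \<in> int_lattice"
      using b_lattice(1)[OF that(2)] m0 unfolding int_lattice_def by simp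
    moreover have "(b \<sigma>2 j - (ns \<sigma>1 \<bullet> b \<sigma>2 j) *\<^sub>R m0) \<bullet> ns \<sigma>1 = 0"
      using ns_inner_facet[OF that(1,3)] by (subst inner_commute) (simp add: inner_diff_right)
    ultimately obtain p where p: "b \<sigma>2 j - (ns \<sigma>1 \<bullet> b \<sigma>2 j) *\<^sub>R m0 = comb \<sigma>1 p" "\<And>i. p $ i \<in> \<int>"
      using lattice_comb[OF \<sigma>1] by metis
    then have "Q'' (b \<sigma>2 j) = p"
      using inj_comb[OF that(1)] that(4)[of "b \<sigma>2 j"] by (simp add: inj_eq)
    then show ?thesis
      using p(2) by simp
  qed
  show ?thesis
  proof (rule abs_det_unimodular)
    show "linear (\<lambda>y. Q (comb \<sigma>' y))" "linear (\<lambda>y. Q' (comb \<sigma> y))"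
      using linear_compose[OF linear_comb Q(1)] linear_compose[OF linear_comb Q'(1)] by (simp_all add: o_def)
    show "Q' (comb \<sigma> (Q (comb \<sigma>' x))) = x" for x
      by (simp add: Q(2) Q'(3,4) linear_diff[OF Q'(1)] linear_cmul[OF Q'(1)])
    show "Q (comb \<sigma>' (axis j 1)) $ i \<in> \<int>" for i j
      unfolding comb_axis using int[OF \<sigma>(1) \<sigma>'(1) \<sigma>(2) Q(2)] .
    show "Q' (comb \<sigma> (axis j 1)) $ i \<in> \<int>" for i j
      unfolding comb_axis using int[OF \<sigma>'(1) \<sigma>(1) \<sigma>'(2) Q'(2)] .
  qed
qed

text \<open>Up to null sets, the subgradients on \<open>\<tau>\<close> are the projections along
  \<open>m0\<close> of the points transported into \<open>E\<close>. These points lie in the star of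
  \<open>m0\<close>, whose facets the projection maps unimodularly.\<close>

theorem MA_facet:
  assumes adm: "adm \<Psi>" and \<tau>: "\<tau> facet_of P" and \<sigma>: "\<sigma> facet_of \<Delta>" "primitive_normal P \<tau> \<in> \<sigma>"
    and E: "E \<in> sets borel" "E \<subseteq> rel_interior \<tau>"
  shows "emeasure lebesgue (subgradient_image (beta b \<sigma> ` rel_interior \<tau>)
      (\<Psi> \<circ> beta_inv \<Delta> h b \<sigma>) (beta b \<sigma> ` E)) = emeasure mu (pull \<Psi> E)"
    (is "emeasure lebesgue ?S = _")
proof -
  define m0 where "m0 = primitive_normal P \<tau>"
  have m0: "m0 \<in> AM" "\<tau> = tau_of \<Delta> h m0" "m0 \<in> \<sigma>" "m0 \<in> int_lattice"
    using facet_P[OF \<tau>] \<sigma>(2) by (auto simp: m0_def)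
  have \<tau>D: "rel_interior \<tau> \<subseteq> D \<sigma>'" if "m0 \<in> \<sigma>'" for \<sigma>'
    using rel_interior_subset[of \<tau>] m0(2,4) that unfolding beta_dom_def by auto
  obtain Q where Q: "linear Q" "\<And>x. comb \<sigma> (Q x) = x - (ns \<sigma> \<bullet> x) *\<^sub>R m0" "\<And>p. Q (comb \<sigma> p) = p"
    "Q m0 = 0" "\<And>x y. Q x = Q y \<Longrightarrow> \<exists>s. x = y + s *\<^sub>R m0"
    using projection_along[OF \<sigma>(1) m0(3)] by metis
  define F where "F = {\<sigma>'. \<sigma>' facet_of \<Delta> \<and> m0 \<in> \<sigma>'}"
  define c where "c \<sigma>' = Q (SOME p. p \<in> \<sigma>')" for \<sigma>'
  define L where "L \<sigma>' y = Q (comb \<sigma>' y)" for \<sigma>' y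
  have cL: "c \<sigma>' + L \<sigma>' y = Q (chart \<sigma>' y)" for \<sigma>' y
    by (simp add: c_def L_def chart_eq linear_add[OF Q(1)])
  have S_iff: "p \<in> ?S \<longleftrightarrow> (\<exists>n\<in>E. \<forall>n'\<in>rel_interior \<tau>. \<Psi> n + comb \<sigma> p \<bullet> (n' - n) \<le> \<Psi> n')" for p
    using \<tau>D[OF m0(3)] E(2) by (intro subgradient_image_iff[OF \<sigma>(1)]) auto
  have W: "pull \<Psi> E \<in> sets borel" "pull \<Psi> E \<subseteq> A - bad \<Psi>"
    using pull_borel[OF adm E(1)] .
  have W_iff: "x \<in> pull \<Psi> E \<longleftrightarrow> (\<exists>n\<in>E. con \<Psi> x n)" if "x \<in> \<sigma>'" "\<sigma>' \<in> F" "x \<notin> bad \<Psi>" for x \<sigma>'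
  proof -
    have x: "x \<in> A - bad \<Psi>"
      using that facet_subset_A by (auto simp: F_def)
    have "rel \<Psi> x n \<longleftrightarrow> con \<Psi> x n" if "n \<in> E" for n
    proof -
      have "n \<in> D \<sigma>'"
        using \<tau>D[of \<sigma>'] \<open>\<sigma>' \<in> F\<close> E(2) that by (auto simp: F_def)
      then have "(x, n) \<in> support_set \<Delta> h"
        using support_set_iff \<open>x \<in> \<sigma>'\<close> \<open>\<sigma>' \<in> F\<close> by (auto simp: F_def)
      then show ?thesis
        by (simp add: rel_def)
    qed
    then show ?thesis
      using rel_iff_T[OF adm x] x by (auto simp: pull_def)
  qed
  have W_sub: "pull \<Psi> E \<subseteq> \<Union>F"
  proof
    fix x assume x: "x \<in> pull \<Psi> E"
    then have "rel \<Psi> x (T \<Psi> x)" "T \<Psi> x \<in> E"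
      using rel_T[OF adm] by (auto simp: pull_def)
    then obtain m' where m': "m' \<in> AM" "x \<in> star_of \<Delta> m'" "T \<Psi> x \<in> tau_of \<Delta> h m'"
      unfolding rel_def support_set_def by blast
    have "m' = m0"
      using facet_P_rel_interior[OF \<tau> _ m'(1,3)] \<open>T \<Psi> x \<in> E\<close> E(2) by (auto simp: m0_def)
    then obtain \<sigma>' where "\<sigma>' facet_of \<Delta>" "x \<in> \<sigma>'" "m0 \<in> \<sigma>'"
      using star_of_facet[OF m'(2)] by blast
    then show "x \<in> \<Union>F"
      by (auto simp: F_def)
  qed
  have inner: "comb \<sigma> (Q x) \<bullet> (n' - n) = x \<bullet> (n' - n)" if "n \<in> rel_interior \<tau>" "n' \<in> rel_interior \<tau>" for x n n'
  proof -
    have "n \<in> tau_of \<Delta> h m0" "n' \<in> tau_of \<Delta> h m0"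
      using that rel_interior_subset[of \<tau>] unfolding m0(2)[symmetric] by auto
    then show ?thesis
      unfolding Q(2) by (simp add: tau_of_def inner_diff_left inner_diff_right)
  qed
  show ?thesis
  proof (rule emeasure_lebesgue_images[OF adm W, of F L c])
    show "F \<subseteq> {\<sigma>. \<sigma> facet_of \<Delta>}"
      by (auto simp: F_def)
    show "linear (L \<sigma>')" "\<bar>det (matrix (L \<sigma>'))\<bar> = 1" if "\<sigma>' \<in> F" for \<sigma>'
      using linear_compose[OF linear_comb Q(1)] that
        projection_unimodular[OF \<sigma>(1) m0(3) _ _ m0(4) Q(1,2)] by (auto simp: L_def[abs_def] o_def F_def)
    show "(\<lambda>y. c \<sigma>1 + L \<sigma>1 y) ` chart \<sigma>1 -` (pull \<Psi> E \<inter> \<sigma>1) \<inter>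
        (\<lambda>y. c \<sigma>2 + L \<sigma>2 y) ` chart \<sigma>2 -` (pull \<Psi> E \<inter> \<sigma>2) = {}"
      if \<sigma>12: "\<sigma>1 \<in> F" "\<sigma>2 \<in> F" "\<sigma>1 \<noteq> \<sigma>2" for \<sigma>1 \<sigma>2
    proof (rule ccontr)
      assume "\<not> ?thesis"
      then obtain y1 y2 where y: "Q (chart \<sigma>1 y1) = Q (chart \<sigma>2 y2)"
        "chart \<sigma>1 y1 \<in> pull \<Psi> E \<inter> \<sigma>1" "chart \<sigma>2 y2 \<in> pull \<Psi> E \<inter> \<sigma>2"
        unfolding cL by blast
      obtain s where s: "chart \<sigma>1 y1 = chart \<sigma>2 y2 + s *\<^sub>R m0"
        using Q(5)[OF y(1)] by blast
      have \<sigma>1: "\<sigma>1 facet_of \<Delta>" "m0 \<in> \<sigma>1" and \<sigma>2: "\<sigma>2 facet_of \<Delta>" "m0 \<in> \<sigma>2"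
        using \<sigma>12 by (auto simp: F_def)
      \<comment> \<open>The two points differ by \<open>s\<close> times \<open>m0\<close>. Each
        facet inequality, tested at the point on the other facet, bounds \<open>s\<close> from one
        side, so \<open>s = 0\<close>.\<close>
      have "ns \<sigma>1 \<bullet> chart \<sigma>2 y2 \<le> 1" "ns \<sigma>2 \<bullet> chart \<sigma>1 y1 \<le> 1"
        using y(2,3) ns_inner_le[OF \<sigma>1(1)] ns_inner_le[OF \<sigma>2(1)] facet_subset[OF \<sigma>1(1)] facet_subset[OF \<sigma>2(1)]
        by blast+
      moreover have "ns \<sigma>1 \<bullet> chart \<sigma>1 y1 = ns \<sigma>1 \<bullet> chart \<sigma>2 y2 + s"
        "ns \<sigma>2 \<bullet> chart \<sigma>1 y1 = ns \<sigma>2 \<bullet> chart \<sigma>2 y2 + s"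
        using s ns_inner_facet[OF \<sigma>1] ns_inner_facet[OF \<sigma>2] by (simp_all add: inner_add_right)
      ultimately have "s = 0"
        using ns_chart[OF \<sigma>1(1)] ns_chart[OF \<sigma>2(1)] by simp
      then have "chart \<sigma>1 y1 \<in> \<sigma>2"
        using s y(3) by simp
      then have "\<sigma>1 = \<sigma>2"
        using facet_unique_if_not_bad[of "chart \<sigma>1 y1" \<Psi>] W(2) y(2) \<sigma>1 \<sigma>2 by blast
      then show False
        using \<sigma>12(3) by simp
    qed
    show "(\<Union>\<sigma>\<in>F. (\<lambda>y. c \<sigma> + L \<sigma> y) ` chart \<sigma> -` (pull \<Psi> E \<inter> \<sigma>)) \<subseteq> ?S"
    proof
      fix p assume "p \<in> (\<Union>\<sigma>\<in>F. (\<lambda>y. c \<sigma> + L \<sigma> y) ` chart \<sigma> -` (pull \<Psi> E \<inter> \<sigma>))"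
      then obtain \<sigma>' y where y: "\<sigma>' \<in> F" "chart \<sigma>' y \<in> pull \<Psi> E" "p = Q (chart \<sigma>' y)"
        unfolding cL by blast
      let ?x = "chart \<sigma>' y"
      have n: "con \<Psi> ?x (T \<Psi> ?x)" "T \<Psi> ?x \<in> E"
        using y(2) rel_T[OF adm, of ?x] by (auto simp: pull_def rel_def)
      have "\<Psi> (T \<Psi> ?x) + comb \<sigma> p \<bullet> (n' - T \<Psi> ?x) \<le> \<Psi> n'" if "n' \<in> rel_interior \<tau>" for n'
      proof -
        have "n' \<in> B"
          using that \<tau>D[OF m0(3)] D_subset_B[OF \<sigma>(1)] by blast
        then show ?thesis
          using conD[OF n(1), of n'] inner[OF _ that, of "T \<Psi> ?x" ?x] n(2) E(2) y(3) by auto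
      qed
      then show "p \<in> ?S"
        unfolding S_iff using n(2) by blast
    qed
    show "?S \<subseteq> (\<Union>\<sigma>\<in>F. (\<lambda>y. c \<sigma> + L \<sigma> y) ` chart \<sigma> -` ((pull \<Psi> E \<union> bad \<Psi>) \<inter> \<sigma>))"
    proof
      fix p assume "p \<in> ?S"
      then obtain n where n: "n \<in> E" "\<And>n'. n' \<in> rel_interior \<tau> \<Longrightarrow> \<Psi> n + comb \<sigma> p \<bullet> (n' - n) \<le> \<Psi> n'"
        unfolding S_iff by blast
      then have "n \<in> rel_interior \<tau>"
        using E(2) by blast
      then obtain x s where x: "x \<in> star_of \<Delta> m0" "con \<Psi> x n" "x = comb \<sigma> p + s *\<^sub>R m0"
        using subgradient_facet_P[OF adm \<tau> _ n(2)] unfolding m0_def by metis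
      obtain \<sigma>' where \<sigma>': "\<sigma>' facet_of \<Delta>" "x \<in> \<sigma>'" "m0 \<in> \<sigma>'"
        using star_of_facet[OF x(1)] .
      obtain y where y: "chart \<sigma>' y = x"
        using chart_surj[OF \<sigma>'(1) ns_inner_facet[OF \<sigma>'(1,2)]] .
      have "\<sigma>' \<in> F"
        using \<sigma>' by (simp add: F_def)
      have "x \<in> pull \<Psi> E \<union> bad \<Psi>"
        using W_iff[OF \<sigma>'(2) \<open>\<sigma>' \<in> F\<close>] x(2) n(1) by blast
      moreover have "p = Q x"
        unfolding x(3) by (simp add: linear_add[OF Q(1)] linear_cmul[OF Q(1)] Q(3,4))
      ultimately have "p \<in> (\<lambda>y. c \<sigma>' + L \<sigma>' y) ` chart \<sigma>' -` ((pull \<Psi> E \<union> bad \<Psi>) \<inter> \<sigma>')"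
        unfolding cL using y \<sigma>'(2) by blast
      then show "p \<in> (\<Union>\<sigma>\<in>F. (\<lambda>y. c \<sigma> + L \<sigma> y) ` chart \<sigma> -` ((pull \<Psi> E \<union> bad \<Psi>) \<inter> \<sigma>))"
        using \<open>\<sigma>' \<in> F\<close> by blast
    qed
  qed (rule W_sub)
qed

subsection \<open>The sets \<open>U\<^sub>\<sigma>\<close>\<close>

lemma U_set_iff:
  assumes "adm \<Psi>" "\<sigma> facet_of \<Delta>"
  shows "n \<in> U_set \<Delta> h \<Psi> \<sigma> \<longleftrightarrow> n \<in> B \<and> (\<forall>m\<in>A. con \<Psi> m n \<longrightarrow> m \<in> rel_interior \<sigma>)"
  unfolding U_set_def using c_subgradient_iff[OF assms(1)] by auto

lemma rel_interior_facet_unique: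
  assumes "\<sigma> facet_of \<Delta>" "\<sigma>' facet_of \<Delta>" "x \<in> rel_interior \<sigma>" "x \<in> \<sigma>'"
  shows "\<sigma>' = \<sigma>"
proof -
  have "\<sigma>' face_of \<Delta>"
    using assms(2) by (simp add: facet_of_def)
  moreover have "\<sigma>' \<noteq> \<Delta>"
    using assms(2) by (auto simp: facet_of_def)
  ultimately show ?thesis
    using facet_eq_face[OF Delta_convex assms(1) _ _ assms(3,4)] by blast
qed

text \<open>Shows that relative interiors of facets are open in \<open>A\<close>; this in turn makes
  \<open>U_set\<close> relatively open in \<open>B\<close>.\<close>

lemma compact_A_minus_facet:
  assumes "\<sigma> facet_of \<Delta>"
  shows "compact (A - rel_interior \<sigma>)"
proof -
  have eq: "A - rel_interior \<sigma> = (\<Union>\<sigma>'\<in>{\<sigma>'. \<sigma>' facet_of \<Delta> \<and> \<sigma>' \<noteq> \<sigma>}. \<sigma>') \<union> rel_frontier \<sigma>"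
  proof (intro equalityI subsetI)
    fix x assume x: "x \<in> A - rel_interior \<sigma>"
    then obtain \<sigma>' where \<sigma>': "\<sigma>' facet_of \<Delta>" "x \<in> \<sigma>'"
      using A_facetE by blast
    show "x \<in> (\<Union>\<sigma>'\<in>{\<sigma>'. \<sigma>' facet_of \<Delta> \<and> \<sigma>' \<noteq> \<sigma>}. \<sigma>') \<union> rel_frontier \<sigma>"
    proof (cases "\<sigma>' = \<sigma>")
      case True
      then have "x \<in> rel_frontier \<sigma>"
        using x \<sigma>' closure_subset[of \<sigma>] by (auto simp: rel_frontier_def)
      then show ?thesis ..
    next
      case False
      then show ?thesis
        using \<sigma>' by blast
    qed
  next
    fix x assume "x \<in> (\<Union>\<sigma>'\<in>{\<sigma>'. \<sigma>' facet_of \<Delta> \<and> \<sigma>' \<noteq> \<sigma>}. \<sigma>') \<union> rel_frontier \<sigma>"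
    then consider \<sigma>' where "\<sigma>' facet_of \<Delta>" "\<sigma>' \<noteq> \<sigma>" "x \<in> \<sigma>'" | "x \<in> rel_frontier \<sigma>"
      by blast
    then show "x \<in> A - rel_interior \<sigma>"
    proof cases
      case 1
      then show ?thesis
        using rel_interior_facet_unique[OF assms] facet_subset_A by blast
    next
      case 2
      have "closure \<sigma> = \<sigma>"
        using facet_compact[OF assms] compact_imp_closed closure_closed by blast
      then show ?thesis
        using 2 facet_subset_A[OF assms] by (auto simp: rel_frontier_def)
    qed
  qed
  have "finite {\<sigma>'. \<sigma>' facet_of \<Delta> \<and> \<sigma>' \<noteq> \<sigma>}"
    by (rule finite_subset[OF _ finite_facets]) blast
  then have "compact (\<Union>\<sigma>'\<in>{\<sigma>'. \<sigma>' facet_of \<Delta> \<and> \<sigma>' \<noteq> \<sigma>}. \<sigma>')"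
    by (rule compact_UN) (use facet_compact in blast)
  moreover have "compact (rel_frontier \<sigma>)"
    using compact_rel_frontier_bounded[OF compact_imp_bounded[OF facet_compact[OF assms]]] .
  ultimately show ?thesis
    unfolding eq by (rule compact_Un)
qed

lemma U_set_compl_compact:
  assumes "adm \<Psi>" "\<sigma> facet_of \<Delta>"
  shows "compact (B - U_set \<Delta> h \<Psi> \<sigma>)"
proof -
  have "B - U_set \<Delta> h \<Psi> \<sigma> = {n. \<exists>m\<in>A - rel_interior \<sigma>. con \<Psi> m n}"
    using U_set_iff[OF assms] con_B by blast
  then show ?thesis
    using compact_con_image[OF _ compact_A_minus_facet[OF assms(2)]] assms(1) by (simp add: adm_def)
qed

lemma U_set_borel:
  assumes "adm \<Psi>" "\<sigma> facet_of \<Delta>"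
  shows "U_set \<Delta> h \<Psi> \<sigma> \<in> sets borel"
proof -
  have "U_set \<Delta> h \<Psi> \<sigma> = B - (B - U_set \<Delta> h \<Psi> \<sigma>)"
    using U_set_iff[OF assms] by blast
  then show ?thesis
    using borel_compact[OF U_set_compl_compact[OF assms]] B_borel by (metis sets.Diff)
qed

text \<open>A contact point of \<open>n\<close> may be pushed in the direction of any lattice point \<open>m0\<close> with
  \<open>n \<in> \<tau>\<^bsub>m0\<^esub>\<close>; it then lands in the star of \<open>m0\<close>, but also still in the interior of \<open>\<sigma>\<close>.\<close>

lemma U_set_active:
  assumes "adm \<Psi>" "\<sigma> facet_of \<Delta>" "n \<in> U_set \<Delta> h \<Psi> \<sigma>" "m0 \<in> AM" "n \<in> tau_of \<Delta> h m0"
  shows "m0 \<in> \<sigma>"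
proof -
  have n: "n \<in> B" "\<And>m. m \<in> A \<Longrightarrow> con \<Psi> m n \<Longrightarrow> m \<in> rel_interior \<sigma>"
    using assms(3) U_set_iff[OF assms(1,2)] by auto
  obtain m where m: "m \<in> A" "con \<Psi> m n"
    using assms(1) n(1) unfolding adm_def by blast
  obtain t where t: "t \<ge> 0" "m + t *\<^sub>R m0 \<in> star_of \<Delta> m0"
    using push_to_star[of m m0] m(1) A_subset assms(4) by blast
  have "m + t *\<^sub>R m0 \<in> rel_interior \<sigma>"
    using n(2) con_push[OF m(2) assms(4,5) t(1)] t(2) star_of_subset by blast
  moreover obtain \<sigma>' where "\<sigma>' facet_of \<Delta>" "m + t *\<^sub>R m0 \<in> \<sigma>'" "m0 \<in> \<sigma>'"
    using star_of_facet[OF t(2)] .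
  ultimately show ?thesis
    using rel_interior_facet_unique[OF assms(2)] by blast
qed

lemma U_set_subset_D:
  assumes "adm \<Psi>" "\<sigma> facet_of \<Delta>"
  shows "U_set \<Delta> h \<Psi> \<sigma> \<subseteq> D \<sigma>"
proof
  fix n assume n: "n \<in> U_set \<Delta> h \<Psi> \<sigma>"
  then have "n \<in> B"
    using U_set_iff[OF assms] by blast
  then obtain m0 where m0: "m0 \<in> AM" "n \<in> tau_of \<Delta> h m0"
    using B_tauE by blast
  then have "m0 \<in> \<sigma>"
    using U_set_active[OF assms n] by blast
  then show "n \<in> D \<sigma>"
    using m0 unfolding beta_dom_def by blast
qed

lemma gap_zero:
  assumes "\<sigma> facet_of \<Delta>" "n \<in> D \<sigma>"
  shows "gap \<sigma> n = 0"
proof -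
  obtain m where "m \<in> \<sigma> \<inter> int_lattice" "n \<in> tau_of \<Delta> h m"
    using assms(2) unfolding beta_dom_def by blast
  then have "gap \<sigma> n \<le> 0"
    using gap_le[OF assms(1), of m n] by (simp add: tau_of_def)
  moreover have "n \<in> P"
    using assms(2) D_subset_B[OF assms(1)] B_subset by blast
  then have "gap \<sigma> n \<ge> 0"
    using push_to_D(1)[OF _ assms(1)] by blast
  ultimately show ?thesis
    by simp
qed

text \<open>Near \<open>n\<close> only constraints from \<open>\<sigma>\<close> can be active, so
  any small perturbation of \<open>n\<close> can be corrected along \<open>ns \<sigma>\<close> to a
  point of \<open>D \<sigma>\<close>. Every direction is thus available, and separation puts
  \<open>x\<close> into the hull of the contact points of \<open>n\<close>, all of which lie on
  \<open>\<sigma>\<close>.\<close>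

lemma subgradient_U_set:
  assumes adm: "adm \<Psi>" and \<sigma>: "\<sigma> facet_of \<Delta>" and n: "n \<in> U_set \<Delta> h \<Psi> \<sigma>"
    and x: "ns \<sigma> \<bullet> x = 1"
    and sub: "\<And>n'. n' \<in> D \<sigma> \<Longrightarrow> \<Psi> n + x \<bullet> (n' - n) \<le> \<Psi> n'"
  shows "con \<Psi> x n" "x \<in> \<sigma>"
proof -
  have nB: "n \<in> B" "\<And>m. m \<in> A \<Longrightarrow> con \<Psi> m n \<Longrightarrow> m \<in> rel_interior \<sigma>"
    using n U_set_iff[OF adm \<sigma>] by auto
  have nD: "n \<in> D \<sigma>"
    using n U_set_subset_D[OF adm \<sigma>] by blast
  have dir: "\<exists>l. l \<in> A \<and> con \<Psi> l n \<and> x \<bullet> v \<le> l \<bullet> v" for v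
  proof -
    define w where "w j = n + inverse (real (Suc j)) *\<^sub>R v" for j
    \<comment> \<open>\<open>w\<close> perturbs \<open>n\<close> in an arbitrary direction and may
      leave \<open>P\<close>; the gap puts it back onto the graph over the hyperplane.\<close>
    define s where "s j = w j + gap \<sigma> (w j) *\<^sub>R ns \<sigma>" for j
    have "(\<lambda>j. n + inverse (real (Suc j)) *\<^sub>R v) \<longlonglongrightarrow> n + 0 *\<^sub>R v"
      by (intro tendsto_intros LIMSEQ_inverse_real_of_nat)
    then have w: "w \<longlonglongrightarrow> n"
      by (simp add: w_def[abs_def])
    have "(\<lambda>j. gap \<sigma> (w j)) \<longlonglongrightarrow> gap \<sigma> n"
      using continuous_on_tendsto_compose[OF continuous_gap[OF \<sigma>] w] by simp
    then have "s \<longlonglongrightarrow> n + gap \<sigma> n *\<^sub>R ns \<sigma>"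
      unfolding s_def[abs_def] by (intro tendsto_intros w)
    then have s: "s \<longlonglongrightarrow> n"
      using gap_zero[OF \<sigma> nD] by simp
    have "\<forall>\<^sub>F j in sequentially. m \<bullet> s j \<le> of_int (h m)" if m: "m \<in> AM" "m \<notin> \<sigma>" for m
    proof -
      have "n \<in> P"
        using nB(1) B_subset by blast
      then have "m \<bullet> n \<le> of_int (h m)"
        using m(1) P_eq by blast
      moreover have "m \<bullet> n \<noteq> of_int (h m)"
        using U_set_active[OF adm \<sigma> n m(1)] m(2) \<open>n \<in> P\<close> by (auto simp: tau_of_def)
      ultimately have "m \<bullet> n < of_int (h m)"
        by simp
      moreover have "(\<lambda>j. m \<bullet> s j) \<longlonglongrightarrow> m \<bullet> n"
        by (intro tendsto_intros s)
      ultimately have "\<forall>\<^sub>F j in sequentially. m \<bullet> s j < of_int (h m)"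
        by (rule order_tendstoD(2)[rotated])
      then show ?thesis
        by (rule eventually_mono) simp
    qed
    then have "\<forall>m\<in>{m \<in> AM. m \<notin> \<sigma>}. \<forall>\<^sub>F j in sequentially. m \<bullet> s j \<le> of_int (h m)"
      by blast
    moreover have "finite {m \<in> AM. m \<notin> \<sigma>}"
      by (rule finite_subset[OF _ finite_AM]) blast
    ultimately have "\<forall>\<^sub>F j in sequentially. \<forall>m\<in>{m \<in> AM. m \<notin> \<sigma>}. m \<bullet> s j \<le> of_int (h m)"
      by (simp only: eventually_ball_finite)
    then have ev1: "\<forall>\<^sub>F j in sequentially. s j \<in> D \<sigma>"
      by (rule eventually_mono) (auto simp: s_def intro!: gap_D[OF \<sigma>])
    have "open (- (B - U_set \<Delta> h \<Psi> \<sigma>))"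
      using compact_imp_closed[OF U_set_compl_compact[OF adm \<sigma>]] by (rule open_Compl)
    moreover have "n \<in> - (B - U_set \<Delta> h \<Psi> \<sigma>)"
      using n by blast
    ultimately have "\<forall>\<^sub>F j in sequentially. s j \<in> - (B - U_set \<Delta> h \<Psi> \<sigma>)"
      by (rule topological_tendstoD[OF s])
    with ev1 have "\<forall>\<^sub>F j in sequentially. s j \<in> D \<sigma> \<and> s j \<in> U_set \<Delta> h \<Psi> \<sigma>"
      by eventually_elim (use D_subset_B[OF \<sigma>] in blast)
    then obtain J where J: "\<And>j. j \<ge> J \<Longrightarrow> s j \<in> D \<sigma> \<and> s j \<in> U_set \<Delta> h \<Psi> \<sigma>"
      unfolding eventually_sequentially by blast
    define s' where "s' j = s (j + J)" for j
    have s': "s' j \<in> D \<sigma>" "s' j \<in> U_set \<Delta> h \<Psi> \<sigma>" for j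
      using J by (auto simp: s'_def)
    have lim: "s' \<longlonglongrightarrow> n"
      using LIMSEQ_ignore_initial_segment[OF s, of J] by (simp add: s'_def[abs_def])
    obtain m r where m: "strict_mono r" "\<And>j. m j \<in> A" "\<And>j. con \<Psi> (m j) (s' (r j))"
      "\<And>j. x \<bullet> (s' (r j) - n) \<le> m j \<bullet> (s' (r j) - n)" "convergent m" "lim m \<in> A" "con \<Psi> (lim m) n"
      by (rule limit_contact[OF adm _ lim _ nB(1), where x = x])
        (use s' sub D_subset_B[OF \<sigma>] in auto)
    have "x \<bullet> v \<le> m j \<bullet> v" for j
    proof -
      let ?i = "r j + J"
      have "m j \<in> rel_interior \<sigma>"
        using s'(2)[of "r j"] m(2,3) U_set_iff[OF adm \<sigma>] by blast
      then have "ns \<sigma> \<bullet> m j = 1"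
        using rel_interior_subset ns_inner_facet[OF \<sigma>] by blast
      \<comment> \<open>Both \<open>x\<close> and \<open>m j\<close> pair to 1 with
        \<open>ns \<sigma>\<close>, so the corrections cancel and only the part along
        \<open>v\<close> is compared.\<close>
      then have "inverse (real (Suc ?i)) * (x \<bullet> v) \<le> inverse (real (Suc ?i)) * (m j \<bullet> v)"
        using m(4)[of j] x by (simp add: s'_def s_def w_def inner_add_right inner_commute[of _ "ns \<sigma>"])
      moreover have "inverse (real (Suc ?i)) > 0"
        by simp
      ultimately show ?thesis
        by (simp only: mult_le_cancel_left_pos)
    qed
    moreover have "(\<lambda>j. m j \<bullet> v) \<longlonglongrightarrow> lim m \<bullet> v"
      using m(5) by (intro tendsto_intros) (simp add: convergent_LIMSEQ_iff)
    ultimately have "x \<bullet> v \<le> lim m \<bullet> v"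
      by (intro LIMSEQ_le_const) auto
    then show ?thesis
      using m by blast
  qed
  define K where "K = convex hull {m \<in> A. con \<Psi> m n}"
  have "x \<in> K"
  proof (rule ccontr)
    assume "x \<notin> K"
    have "closed K" "convex K"
      unfolding K_def by (simp_all add: compact_imp_closed compact_convex_hull compact_contact_set adm)
    then obtain a c where ac: "a \<bullet> x < c" "\<forall>y\<in>K. a \<bullet> y > c"
      using separating_hyperplane_closed_point \<open>x \<notin> K\<close> by metis
    obtain l where l: "l \<in> A" "con \<Psi> l n" "x \<bullet> (- a) \<le> l \<bullet> (- a)"
      using dir by blast
    have "l \<in> K"
      unfolding K_def using l by (intro hull_inc) simp
    then have "a \<bullet> l > c"
      using ac(2) by blast
    then show False
      using l(3) ac(1) by (simp add: inner_commute)
  qed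
  then show "con \<Psi> x n"
    unfolding K_def by (rule contact_hull)
  have "K \<subseteq> \<sigma>"
    unfolding K_def by (rule hull_minimal) (use nB(2) rel_interior_subset facet_convex[OF \<sigma>] in auto)
  then show "x \<in> \<sigma>"
    using \<open>x \<in> K\<close> by blast
qed

text \<open>Subtracting \<open>m\<close> moves the origin of the chart to \<open>q\<close>. After
  this translation the subgradients are exactly the points of \<open>\<sigma>\<close> in contact
  with \<open>E\<close>, so one facet and the identity map suffice.\<close>

theorem MA_U_set:
  assumes adm: "adm \<Psi>" and \<sigma>: "\<sigma> facet_of \<Delta>" "m \<in> \<sigma>"
    and E: "E \<in> sets borel" "E \<subseteq> U_set \<Delta> h \<Psi> \<sigma>"
  shows "emeasure lebesgue (subgradient_image (beta b \<sigma> ` D \<sigma>)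
      ((\<lambda>n. \<Psi> n - m \<bullet> n) \<circ> beta_inv \<Delta> h b \<sigma>) (beta b \<sigma> ` E)) = emeasure mu (pull \<Psi> E)"
    (is "emeasure lebesgue ?S = _")
proof -
  have ED: "E \<subseteq> D \<sigma>"
    using E(2) U_set_subset_D[OF adm \<sigma>(1)] by blast
  obtain q where q: "chart \<sigma> q = m"
    using chart_surj[OF \<sigma>(1) ns_inner_facet[OF \<sigma>]] .
  have chart_q: "chart \<sigma> (q + p) = m + comb \<sigma> p" for p
    using q by (simp add: chart_eq linear_add[OF linear_comb])
  have S_iff: "p \<in> ?S \<longleftrightarrow> (\<exists>n\<in>E. con \<Psi> (chart \<sigma> (q + p)) n \<and> chart \<sigma> (q + p) \<in> \<sigma>)" for p
  proof -
    have "p \<in> ?S \<longleftrightarrow> (\<exists>n\<in>E. \<forall>n'\<in>D \<sigma>. \<Psi> n - m \<bullet> n + comb \<sigma> p \<bullet> (n' - n) \<le> \<Psi> n' - m \<bullet> n')"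
      by (rule subgradient_image_iff[OF \<sigma>(1) order_refl ED])
    also have "\<dots> \<longleftrightarrow> (\<exists>n\<in>E. \<forall>n'\<in>D \<sigma>. \<Psi> n + chart \<sigma> (q + p) \<bullet> (n' - n) \<le> \<Psi> n')"
      unfolding chart_q by (simp add: inner_add_left inner_diff_right algebra_simps)
    also have "\<dots> \<longleftrightarrow> (\<exists>n\<in>E. con \<Psi> (chart \<sigma> (q + p)) n \<and> chart \<sigma> (q + p) \<in> \<sigma>)"
    proof (rule bex_cong[OF refl], rule iffI)
      fix n assume n: "n \<in> E" "\<forall>n'\<in>D \<sigma>. \<Psi> n + chart \<sigma> (q + p) \<bullet> (n' - n) \<le> \<Psi> n'"
      then have "n \<in> U_set \<Delta> h \<Psi> \<sigma>"
        using E(2) by blast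
      then show "con \<Psi> (chart \<sigma> (q + p)) n \<and> chart \<sigma> (q + p) \<in> \<sigma>"
        using subgradient_U_set[OF adm \<sigma>(1) _ ns_chart[OF \<sigma>(1)]] n(2) by blast
    next
      fix n assume "con \<Psi> (chart \<sigma> (q + p)) n \<and> chart \<sigma> (q + p) \<in> \<sigma>"
      then show "\<forall>n'\<in>D \<sigma>. \<Psi> n + chart \<sigma> (q + p) \<bullet> (n' - n) \<le> \<Psi> n'"
        using conD D_subset_B[OF \<sigma>(1)] by blast
    qed
    finally show ?thesis .
  qed
  have W: "pull \<Psi> E \<in> sets borel" "pull \<Psi> E \<subseteq> A - bad \<Psi>"
    using pull_borel[OF adm E(1)] .
  have W_con: "con \<Psi> x (T \<Psi> x)" "T \<Psi> x \<in> E" "x \<in> A" if "x \<in> pull \<Psi> E" for x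
    using that rel_T[OF adm, of x] by (auto simp: pull_def rel_def)
  have W_sub: "pull \<Psi> E \<subseteq> \<sigma>"
    using W_con E(2) U_set_iff[OF adm \<sigma>(1)] rel_interior_subset by blast
  have con_W: "x \<in> pull \<Psi> E \<union> bad \<Psi>" if "x \<in> \<sigma>" "con \<Psi> x n" "n \<in> E" for x n
  proof (cases "x \<in> bad \<Psi>")
    case False
    then have "x \<in> A - bad \<Psi>"
      using that(1) facet_subset_A[OF \<sigma>(1)] by blast
    moreover have "(x, n) \<in> support_set \<Delta> h"
      using support_set_iff \<sigma>(1) that(1,3) ED by blast
    ultimately have "n = T \<Psi> x"
      using rel_iff_T[OF adm] that(2) unfolding rel_def by blast
    then show ?thesis
      using \<open>x \<in> A - bad \<Psi>\<close> that(3) by (simp add: pull_def)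
  qed simp
  show ?thesis
  proof (rule emeasure_lebesgue_images[OF adm W, of "{\<sigma>}" "\<lambda>_ y. y" "\<lambda>_. - q"])
    show "linear (\<lambda>y :: real ^ 'k. y)"
      by (rule linear_ident)
    show "\<bar>det (matrix (\<lambda>y :: real ^ 'k. y))\<bar> = 1"
      by (simp add: matrix_id_mat_1[unfolded id_def])
    show "(\<Union>\<sigma>\<in>{\<sigma>}. (\<lambda>y. - q + y) ` chart \<sigma> -` (pull \<Psi> E \<inter> \<sigma>)) \<subseteq> ?S"
      using W_con S_iff by fastforce
    show "?S \<subseteq> (\<Union>\<sigma>\<in>{\<sigma>}. (\<lambda>y. - q + y) ` chart \<sigma> -` ((pull \<Psi> E \<union> bad \<Psi>) \<inter> \<sigma>))"
    proof
      fix p assume "p \<in> ?S"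
      then obtain n where n: "n \<in> E" "con \<Psi> (chart \<sigma> (q + p)) n" "chart \<sigma> (q + p) \<in> \<sigma>"
        unfolding S_iff by blast
      then have "q + p \<in> chart \<sigma> -` ((pull \<Psi> E \<union> bad \<Psi>) \<inter> \<sigma>)"
        using con_W by blast
      moreover have "p = - q + (q + p)"
        by simp
      ultimately show "p \<in> (\<Union>\<sigma>\<in>{\<sigma>}. (\<lambda>y. - q + y) ` chart \<sigma> -` ((pull \<Psi> E \<union> bad \<Psi>) \<inter> \<sigma>))"
        by blast
    qed
  qed (use \<sigma>(1) W_sub in auto)
qed

section \<open>Measurability of the singular set\<close>

lemma finite_facets_P: "finite {\<tau>. \<tau> facet_of P}"
  by (rule finite_subset[of _ "tau_of \<Delta> h ` AM"]) (use facet_P finite_AM in auto)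

lemma rel_interior_facet_P:
  assumes "\<tau> facet_of P"
  shows "rel_interior \<tau> \<in> sets borel" "rel_interior \<tau> \<subseteq> B"
proof -
  have \<tau>: "\<tau> = tau_of \<Delta> h (primitive_normal P \<tau>)" "primitive_normal P \<tau> \<in> AM"
    using facet_P[OF assms] by blast+
  have "compact \<tau>"
    using \<tau>(1) tau_of_compact by metis
  then have "compact (rel_frontier \<tau>)"
    by (intro compact_rel_frontier_bounded compact_imp_bounded)
  moreover have "rel_interior \<tau> = \<tau> - rel_frontier \<tau>"
    using rel_interior_subset[of \<tau>] closure_closed[OF compact_imp_closed[OF \<open>compact \<tau>\<close>]]
    by (auto simp: rel_frontier_def)
  ultimately show "rel_interior \<tau> \<in> sets borel"
    using borel_compact \<open>compact \<tau>\<close> by auto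
  have "\<tau> \<subseteq> B"
    using \<tau> tau_of_subset_B by metis
  then show "rel_interior \<tau> \<subseteq> B"
    using rel_interior_subset by blast
qed

lemma Sing_borel:
  assumes "adm \<Psi>"
  shows "Sing \<Delta> h \<Psi> \<in> sets borel" "Sing \<Delta> h \<Psi> \<subseteq> B"
proof -
  have "bdB_sing \<Delta> h \<in> sets borel"
    unfolding bdB_sing_def using B_borel finite_facets_P rel_interior_facet_P(1)
    by (intro sets.Diff sets.finite_UN) auto
  moreover have "(\<Union>\<sigma>\<in>{\<sigma>. \<sigma> facet_of \<Delta>}. U_set \<Delta> h \<Psi> \<sigma>) \<in> sets borel"
    using finite_facets U_set_borel[OF assms] by (intro sets.finite_UN) auto
  ultimately show "Sing \<Delta> h \<Psi> \<in> sets borel"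
    unfolding Sing_def by (rule sets.Diff)
  show "Sing \<Delta> h \<Psi> \<subseteq> B"
    unfolding Sing_def bdB_sing_def by blast
qed

end

section \<open>Transport plans and contact pairs\<close>

locale reflexive_transport = reflexive_height \<Delta> h b
  for \<Delta> :: "(real ^ 'n) set" and h and b :: "(real ^ 'n) set \<Rightarrow> 'k::finite \<Rightarrow> real ^ 'n" +
  fixes \<nu> :: "(real ^ 'n) measure"
  assumes nu_sets: "sets \<nu> = sets (restrict_space borel (bdB \<Delta> h))"
    and nu_mass: "emeasure \<nu> (bdB \<Delta> h) = emeasure (mu_M \<Delta> b) (bdA \<Delta>)"
begin

lemma sets_nu_iff: "E \<in> sets \<nu> \<longleftrightarrow> E \<in> sets borel \<and> E \<subseteq> B"
  unfolding nu_sets by (rule sets_restrict_borel_iff[OF B_borel])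

lemma space_nu: "space \<nu> = B"
  using sets_eq_imp_space_eq[OF nu_sets] by (simp add: space_restrict_space)

lemma finite_measure_nu: "finite_measure \<nu>"
  using emeasure_mu_finite nu_mass space_nu by (intro finite_measureI) auto

lemma AB_borel: "A \<times> B \<in> sets borel"
  using borel_compact[OF compact_Times[OF A_compact B_compact]] .

lemma plan_measurable:
  assumes "sets \<gamma> = sets (restrict_space borel (A \<times> B))"
  shows "space \<gamma> = A \<times> B" "fst \<in> measurable \<gamma> mu" "snd \<in> measurable \<gamma> \<nu>"
proof -
  show space: "space \<gamma> = A \<times> B"
    using sets_eq_imp_space_eq[OF assms] by (simp add: space_restrict_space)
  have "fst \<in> measurable (restrict_space borel (A \<times> B)) (restrict_space borel A)"
    by (intro measurable_restrict_space2 measurable_restrict_space1 borel_measurable_continuous_onI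
        continuous_on_fst continuous_on_id) (auto simp: space_restrict_space)
  then show "fst \<in> measurable \<gamma> mu"
    using assms sets_mu by (simp cong: measurable_cong_sets)
  have "snd \<in> measurable (restrict_space borel (A \<times> B)) (restrict_space borel B)"
    by (intro measurable_restrict_space2 measurable_restrict_space1 borel_measurable_continuous_onI
        continuous_on_snd continuous_on_id) (auto simp: space_restrict_space)
  then show "snd \<in> measurable \<gamma> \<nu>"
    using assms nu_sets by (simp cong: measurable_cong_sets)
qed

lemma planD:
  assumes "transport_plan mu \<nu> \<gamma>"
  shows "sets \<gamma> = sets (restrict_space borel (A \<times> B))" "distr \<gamma> mu fst = mu" "distr \<gamma> \<nu> snd = \<nu>"
    "space \<gamma> = A \<times> B" "fst \<in> measurable \<gamma> mu" "snd \<in> measurable \<gamma> \<nu>"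
    and plan_mass: "emeasure \<gamma> (space \<gamma>) = emeasure mu A"
    and plan_finite: "finite_measure \<gamma>"
proof -
  show \<gamma>: "sets \<gamma> = sets (restrict_space borel (A \<times> B))" "distr \<gamma> mu fst = mu" "distr \<gamma> \<nu> snd = \<nu>"
    using assms unfolding transport_plan_def space_mu space_nu by auto
  show m: "space \<gamma> = A \<times> B" "fst \<in> measurable \<gamma> mu" "snd \<in> measurable \<gamma> \<nu>"
    using plan_measurable[OF \<gamma>(1)] .
  have "emeasure mu A = emeasure (distr \<gamma> mu fst) A"
    unfolding \<gamma>(2) ..
  also have "\<dots> = emeasure \<gamma> (fst -` A \<inter> space \<gamma>)"
    by (rule emeasure_distr[OF m(2)]) (simp add: sets_mu_iff A_borel)
  also have "fst -` A \<inter> space \<gamma> = space \<gamma>"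
    unfolding m(1) by auto
  finally show "emeasure \<gamma> (space \<gamma>) = emeasure mu A" ..
  then show "finite_measure \<gamma>"
    using emeasure_mu_finite by (intro finite_measureI) auto
qed

lemma integrable_plan:
  fixes f :: "(real ^ 'n) \<times> (real ^ 'n) \<Rightarrow> real"
  assumes "transport_plan mu \<nu> \<gamma>" "continuous_on (A \<times> B) f"
  shows "integrable \<gamma> f"
proof -
  interpret finite_measure \<gamma>
    using plan_finite[OF assms(1)] .
  have "bounded (f ` (A \<times> B))"
    by (intro compact_imp_bounded compact_continuous_image assms(2) compact_Times A_compact B_compact)
  then obtain K where K: "\<And>z. z \<in> A \<times> B \<Longrightarrow> norm (f z) \<le> K"
    unfolding bounded_iff by auto
  have "f \<in> borel_measurable (restrict_space borel (A \<times> B))"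
    using assms(2) by (rule borel_measurable_continuous_on_restrict)
  then have "f \<in> borel_measurable \<gamma>"
    using planD(1)[OF assms(1)] by (simp cong: measurable_cong_sets)
  moreover have "AE z in \<gamma>. norm (f z) \<le> K"
    using K planD(4)[OF assms(1)] by (intro AE_I2) auto
  ultimately show ?thesis
    by (intro integrable_const_bound)
qed

lemma integral_fst_plan:
  fixes f :: "real ^ 'n \<Rightarrow> real"
  assumes "transport_plan mu \<nu> \<gamma>" "continuous_on A f"
  shows "(\<integral>m. f m \<partial>mu) = (\<integral>z. f (fst z) \<partial>\<gamma>)"
proof -
  have "f \<in> borel_measurable mu"
    using borel_measurable_continuous_on_restrict[OF assms(2)] sets_mu by (simp cong: measurable_cong_sets)
  then have "(\<integral>m. f m \<partial>distr \<gamma> mu fst) = (\<integral>z. f (fst z) \<partial>\<gamma>)"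
    by (rule integral_distr[OF planD(5)[OF assms(1)]])
  then show ?thesis
    unfolding planD(2)[OF assms(1)] .
qed

lemma integral_snd_plan:
  fixes f :: "real ^ 'n \<Rightarrow> real"
  assumes "transport_plan mu \<nu> \<gamma>" "continuous_on B f"
  shows "(\<integral>n. f n \<partial>\<nu>) = (\<integral>z. f (snd z) \<partial>\<gamma>)"
proof -
  have "f \<in> borel_measurable \<nu>"
    using borel_measurable_continuous_on_restrict[OF assms(2)] nu_sets by (simp cong: measurable_cong_sets)
  then have "(\<integral>n. f n \<partial>distr \<gamma> \<nu> snd) = (\<integral>z. f (snd z) \<partial>\<gamma>)"
    by (rule integral_distr[OF planD(6)[OF assms(1)]])
  then show ?thesis
    unfolding planD(3)[OF assms(1)] .
qed

lemma continuous_cost: "continuous_on S (\<lambda>z :: (real ^ 'n) \<times> (real ^ 'n). fst z \<bullet> snd z)"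
  by (intro continuous_intros)

abbreviation dual_value :: "(real ^ 'n \<Rightarrow> real) \<Rightarrow> real" where
  "dual_value \<Psi> \<equiv> (\<integral>m. c_transform B \<Psi> m \<partial>mu) + (\<integral>n. \<Psi> n \<partial>\<nu>)"

text \<open>The slack \<open>?s\<close> is non-negative and vanishes exactly at contact pairs; its
  integral is the difference of the two sides.\<close>

lemma plan_duality:
  assumes plan: "transport_plan mu \<nu> \<gamma>" and adm: "adm \<Psi>"
  shows "(\<integral>z. fst z \<bullet> snd z \<partial>\<gamma>) \<le> dual_value \<Psi>"
    and "(\<integral>z. fst z \<bullet> snd z \<partial>\<gamma>) = dual_value \<Psi> \<longleftrightarrow> (AE z in \<gamma>. con \<Psi> (fst z) (snd z))"
proof -
  let ?\<Phi> = "c_transform B \<Psi>"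
  let ?s = "\<lambda>z. ?\<Phi> (fst z) + \<Psi> (snd z) - fst z \<bullet> snd z"
  have c1: "continuous_on A ?\<Phi>" and c2: "continuous_on B \<Psi>"
    using continuous_c_transform_B[OF adm] adm by (auto simp: adm_def)
  have cz: "continuous_on (A \<times> B) (\<lambda>z. ?\<Phi> (fst z))" "continuous_on (A \<times> B) (\<lambda>z. \<Psi> (snd z))"
    by (rule continuous_on_compose2[OF c1] continuous_on_compose2[OF c2];
        auto intro!: continuous_on_fst continuous_on_snd continuous_on_id)+
  note int = integrable_plan[OF plan cz(1)] integrable_plan[OF plan cz(2)]
    integrable_plan[OF plan continuous_cost]
  have eq: "(\<integral>z. ?s z \<partial>\<gamma>) = dual_value \<Psi> - (\<integral>z. fst z \<bullet> snd z \<partial>\<gamma>)"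
    using int by (simp add: integral_fst_plan[OF plan c1] integral_snd_plan[OF plan c2])
  have ints: "integrable \<gamma> ?s"
    using int by simp
  have nonneg: "AE z in \<gamma>. 0 \<le> ?s z"
  proof (rule AE_I2)
    fix z assume "z \<in> space \<gamma>"
    then have "snd z \<in> B"
      unfolding planD(4)[OF plan] mem_Times_iff by (rule conjunct2)
    then show "0 \<le> ?s z"
      using c_transform_ge[OF B_compact c2, of "snd z" "fst z"] by linarith
  qed
  show "(\<integral>z. fst z \<bullet> snd z \<partial>\<gamma>) \<le> dual_value \<Psi>"
    using integral_nonneg_AE[OF nonneg] eq by simp
  have "(\<integral>z. fst z \<bullet> snd z \<partial>\<gamma>) = dual_value \<Psi> \<longleftrightarrow> (\<integral>z. ?s z \<partial>\<gamma>) = 0"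
    using eq by auto
  also have "\<dots> \<longleftrightarrow> (AE z in \<gamma>. ?s z = 0)"
    by (rule integral_nonneg_eq_0_iff_AE[OF ints nonneg])
  also have "\<dots> \<longleftrightarrow> (AE z in \<gamma>. con \<Psi> (fst z) (snd z))"
  proof (rule AE_cong)
    fix z assume "z \<in> space \<gamma>"
    then have "snd z \<in> B"
      unfolding planD(4)[OF plan] mem_Times_iff by (rule conjunct2)
    then show "?s z = 0 \<longleftrightarrow> con \<Psi> (fst z) (snd z)"
      using c_transform_ge[OF B_compact c2, of "snd z" "fst z"] con_iff[OF c2, of "snd z" "fst z"] by linarith
  qed
  finally show "(\<integral>z. fst z \<bullet> snd z \<partial>\<gamma>) = dual_value \<Psi> \<longleftrightarrow> (AE z in \<gamma>. con \<Psi> (fst z) (snd z))" .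
qed

lemma optimal_if_con:
  assumes "transport_plan mu \<nu> \<gamma>" "adm \<Psi>" "AE z in \<gamma>. con \<Psi> (fst z) (snd z)"
  shows "optimal_plan mu \<nu> \<gamma>"
proof -
  have "(\<integral>z. fst z \<bullet> snd z \<partial>\<gamma>) = dual_value \<Psi>"
    using plan_duality(2)[OF assms(1,2)] assms(3) by blast
  then have "(\<integral>z. fst z \<bullet> snd z \<partial>\<gamma>') \<le> (\<integral>z. fst z \<bullet> snd z \<partial>\<gamma>)" if "transport_plan mu \<nu> \<gamma>'" for \<gamma>'
    using plan_duality(1)[OF that assms(2)] by linarith
  then show ?thesis
    unfolding optimal_plan_def using assms(1) by simp
qed

text \<open>\<open>\<gamma>'\<close> attains the dual value of \<open>\<Psi>\<close>, which bounds
  every plan. An optimal plan attains it too, and the equality case of duality gives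
  contact.\<close>

lemma con_transfer:
  assumes "optimal_plan mu \<nu> \<gamma>" "transport_plan mu \<nu> \<gamma>'" "adm \<Psi>" "AE z in \<gamma>'. con \<Psi> (fst z) (snd z)"
  shows "AE z in \<gamma>. con \<Psi> (fst z) (snd z)"
proof -
  have plan: "transport_plan mu \<nu> \<gamma>"
    using assms(1) by (simp add: optimal_plan_def)
  have "(\<integral>z. fst z \<bullet> snd z \<partial>\<gamma>') \<le> (\<integral>z. fst z \<bullet> snd z \<partial>\<gamma>)"
    using assms(1,2) by (auto simp: optimal_plan_def)
  then show ?thesis
    using plan_duality[OF plan assms(3)] plan_duality(2)[OF assms(2,3)] assms(4) by linarith
qed

section \<open>Supports of plans and cyclical monotonicity\<close>

definition supp :: "((real ^ 'n) \<times> (real ^ 'n)) measure \<Rightarrow> ((real ^ 'n) \<times> (real ^ 'n)) set" where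
  "supp \<gamma> = {z \<in> A \<times> B. \<forall>U. open U \<and> z \<in> U \<longrightarrow> emeasure \<gamma> (U \<inter> (A \<times> B)) > 0}"

lemma plan_open_sets:
  assumes "transport_plan mu \<nu> \<gamma>" "open U"
  shows "U \<inter> (A \<times> B) \<in> sets \<gamma>"
  using assms(2) AB_borel unfolding planD(1)[OF assms(1)] sets_restrict_borel_iff[OF AB_borel]
  by (auto intro!: sets.Int)

text \<open>By second countability, the complement of the support is covered by countably many null
  basic open sets.\<close>

lemma AE_supp:
  assumes "transport_plan mu \<nu> \<gamma>"
  shows "AE z in \<gamma>. z \<in> supp \<gamma>"
proof -
  obtain K :: "((real ^ 'n) \<times> (real ^ 'n)) set set" where K: "countable K" "topological_basis K"
    using ex_countable_basis by blast
  define K0 where "K0 = {U \<in> K. emeasure \<gamma> (U \<inter> (A \<times> B)) = 0}"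
  have "(\<Union>U\<in>K0. U \<inter> (A \<times> B)) \<in> null_sets \<gamma>"
  proof (rule null_sets_UN')
    show "countable K0"
      using K(1) by (simp add: K0_def)
    fix U assume "U \<in> K0"
    then show "U \<inter> (A \<times> B) \<in> null_sets \<gamma>"
      using plan_open_sets[OF assms topological_basis_open[OF K(2)]] by (auto simp: K0_def null_sets_def)
  qed
  moreover have "{z \<in> space \<gamma>. z \<notin> supp \<gamma>} \<subseteq> (\<Union>U\<in>K0. U \<inter> (A \<times> B))"
  proof
    fix z assume "z \<in> {z \<in> space \<gamma>. z \<notin> supp \<gamma>}"
    then obtain U where U: "z \<in> A \<times> B" "open U" "z \<in> U" "emeasure \<gamma> (U \<inter> (A \<times> B)) = 0"
      using planD(4)[OF assms] by (auto simp: supp_def zero_less_iff_neq_zero)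
    obtain V where V: "V \<in> K" "z \<in> V" "V \<subseteq> U"
      using topological_basisE[OF K(2) U(2,3)] by blast
    have "emeasure \<gamma> (V \<inter> (A \<times> B)) \<le> emeasure \<gamma> (U \<inter> (A \<times> B))"
      using V(3) plan_open_sets[OF assms U(2)] by (intro emeasure_mono) auto
    then have "V \<in> K0"
      using U(4) V(1) by (simp add: K0_def)
    then show "z \<in> (\<Union>U\<in>K0. U \<inter> (A \<times> B))"
      using V(2) U(1) by blast
  qed
  ultimately show ?thesis
    by (rule AE_I')
qed

lemma inner_close:
  fixes x x' y y' :: "'a::real_inner"
  assumes "norm y' \<le> R" "norm x \<le> R" "norm (x' - x) \<le> d" "norm (y' - y) \<le> d"
  shows "\<bar>x' \<bullet> y' - x \<bullet> y\<bar> \<le> 2 * R * d"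
proof -
  have "x' \<bullet> y' - x \<bullet> y = (x' - x) \<bullet> y' + x \<bullet> (y' - y)"
    by (simp add: inner_diff_left inner_diff_right)
  also have "\<bar>\<dots>\<bar> \<le> norm (x' - x) * norm y' + norm x * norm (y' - y)"
    by (intro abs_triangle_ineq[THEN order_trans] add_mono Cauchy_Schwarz_ineq2)
  also have "\<dots> \<le> d * R + R * d"
    using assms by (intro add_mono mult_mono) (auto intro: order_trans[OF norm_ge_zero])
  finally show ?thesis
    by (simp add: mult_ac)
qed

text \<open>A violated inequality persists on small neighbourhoods of the points \<open>z i\<close>,
  which have positive measure because these points lie in the support.
  \<open>cyclic_improvement\<close> would then produce a better plan.\<close>

lemma optimal_cyclically_monotone:
  assumes opt: "optimal_plan mu \<nu> \<gamma>" and k: "0 < (k :: nat)" and s: "bij_betw s {..<k} {..<k}"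
    and z: "\<And>i. i < k \<Longrightarrow> z i \<in> supp \<gamma>"
  shows "(\<Sum>i<k. fst (z i) \<bullet> snd (z (s i))) \<le> (\<Sum>i<k. fst (z i) \<bullet> snd (z i))"
proof (rule ccontr)
  define g where "g = (\<Sum>i<k. fst (z i) \<bullet> snd (z (s i))) - (\<Sum>i<k. fst (z i) \<bullet> snd (z i))"
  assume "\<not> ?thesis"
  then have g: "g > 0"
    by (simp add: g_def)
  have plan: "transport_plan mu \<nu> \<gamma>"
    using opt by (simp add: optimal_plan_def)
  obtain R0 where R0: "\<And>x. x \<in> A \<union> B \<Longrightarrow> norm x \<le> R0"
    using compact_imp_bounded[OF compact_Un[OF A_compact B_compact]] unfolding bounded_iff by blast
  define R where "R = max R0 1"
  have R: "R \<ge> 1" "\<And>x. x \<in> A \<Longrightarrow> norm x \<le> R" "\<And>x. x \<in> B \<Longrightarrow> norm x \<le> R"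
    using R0 by (auto simp: R_def le_max_iff_disj)
  \<comment> \<open>Each pairing moves by at most \<open>\<eta>\<close>, so each of the two sums
    moves by at most \<open>g / 4\<close> and a gain of \<open>g / 2\<close> remains. By
    \<open>inner_close\<close>, \<open>\<delta>\<close> is the radius achieving this.\<close>
  define \<eta> where "\<eta> = g / (4 * real k)"
  define \<delta> where "\<delta> = \<eta> / (2 * R)"
  have \<eta>: "\<eta> > 0" "real k * \<eta> = g / 4"
    using g k by (auto simp: \<eta>_def)
  have \<delta>: "\<delta> > 0" "2 * R * \<delta> = \<eta>"
    using \<eta> R(1) by (auto simp: \<delta>_def)
  have sk: "s i < k" if "i < k" for i
    using s that by (auto simp: bij_betw_def)
  have zAB: "fst (z i) \<in> A" "snd (z i) \<in> B" if "i < k" for i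
    using z[OF that] by (auto simp: supp_def)
  define W where "W i = ball (z i) \<delta> \<inter> (A \<times> B)" for i
  have close: "\<bar>fst w \<bullet> snd w' - fst (z i) \<bullet> snd (z j)\<bar> \<le> \<eta>"
    if "i < k" "j < k" "w \<in> W i" "w' \<in> W j" for i j w w'
  proof -
    have "dist (fst (z i)) (fst w) \<le> \<delta>" "dist (snd (z j)) (snd w') \<le> \<delta>"
      using that dist_fst_le[of "z i" w] dist_snd_le[of "z j" w'] by (auto simp: W_def)
    then have "norm (fst w - fst (z i)) \<le> \<delta>" "norm (snd w' - snd (z j)) \<le> \<delta>"
      by (simp_all add: dist_norm norm_minus_commute)
    moreover have "norm (snd w') \<le> R" "norm (fst (z i)) \<le> R"
      using R zAB that by (auto simp: W_def)
    ultimately show ?thesis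
      using inner_close[of "snd w'" R "fst (z i)" "fst w" \<delta> "snd (z j)"] \<delta>(2) by simp
  qed
  \<comment> \<open>The shift by \<open>R * R\<close> makes the cost non-negative for the extended
    integral; plans have equal mass, so comparisons between them are unaffected.\<close>
  define c where "c w = fst w \<bullet> snd w + R * R" for w :: "(real ^ 'n) \<times> (real ^ 'n)"
  have c0: "0 \<le> c w" if "w \<in> A \<times> B" for w
  proof -
    have "\<bar>fst w \<bullet> snd w\<bar> \<le> norm (fst w) * norm (snd w)"
      by (rule Cauchy_Schwarz_ineq2)
    also have "\<dots> \<le> R * R"
      using R that by (intro mult_mono) auto
    finally show ?thesis
      by (simp add: c_def)
  qed
  have cc: "continuous_on (A \<times> B) c"
    unfolding c_def by (intro continuous_intros)
  have nn: "(\<integral>\<^sup>+w. ennreal (c w) \<partial>\<gamma>') = ennreal ((\<integral>w. fst w \<bullet> snd w \<partial>\<gamma>') + R * R * measure mu A)"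
    if plan': "transport_plan mu \<nu> \<gamma>'" for \<gamma>'
  proof -
    interpret finite_measure \<gamma>'
      using plan_finite[OF plan'] .
    have "(\<integral>\<^sup>+w. ennreal (c w) \<partial>\<gamma>') = ennreal (\<integral>w. c w \<partial>\<gamma>')"
      using c0 planD(4)[OF plan'] by (intro nn_integral_eq_integral integrable_plan[OF plan' cc] AE_I2) auto
    also have "(\<integral>w. c w \<partial>\<gamma>') = (\<integral>w. fst w \<bullet> snd w \<partial>\<gamma>') + R * R * measure \<gamma>' (space \<gamma>')"
      unfolding c_def using integrable_plan[OF plan' continuous_cost] by simp
    finally show ?thesis
      using plan_mass[OF plan'] by (simp add: measure_def)
  qed
  have C_meas: "(\<lambda>w. ennreal (c w)) \<in> borel_measurable \<gamma>"
    using borel_measurable_continuous_on_restrict[OF cc] planD(1)[OF plan]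
    by (simp cong: measurable_cong_sets)
  obtain \<gamma>' where \<gamma>': "sets \<gamma>' = sets \<gamma>"
    "\<And>X. X \<times> B \<in> sets \<gamma> \<Longrightarrow> emeasure \<gamma>' (X \<times> B) = emeasure \<gamma> (X \<times> B)"
    "\<And>Y. A \<times> Y \<in> sets \<gamma> \<Longrightarrow> emeasure \<gamma>' (A \<times> Y) = emeasure \<gamma> (A \<times> Y)"
    "(\<integral>\<^sup>+w. ennreal (c w) \<partial>\<gamma>) < (\<integral>\<^sup>+w. ennreal (c w) \<partial>\<gamma>')"
  proof (rule cyclic_improvement[OF planD(1)[OF plan] plan_finite[OF plan] C_meas _ k s, of W "ennreal (g / 2)"])
    show "(\<integral>\<^sup>+w. ennreal (c w) \<partial>\<gamma>) < \<infinity>"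
      unfolding nn[OF plan] by simp
    show "W i \<in> sets \<gamma>" for i
      unfolding W_def by (rule plan_open_sets[OF plan open_ball])
    show "emeasure \<gamma> (W i) > 0" if "i < k" for i
      using z[OF that] \<delta>(1) unfolding supp_def W_def by auto
    show "ennreal (g / 2) > 0"
      using g by simp
    fix w assume w: "\<And>i. i < k \<Longrightarrow> w i \<in> W i"
    have wAB: "w i \<in> A \<times> B" "(fst (w i), snd (w (s i))) \<in> A \<times> B" if "i < k" for i
      using w[OF that] w[OF sk[OF that]] by (auto simp: W_def)
    have "(\<Sum>i<k. c (w i)) \<le> (\<Sum>i<k. fst (z i) \<bullet> snd (z i) + \<eta> + R * R)"
    proof (rule sum_mono)
      fix i assume "i \<in> {..<k}"
      then show "c (w i) \<le> fst (z i) \<bullet> snd (z i) + \<eta> + R * R"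
        using close[of i i "w i" "w i"] w[of i] by (auto simp: c_def)
    qed
    moreover have "(\<Sum>i<k. fst (z i) \<bullet> snd (z (s i)) - \<eta> + R * R) \<le> (\<Sum>i<k. c (fst (w i), snd (w (s i))))"
    proof (rule sum_mono)
      fix i assume "i \<in> {..<k}"
      then show "fst (z i) \<bullet> snd (z (s i)) - \<eta> + R * R \<le> c (fst (w i), snd (w (s i)))"
        using close[of i "s i" "w i" "w (s i)"] w[of i] w[of "s i"] sk[of i] by (auto simp: c_def)
    qed
    moreover have "(\<Sum>i<k. fst (z i) \<bullet> snd (z i) + \<eta> + R * R) = (\<Sum>i<k. fst (z i) \<bullet> snd (z i)) + g / 4 + real k * (R * R)"
      "(\<Sum>i<k. fst (z i) \<bullet> snd (z (s i)) - \<eta> + R * R) = (\<Sum>i<k. fst (z i) \<bullet> snd (z (s i))) - g / 4 + real k * (R * R)"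
      using \<eta>(2) by (simp_all add: sum.distrib sum_subtractf)
    ultimately have "(\<Sum>i<k. c (w i)) + g / 2 \<le> (\<Sum>i<k. c (fst (w i), snd (w (s i))))"
      using g_def by linarith
    then have "ennreal ((\<Sum>i<k. c (w i)) + g / 2) \<le> ennreal (\<Sum>i<k. c (fst (w i), snd (w (s i))))"
      by (rule ennreal_leI)
    moreover have "0 \<le> (\<Sum>i<k. c (w i))"
      using c0 wAB by (intro sum_nonneg) auto
    ultimately show "(\<Sum>i<k. ennreal (c (w i))) + ennreal (g / 2)
        \<le> (\<Sum>i<k. ennreal (c (fst (w i), snd (w (s i)))))"
      using c0 wAB g by (subst (1 2) sum_ennreal) (auto simp: ennreal_plus)
  qed blast
  have sets': "sets \<gamma>' = sets (restrict_space borel (A \<times> B))"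
    using \<gamma>'(1) planD(1)[OF plan] by simp
  note m' = plan_measurable[OF sets']
  have "distr \<gamma>' mu fst = mu"
  proof (rule measure_eqI)
    fix X assume "X \<in> sets (distr \<gamma>' mu fst)"
    then have X: "X \<in> sets mu" "X \<subseteq> A"
      using sets_mu_iff by auto
    have v: "fst -` X \<inter> (A \<times> B) = X \<times> B"
      using X(2) by auto
    have "X \<times> B \<in> sets \<gamma>"
      using measurable_sets[OF planD(5)[OF plan] X(1)] unfolding planD(4)[OF plan] v .
    then have "emeasure (distr \<gamma>' mu fst) X = emeasure (distr \<gamma> mu fst) X"
      using \<gamma>'(2) X(1) m' planD(4,5)[OF plan] v by (simp add: emeasure_distr)
    then show "emeasure (distr \<gamma>' mu fst) X = emeasure mu X"
      using planD(2)[OF plan] by simp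
  qed simp
  moreover have "distr \<gamma>' \<nu> snd = \<nu>"
  proof (rule measure_eqI)
    fix Y assume "Y \<in> sets (distr \<gamma>' \<nu> snd)"
    then have Y: "Y \<in> sets \<nu>" "Y \<subseteq> B"
      using sets_nu_iff by auto
    have v: "snd -` Y \<inter> (A \<times> B) = A \<times> Y"
      using Y(2) by auto
    have "A \<times> Y \<in> sets \<gamma>"
      using measurable_sets[OF planD(6)[OF plan] Y(1)] unfolding planD(4)[OF plan] v .
    then have "emeasure (distr \<gamma>' \<nu> snd) Y = emeasure (distr \<gamma> \<nu> snd) Y"
      using \<gamma>'(3) Y(1) m' planD(4,6)[OF plan] v by (simp add: emeasure_distr)
    then show "emeasure (distr \<gamma>' \<nu> snd) Y = emeasure \<nu> Y"
      using planD(3)[OF plan] by simp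
  qed simp
  ultimately have plan': "transport_plan mu \<nu> \<gamma>'"
    unfolding transport_plan_def space_mu space_nu using sets' by blast
  then have "(\<integral>w. fst w \<bullet> snd w \<partial>\<gamma>') \<le> (\<integral>w. fst w \<bullet> snd w \<partial>\<gamma>)"
    using opt by (auto simp: optimal_plan_def)
  then have "(\<integral>\<^sup>+w. ennreal (c w) \<partial>\<gamma>') \<le> (\<integral>\<^sup>+w. ennreal (c w) \<partial>\<gamma>)"
    unfolding nn[OF plan] nn[OF plan'] by (intro ennreal_leI) simp
  then show False
    using \<gamma>'(4) by simp
qed

text \<open>The potential \<open>\<Psi>0\<close> built from the support attains the dual value on
  \<open>\<gamma>\<close>. A maximiser of \<open>J\<close> has a dual value at most as large, hence
  attains it as well, and equality forces contact almost everywhere.\<close>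

lemma optimal_contact_potential:
  assumes "optimal_plan mu \<nu> \<gamma>" "kantorovich_potential \<Delta> h b \<nu> \<Psi>"
  shows "AE z in \<gamma>. con \<Psi> (fst z) (snd z)"
proof (cases "supp \<gamma> = {}")
  case True
  have plan: "transport_plan mu \<nu> \<gamma>"
    using assms(1) by (simp add: optimal_plan_def)
  show ?thesis
    using AE_supp[OF plan] by eventually_elim (simp add: True)
next
  case False
  have plan: "transport_plan mu \<nu> \<gamma>"
    using assms(1) by (simp add: optimal_plan_def)
  obtain R where R: "\<And>n. n \<in> B \<Longrightarrow> norm n \<le> R"
    using compact_imp_bounded[OF B_compact] unfolding bounded_iff by blast
  obtain \<Phi> where \<Phi>: "continuous_on UNIV \<Phi>"
    "\<And>x y m. (x, y) \<in> supp \<gamma> \<Longrightarrow> \<Phi> x + (m - x) \<bullet> y \<le> \<Phi> m"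
  proof (rule cyclically_monotone_potential[OF False])
    show "(\<Sum>i<k. fst (z i) \<bullet> snd (z (s i))) \<le> (\<Sum>i<k. fst (z i) \<bullet> snd (z i))"
      if "0 < k" "bij_betw s {..<k} {..<k}" "\<And>i. i < k \<Longrightarrow> z i \<in> supp \<gamma>" for k :: nat and z s
      using optimal_cyclically_monotone[OF assms(1) that] .
    show "norm y \<le> R" if "(x, y) \<in> supp \<gamma>" for x y
      using that R by (auto simp: supp_def)
  qed blast
  have cont: "continuous_on A \<Phi>"
    using \<Phi>(1) continuous_on_subset by blast
  define \<Psi>0 where "\<Psi>0 = c_transform A \<Phi>"
  have conv: "c_convex_B \<Delta> h \<Psi>0"
    unfolding c_convex_B_def \<Psi>0_def using cont by blast
  have con: "con \<Psi>0 x y" if xy: "(x, y) \<in> supp \<gamma>" for x y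
    unfolding con_def
  proof (intro conjI ballI)
    have xA: "x \<in> A" and yB: "y \<in> B"
      using xy by (auto simp: supp_def)
    show "y \<in> B" by fact
    have "\<Psi>0 y = y \<bullet> x - \<Phi> x"
      unfolding \<Psi>0_def using \<Phi>(2)[OF xy]
      by (intro c_transform_eqI xA) (simp add: inner_diff_left inner_commute algebra_simps)
    moreover fix n' assume "n' \<in> B"
    have "n' \<bullet> x - \<Phi> x \<le> \<Psi>0 n'"
      unfolding \<Psi>0_def by (rule c_transform_ge[OF A_compact cont xA])
    ultimately show "\<Psi>0 y + x \<bullet> (n' - y) \<le> \<Psi>0 n'"
      by (simp add: inner_diff_right inner_commute)
  qed
  have "AE z in \<gamma>. con \<Psi>0 (fst z) (snd z)"
    using AE_supp[OF plan] by eventually_elim (use con in auto)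
  then have "(\<integral>z. fst z \<bullet> snd z \<partial>\<gamma>) = dual_value \<Psi>0"
    using plan_duality(2)[OF plan adm_c_convex[OF conv]] by blast
  moreover have "dual_value \<Psi> \<le> dual_value \<Psi>0"
    using assms(2) conv unfolding kantorovich_potential_def kantorovich_J_def by force
  moreover have "adm \<Psi>"
    using assms(2) adm_c_convex unfolding kantorovich_potential_def by blast
  ultimately show ?thesis
    using plan_duality[OF plan, of \<Psi>] by auto
qed

section \<open>Plans supported on the stars\<close>

lemma T_transport_measurable: "adm \<Psi> \<Longrightarrow> T \<Psi> \<in> measurable mu \<nu>"
proof -
  assume adm: "adm \<Psi>"
  have "T \<Psi> \<in> measurable (restrict_space borel A) (restrict_space borel B)"
    using T_measurable[OF adm] T_in_B[OF adm]
    by (intro measurable_restrict_space2 measurable_restrict_space1) auto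
  then show ?thesis
    using sets_mu nu_sets by (simp cong: measurable_cong_sets)
qed

lemma AE_not_bad: "adm \<Psi> \<Longrightarrow> AE m in mu. m \<notin> bad \<Psi>"
  using bad_fsigma emeasure_mu_bad by (intro AE_not_in) (auto simp: null_sets_def sets_mu_iff)

lemma emeasure_distr_T:
  assumes "adm \<Psi>" "E \<in> sets \<nu>"
  shows "emeasure (distr mu \<nu> (T \<Psi>)) E = emeasure mu (pull \<Psi> E)"
proof -
  have E: "E \<in> sets borel"
    using assms(2) sets_nu_iff by blast
  have "emeasure (distr mu \<nu> (T \<Psi>)) E = emeasure mu (T \<Psi> -` E \<inter> space mu)"
    by (rule emeasure_distr[OF T_transport_measurable[OF assms(1)] assms(2)])
  also have "\<dots> = emeasure mu (pull \<Psi> E)"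
  proof (rule emeasure_eq_AE)
    show "AE m in mu. (m \<in> T \<Psi> -` E \<inter> space mu) = (m \<in> pull \<Psi> E)"
      using AE_not_bad[OF assms(1)] AE_space
      by eventually_elim (auto simp: pull_def space_mu)
    show "T \<Psi> -` E \<inter> space mu \<in> sets mu"
      by (rule measurable_sets[OF T_transport_measurable[OF assms(1)] assms(2)])
    show "pull \<Psi> E \<in> sets mu"
      using pull_borel[OF assms(1) E] by (auto simp: sets_mu_iff)
  qed
  finally show ?thesis .
qed

lemma distr_T_if_plan:
  assumes plan: "transport_plan mu \<nu> \<gamma>" and adm: "adm \<Psi>"
    and rel: "AE z in \<gamma>. rel \<Psi> (fst z) (snd z)"
  shows "distr mu \<nu> (T \<Psi>) = \<nu>"
proof (rule measure_eqI)
  fix E assume "E \<in> sets (distr mu \<nu> (T \<Psi>))"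
  then have E: "E \<in> sets \<nu>"
    by simp
  have "AE m in distr \<gamma> mu fst. m \<notin> bad \<Psi>"
    unfolding planD(2)[OF plan] by (rule AE_not_bad[OF adm])
  then have "AE z in \<gamma>. fst z \<notin> bad \<Psi>"
    by (rule AE_distrD[OF planD(5)[OF plan]])
  then have "AE z in \<gamma>. (z \<in> fst -` pull \<Psi> E \<inter> space \<gamma>) = (z \<in> snd -` E \<inter> space \<gamma>)"
    using rel AE_space
  proof eventually_elim
    case (elim z)
    then have "fst z \<in> A - bad \<Psi>"
      unfolding planD(4)[OF plan] by auto
    then have "snd z = T \<Psi> (fst z)"
      using rel_iff_T[OF adm] elim(2) by blast
    then show ?case
      using \<open>fst z \<in> A - bad \<Psi>\<close> elim(3) by (simp add: pull_def)
  qed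
  moreover have p: "pull \<Psi> E \<in> sets mu"
    using pull_borel[OF adm, of E] E by (auto simp: sets_mu_iff sets_nu_iff)
  ultimately have "emeasure \<gamma> (fst -` pull \<Psi> E \<inter> space \<gamma>) = emeasure \<gamma> (snd -` E \<inter> space \<gamma>)"
    using measurable_sets[OF planD(5)[OF plan] p] measurable_sets[OF planD(6)[OF plan] E]
    by (intro emeasure_eq_AE) auto
  then have "emeasure (distr \<gamma> mu fst) (pull \<Psi> E) = emeasure (distr \<gamma> \<nu> snd) E"
    by (simp add: emeasure_distr[OF planD(5)[OF plan] p] emeasure_distr[OF planD(6)[OF plan] E])
  then show "emeasure (distr mu \<nu> (T \<Psi>)) E = emeasure \<nu> E"
    unfolding planD(2,3)[OF plan] emeasure_distr_T[OF adm E] .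
qed simp

lemma plan_if_distr_T:
  assumes adm: "adm \<Psi>" and eq: "distr mu \<nu> (T \<Psi>) = \<nu>"
  obtains \<gamma> where "transport_plan mu \<nu> \<gamma>" "AE z in \<gamma>. rel \<Psi> (fst z) (snd z)"
    "AE z in \<gamma>. snd z = T \<Psi> (fst z)"
proof -
  define N where "N = restrict_space borel (A \<times> B)"
  define \<gamma> where "\<gamma> = distr mu N (\<lambda>m. (m, T \<Psi> m))"
  have "(\<lambda>m. (m, T \<Psi> m)) \<in> borel_measurable borel"
    using T_measurable[OF adm] by (intro borel_measurable_Pair) auto
  then have "(\<lambda>m. (m, T \<Psi> m)) \<in> measurable (restrict_space borel A) N"
    unfolding N_def using T_in_B[OF adm]
    by (intro measurable_restrict_space2 measurable_restrict_space1) (auto simp: space_restrict_space)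
  then have meas: "(\<lambda>m. (m, T \<Psi> m)) \<in> measurable mu N"
    using sets_mu by (simp cong: measurable_cong_sets)
  have s\<gamma>: "sets \<gamma> = sets (restrict_space borel (A \<times> B))"
    by (simp add: \<gamma>_def N_def)
  note m = plan_measurable[OF s\<gamma>]
  have mN: "fst \<in> measurable N mu" "snd \<in> measurable N \<nu>"
    using m s\<gamma> by (simp_all add: N_def cong: measurable_cong_sets)
  have "distr \<gamma> mu fst = distr mu mu (\<lambda>m. m)"
    unfolding \<gamma>_def using mN meas by (subst distr_distr) (auto simp: o_def)
  moreover have "distr \<gamma> \<nu> snd = distr mu \<nu> (T \<Psi>)"
    unfolding \<gamma>_def using mN meas by (subst distr_distr) (auto simp: o_def)
  ultimately have plan: "transport_plan mu \<nu> \<gamma>"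
    unfolding transport_plan_def space_mu space_nu using s\<gamma> eq by (simp add: distr_id2)
  have graph: "AE z in \<gamma>. P z" if "AE m in mu. P (m, T \<Psi> m)" "{z \<in> space N. P z} \<in> sets N" for P
    unfolding \<gamma>_def using that by (subst AE_distr_iff[OF meas]) auto
  have sN: "E \<in> sets N \<longleftrightarrow> E \<in> sets borel \<and> E \<subseteq> A \<times> B" for E
    unfolding N_def by (rule sets_restrict_borel_iff[OF AB_borel])
  have spN: "space N = A \<times> B"
    by (simp add: N_def space_restrict_space)
  have "AE z in \<gamma>. rel \<Psi> (fst z) (snd z)"
  proof (rule graph)
    show "AE m in mu. rel \<Psi> (fst (m, T \<Psi> m)) (snd (m, T \<Psi> m))"
      using AE_not_bad[OF adm] AE_space
      by eventually_elim (auto simp: space_mu intro: rel_T[OF adm])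
    have "compact {(m, n). rel \<Psi> m n \<and> n \<in> UNIV}"
      by (rule rel_compact[OF adm closed_UNIV])
    then have "{(m, n). rel \<Psi> m n \<and> n \<in> UNIV} \<in> sets borel"
      by (rule borel_compact)
    moreover have "{(m, n). rel \<Psi> m n \<and> n \<in> UNIV} = {z \<in> space N. rel \<Psi> (fst z) (snd z)}"
      unfolding spN using support_set_subset by (fastforce simp: rel_def)
    ultimately show "{z \<in> space N. rel \<Psi> (fst z) (snd z)} \<in> sets N"
      unfolding sN spN by auto
  qed
  moreover have "AE z in \<gamma>. snd z = T \<Psi> (fst z)"
  proof (rule graph)
    have "(\<lambda>z. T \<Psi> (fst z)) \<in> borel_measurable borel"
      by (rule measurable_compose[OF borel_measurable_continuous_onI[OF continuous_on_fst[OF continuous_on_id]] T_measurable[OF adm]])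
    moreover have "(\<lambda>z :: (real ^ 'n) \<times> (real ^ 'n). snd z) \<in> borel_measurable borel"
      by (intro borel_measurable_continuous_onI continuous_on_snd continuous_on_id)
    ultimately have "{z \<in> space borel. snd z = T \<Psi> (fst z)} \<in> sets borel"
      by measurable
    moreover have "{z \<in> space N. snd z = T \<Psi> (fst z)} = {z \<in> space borel. snd z = T \<Psi> (fst z)} \<inter> (A \<times> B)"
      unfolding spN by auto
    ultimately show "{z \<in> space N. snd z = T \<Psi> (fst z)} \<in> sets N"
      unfolding sN using AB_borel by auto
  qed simp
  ultimately show ?thesis
    using that plan by blast
qed

section \<open>Uniqueness\<close>

text \<open>A chart domain without interior would lie in a hyperplane, leaving the facet with
  dimension below \<open>d\<close>.\<close>

lemma facet_chart_full:
  assumes "\<sigma> facet_of \<Delta>"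
  shows "interior (chart \<sigma> -` \<sigma>) \<noteq> {}" "convex (chart \<sigma> -` \<sigma>)"
proof -
  let ?p = "SOME p. p \<in> \<sigma>"
  have eq: "chart \<sigma> = (\<lambda>x. ?p + x) \<circ> comb \<sigma>"
    by (auto simp: chart_eq)
  have "chart \<sigma> -` \<sigma> = comb \<sigma> -` ((\<lambda>x. - ?p + x) ` \<sigma>)"
    by (auto simp: chart_eq image_iff algebra_simps)
  then show conv: "convex (chart \<sigma> -` \<sigma>)"
    using convex_linear_vimage[OF linear_comb] convex_translation[OF facet_convex[OF assms]] by metis
  have surj: "chart \<sigma> ` (chart \<sigma> -` \<sigma>) = \<sigma>"
  proof
    show "\<sigma> \<subseteq> chart \<sigma> ` (chart \<sigma> -` \<sigma>)"
    proof
      fix x assume x: "x \<in> \<sigma>"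
      obtain y where "chart \<sigma> y = x"
        using chart_surj[OF assms ns_inner_facet[OF assms x]] .
      then show "x \<in> chart \<sigma> ` (chart \<sigma> -` \<sigma>)"
        using x by blast
    qed
  qed blast
  show "interior (chart \<sigma> -` \<sigma>) \<noteq> {}"
  proof
    assume "interior (chart \<sigma> -` \<sigma>) = {}"
    then obtain a c where a: "a \<noteq> 0" "chart \<sigma> -` \<sigma> \<subseteq> {y. a \<bullet> y = c}"
      using empty_interior_subset_hyperplane[OF conv] by metis
    have "aff_dim \<sigma> = aff_dim ((\<lambda>x. ?p + x) ` comb \<sigma> ` (chart \<sigma> -` \<sigma>))"
      using surj unfolding eq image_comp by simp
    also have "\<dots> = aff_dim (comb \<sigma> ` (chart \<sigma> -` \<sigma>))"
      by (rule aff_dim_translation_eq)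
    also have "\<dots> \<le> aff_dim (chart \<sigma> -` \<sigma>)"
      by (rule aff_dim_linear_image_le[OF linear_comb])
    also have "\<dots> \<le> aff_dim {y. a \<bullet> y = c}"
      by (rule aff_dim_subset[OF a(2)])
    also have "\<dots> = int CARD('k) - 1"
      using a(1) by (simp add: of_nat_diff)
    finally have "aff_dim \<sigma> \<le> int CARD('k) - 1" .
    moreover have "aff_dim \<Delta> = int CARD('n)"
      using aff_dim_nonempty_interior[of \<Delta>] zero_interior by auto
    ultimately show False
      using assms dim by (simp add: facet_of_def)
  qed
qed

lemma compact_common_contact:
  assumes "adm \<Psi>" "adm \<Psi>'"
  shows "compact {m \<in> A. \<exists>n. con \<Psi> m n \<and> con \<Psi>' m n}"
proof -
  have cont: "continuous_on B \<Psi>" "continuous_on B \<Psi>'"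
    using assms by (auto simp: adm_def)
  have eq: "{m \<in> A. \<exists>n. con \<Psi> m n \<and> con \<Psi>' m n}
      = fst ` ({(m, n). m \<in> A \<and> con \<Psi> m n} \<inter> {(m, n). con \<Psi>' m n})"
    by force
  show ?thesis
    unfolding eq
    by (intro compact_continuous_image continuous_on_fst continuous_on_id compact_Int_closed
        compact_con[OF cont(1) A_compact] closed_con[OF cont(2)])
qed

text \<open>The set of such \<open>m\<close> is compact. In the interior of a chart domain its
  complement is open and null, hence empty; the facet is the closure of that interior.\<close>

lemma common_contact_everywhere:
  assumes adm: "adm \<Psi>" "adm \<Psi>'" and ae: "AE m in mu. \<exists>n. con \<Psi> m n \<and> con \<Psi>' m n" and m: "m \<in> A"
  obtains n where "con \<Psi> m n" "con \<Psi>' m n"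
proof -
  define S where "S = {m \<in> A. \<exists>n. con \<Psi> m n \<and> con \<Psi>' m n}"
  have S: "compact S"
    unfolding S_def by (rule compact_common_contact[OF adm])
  have AS: "A - S \<in> sets borel" "A - S \<subseteq> A"
    using A_borel borel_compact[OF S] by auto
  have "AE m in mu. m \<notin> A - S"
    using ae by eventually_elim (auto simp: S_def)
  have meas: "A - S \<in> sets mu"
    using AS by (simp add: sets_mu_iff)
  have eq: "{m \<in> space mu. \<not> m \<notin> A - S} = A - S"
    unfolding space_mu by blast
  have "emeasure mu (A - S) = 0"
    using AE_iff_measurable[OF meas eq] \<open>AE m in mu. m \<notin> A - S\<close> by blast
  then have null: "emeasure lborel (chart \<sigma> -` ((A - S) \<inter> \<sigma>)) = 0" if "\<sigma> facet_of \<Delta>" for \<sigma>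
    using that finite_facets unfolding emeasure_mu[OF AS] by (simp add: sum_eq_0_iff)
  obtain \<sigma> where \<sigma>: "\<sigma> facet_of \<Delta>" "m \<in> \<sigma>"
    using A_facetE[OF m] .
  define Y where "Y = chart \<sigma> -` \<sigma>"
  have clS: "closed (chart \<sigma> -` S)"
    by (rule closed_chart_vimage[OF compact_imp_closed[OF S]])
  have "negligible (chart \<sigma> -` ((A - S) \<inter> \<sigma>))"
    using null[OF \<sigma>(1)] emeasure_chart_part[OF \<sigma>(1) AS(1)] chart_part_lmeasurable[OF \<sigma>(1) AS(1)]
    by (auto simp: negligible_iff_null_sets null_sets_def fmeasurable_def)
  moreover have "interior Y - chart \<sigma> -` S \<subseteq> chart \<sigma> -` ((A - S) \<inter> \<sigma>)"
    using interior_subset[of Y] facet_subset_A[OF \<sigma>(1)] unfolding Y_def by auto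
  ultimately have "negligible (interior Y - chart \<sigma> -` S)"
    by (rule negligible_subset)
  moreover have "open (interior Y - chart \<sigma> -` S)"
    using clS by (intro open_Diff open_interior)
  ultimately have "interior Y \<subseteq> chart \<sigma> -` S"
    using open_not_negligible by blast
  then have "closure (interior Y) \<subseteq> chart \<sigma> -` S"
    using clS by (rule closure_minimal)
  moreover have "closure (interior Y) = closure Y"
    unfolding Y_def using facet_chart_full[OF \<sigma>(1)] by (intro convex_closure_interior)
  moreover obtain y where "chart \<sigma> y = m"
    using chart_surj[OF \<sigma>(1) ns_inner_facet[OF \<sigma>]] .
  ultimately have "m \<in> S"
    using \<sigma>(2) closure_subset[of Y] unfolding Y_def by auto
  then show ?thesis
    using that unfolding S_def by blast
qed

text \<open>Avoids differentiating: the segment is divided into equal steps. Common subgradients at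
  both ends of a step control the difference of increments by the change of \<open>p\<close>, and
  telescoping leaves an error of order \<open>1 / (N + 1)\<close>.\<close>

lemma common_subgradients_increment:
  fixes f g :: "'a::real_inner \<Rightarrow> real"
  assumes "convex S" "x \<in> S" "y \<in> S"
    and "\<And>x. x \<in> S \<Longrightarrow> \<exists>p. norm p \<le> K \<and>
      (\<forall>y\<in>S. f x + p \<bullet> (y - x) \<le> f y \<and> g x + p \<bullet> (y - x) \<le> g y)"
  shows "f y - f x \<le> g y - g x"
proof -
  obtain p where p: "\<And>x. x \<in> S \<Longrightarrow> norm (p x) \<le> K"
    "\<And>x y. x \<in> S \<Longrightarrow> y \<in> S \<Longrightarrow> f x + p x \<bullet> (y - x) \<le> f y"
    "\<And>x y. x \<in> S \<Longrightarrow> y \<in> S \<Longrightarrow> g x + p x \<bullet> (y - x) \<le> g y"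
    using assms(4) by metis
  have bound: "(f y - f x) - (g y - g x) \<le> 2 * K * norm (y - x) * inverse (real (Suc N))" for N
  proof -
    let ?M = "Suc N"
    define c where "c i = x + (real i / real ?M) *\<^sub>R (y - x)" for i
    define d where "d = inverse (real ?M) *\<^sub>R (y - x)"
    have cS: "c i \<in> S" if "i \<le> ?M" for i
    proof -
      have "c i = (1 - real i / real ?M) *\<^sub>R x + (real i / real ?M) *\<^sub>R y"
        by (simp add: c_def algebra_simps)
      then show ?thesis
        using assms(1-3) that by (auto intro!: convexD)
    qed
    have step: "c (Suc i) - c i = d" for i
    proof -
      have "c (Suc i) - c i = (real (Suc i) / real ?M - real i / real ?M) *\<^sub>R (y - x)"
        by (simp add: c_def scaleR_diff_left)
      also have "real (Suc i) / real ?M - real i / real ?M = inverse (real ?M)"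
        by (simp add: field_simps)
      finally show ?thesis
        by (simp add: d_def)
    qed
    \<comment> \<open>The increment of \<open>f\<close> is bounded above with the slope at the far
      end, that of \<open>g\<close> below with the slope at the near end.\<close>
    have "(f (c (Suc i)) - f (c i)) - (g (c (Suc i)) - g (c i)) \<le> (p (c (Suc i)) - p (c i)) \<bullet> d"
      if "i < ?M" for i
    proof -
      have c: "c i \<in> S" "c (Suc i) \<in> S"
        using cS that by auto
      have "c i - c (Suc i) = - d"
        using step[of i] by (simp add: algebra_simps)
      then show ?thesis
        using p(2)[OF c(2,1)] p(3)[OF c] step[of i] by (simp add: inner_diff_left)
    qed
    then have "(\<Sum>i<?M. (f (c (Suc i)) - f (c i)) - (g (c (Suc i)) - g (c i)))
        \<le> (\<Sum>i<?M. (p (c (Suc i)) - p (c i)) \<bullet> d)"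
      by (intro sum_mono) auto
    also have "\<dots> = (p (c ?M) - p (c 0)) \<bullet> d"
      by (simp only: inner_sum_left[symmetric] sum_lessThan_telescope[of "\<lambda>i. p (c i)"])
    also have "\<dots> \<le> norm (p (c ?M) - p (c 0)) * norm d"
      by (rule norm_cauchy_schwarz)
    also have "\<dots> \<le> (2 * K) * norm d"
    proof (rule mult_right_mono)
      have "norm (p (c ?M)) \<le> K" "norm (p (c 0)) \<le> K"
        using p(1) cS by simp_all
      then show "norm (p (c ?M) - p (c 0)) \<le> 2 * K"
        using norm_triangle_ineq4[of "p (c ?M)" "p (c 0)"] by linarith
    qed simp
    finally have "(\<Sum>i<?M. f (c (Suc i)) - f (c i)) - (\<Sum>i<?M. g (c (Suc i)) - g (c i)) \<le> 2 * K * norm d"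
      by (simp only: sum_subtractf)
    then have "(f (c ?M) - f (c 0)) - (g (c ?M) - g (c 0)) \<le> 2 * K * norm d"
      by (simp only: sum_lessThan_telescope[of "\<lambda>i. f (c i)"] sum_lessThan_telescope[of "\<lambda>i. g (c i)"])
    moreover have "c ?M = y" "c 0 = x"
      by (simp_all add: c_def)
    moreover have "norm d = norm (y - x) * inverse (real ?M)"
      by (simp add: d_def)
    ultimately show ?thesis
      by (simp add: mult.assoc)
  qed
  have "(\<lambda>N. 2 * K * norm (y - x) * inverse (real (Suc N))) \<longlonglongrightarrow> 2 * K * norm (y - x) * 0"
    by (intro tendsto_intros LIMSEQ_inverse_real_of_nat)
  then have "(f y - f x) - (g y - g x) \<le> 2 * K * norm (y - x) * 0"
    by (rule LIMSEQ_le_const) (use bound in blast)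
  then show ?thesis
    by simp
qed

text \<open>The boundary of a convex body is connected unless the body is a segment;
  \<open>dim\<close> gives dimension at least 2.\<close>

lemma A_connected: "connected A"
proof -
  have "aff_dim \<Delta> = int CARD('n)"
    using aff_dim_nonempty_interior[of \<Delta>] zero_interior by auto
  then have "aff_dim \<Delta> \<noteq> 1"
    using dim by simp
  then have "connected (rel_frontier \<Delta>)"
    using path_connected_sphere_gen[OF Delta_convex compact_imp_bounded[OF Delta_compact]]
      path_connected_imp_connected by blast
  moreover have "rel_frontier \<Delta> = A"
    unfolding bdA_def by (rule rel_frontier_nonempty_interior) (use zero_interior in blast)
  ultimately show ?thesis
    by simp
qed

text \<open>Common contact points are common subgradients of the two transforms, so the transforms
  differ by a constant on each facet. The difference is thus continuous with finitely many values on
  a connected set.\<close>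

lemma potentials_differ_by_constant:
  assumes adm: "adm \<Psi>" "adm \<Psi>'" and ae: "AE m in mu. \<exists>n. con \<Psi> m n \<and> con \<Psi>' m n"
  obtains c where "\<And>n. n \<in> B \<Longrightarrow> \<Psi> n - \<Psi>' n = c"
proof -
  define u where "u m = c_transform B \<Psi> m - c_transform B \<Psi>' m" for m
  have cont: "continuous_on B \<Psi>" "continuous_on B \<Psi>'"
    using adm by (auto simp: adm_def)
  obtain R where R: "\<And>n. n \<in> B \<Longrightarrow> norm n \<le> R"
    using compact_imp_bounded[OF B_compact] unfolding bounded_iff by blast
  have sub: "c_transform B \<Psi>1 m + n \<bullet> (m' - m) \<le> c_transform B \<Psi>1 m'"
    if "continuous_on B \<Psi>1" "con \<Psi>1 m n" for \<Psi>1 m m' n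
    using con_c_transform[OF that(2)] c_transform_ge[OF B_compact that(1) con_B[OF that(2)], of m']
    by (simp add: inner_diff_right inner_commute)
  have common: "\<exists>p. norm p \<le> R \<and> (\<forall>m'\<in>\<sigma>. c_transform B \<Psi> m + p \<bullet> (m' - m) \<le> c_transform B \<Psi> m' \<and>
      c_transform B \<Psi>' m + p \<bullet> (m' - m) \<le> c_transform B \<Psi>' m')"
    if \<sigma>: "\<sigma> facet_of \<Delta>" "m \<in> \<sigma>" for \<sigma> m
  proof -
    obtain n where "con \<Psi> m n" "con \<Psi>' m n"
      using common_contact_everywhere[OF adm ae] facet_subset_A \<sigma> by blast
    then show ?thesis
      using sub cont R con_B by blast
  qed
  have facet: "u m = u m'" if \<sigma>: "\<sigma> facet_of \<Delta>" and m: "m \<in> \<sigma>" "m' \<in> \<sigma>" for \<sigma> m m'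
  proof -
    have "c_transform B \<Psi> m' - c_transform B \<Psi> m \<le> c_transform B \<Psi>' m' - c_transform B \<Psi>' m"
      by (rule common_subgradients_increment[OF facet_convex[OF \<sigma>] m, of R]) (rule common[OF \<sigma>])
    moreover have "c_transform B \<Psi> m - c_transform B \<Psi> m' \<le> c_transform B \<Psi>' m - c_transform B \<Psi>' m'"
      by (rule common_subgradients_increment[OF facet_convex[OF \<sigma>] m(2,1), of R]) (rule common[OF \<sigma>])
    ultimately show ?thesis
      by (simp add: u_def)
  qed
  have "u ` A \<subseteq> (\<lambda>\<sigma>. u (SOME p. p \<in> \<sigma>)) ` {\<sigma>. \<sigma> facet_of \<Delta>}"
  proof
    fix t assume "t \<in> u ` A"
    then obtain m where m: "m \<in> A" "t = u m"
      by blast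
    obtain \<sigma> where \<sigma>: "\<sigma> facet_of \<Delta>" "m \<in> \<sigma>"
      using A_facetE[OF m(1)] .
    then have "t = u (SOME p. p \<in> \<sigma>)"
      using facet[OF \<sigma>(1) \<sigma>(2) chart_base[OF \<sigma>(1)]] m(2) by simp
    then show "t \<in> (\<lambda>\<sigma>. u (SOME p. p \<in> \<sigma>)) ` {\<sigma>. \<sigma> facet_of \<Delta>}"
      using \<sigma>(1) by blast
  qed
  then have "finite (u ` A)"
    using finite_facets finite_subset by blast
  moreover have "continuous_on A u"
    unfolding u_def by (intro continuous_on_diff continuous_c_transform_B adm)
  ultimately have "u constant_on A"
    using continuous_finite_range_constant[OF A_connected] by blast
  then obtain c where c: "\<And>m. m \<in> A \<Longrightarrow> u m = c"
    unfolding constant_on_def by blast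
  have "\<Psi> n - \<Psi>' n = - c" if n: "n \<in> B" for n
  proof -
    \<comment> \<open>The two contact points of \<open>n\<close>, one for each potential, give the
      two inequalities between \<open>\<Psi> n - \<Psi>' n\<close> and \<open>- c\<close>.\<close>
    obtain m m' where m: "m \<in> A" "con \<Psi> m n" "m' \<in> A" "con \<Psi>' m' n"
      using adm n unfolding adm_def by blast
    have "c_transform B \<Psi> m = m \<bullet> n - \<Psi> n" "c_transform B \<Psi>' m' = m' \<bullet> n - \<Psi>' n"
      using con_c_transform m by blast+
    moreover have "m \<bullet> n - \<Psi>' n \<le> c_transform B \<Psi>' m" "m' \<bullet> n - \<Psi> n \<le> c_transform B \<Psi> m'"
      using c_transform_ge[OF B_compact _ n] cont by blast+
    ultimately show ?thesis
      using c[OF m(1)] c[OF m(3)] by (simp add: u_def)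
  qed
  then show ?thesis
    by (rule that)
qed

lemma Sing_cong:
  assumes adm: "adm \<Psi>" "adm \<Psi>'" and c: "\<And>n. n \<in> B \<Longrightarrow> \<Psi> n - \<Psi>' n = c"
  shows "Sing \<Delta> h \<Psi> = Sing \<Delta> h \<Psi>'"
proof -
  have "con \<Psi> m n \<longleftrightarrow> con \<Psi>' m n" for m n
  proof (cases "n \<in> B")
    case True
    have "\<Psi> n' = \<Psi>' n' + c" if "n' \<in> B" for n'
      using c[OF that] by simp
    then show ?thesis
      using True by (simp add: con_def)
  qed (simp add: con_def)
  then have "U_set \<Delta> h \<Psi> \<sigma> = U_set \<Delta> h \<Psi>' \<sigma>" if "\<sigma> facet_of \<Delta>" for \<sigma>
    using U_set_iff[OF adm(1) that] U_set_iff[OF adm(2) that] by blast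
  then show ?thesis
    by (simp add: Sing_def cong: SUP_cong_simp)
qed

section \<open>The Monge-Ampere equation\<close>

lemma solves_MA_if_distr_T:
  assumes "\<Psi> \<in> P_class \<Delta>" "distr mu \<nu> (T \<Psi>) = \<nu>"
  shows "solves_MA \<Delta> h b \<nu> \<Psi>"
proof -
  have adm: "adm \<Psi>"
    by (rule adm_P_class[OF assms(1)])
  have "emeasure \<nu> E = emeasure mu (pull \<Psi> E)" if "E \<in> sets \<nu>" for E
    using emeasure_distr_T[OF adm that] assms(2) by simp
  then show ?thesis
    unfolding solves_MA_def using assms(1) MA_facet[OF adm] MA_U_set[OF adm] sets_nu_iff by auto
qed

text \<open>The equation identifies the two measures on the finitely many sets in \<open>F\<close>,
  which cover the complement of the singular set. As the total masses agree and \<open>\<nu>\<close>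
  vanishes on the singular set, so does the image of \<open>mu\<close> under
  \<open>T \<Psi>\<close>.\<close>

lemma distr_T_if_solves_MA:
  assumes MA: "solves_MA \<Delta> h b \<nu> \<Psi>" and null: "emeasure \<nu> (Sing \<Delta> h \<Psi>) = 0"
  shows "distr mu \<nu> (T \<Psi>) = \<nu>"
proof -
  have "\<Psi> \<in> P_class \<Delta>"
    using MA by (simp add: solves_MA_def)
  then have adm: "adm \<Psi>"
    by (rule adm_P_class)
  note MA1 = MA[unfolded solves_MA_def, THEN conjunct2, THEN conjunct1, rule_format]
    and MA2 = MA[unfolded solves_MA_def, THEN conjunct2, THEN conjunct2, rule_format]
  define \<rho> where "\<rho> = distr mu \<nu> (T \<Psi>)"
  have \<rho>: "emeasure \<rho> E = emeasure mu (pull \<Psi> E)" if "E \<in> sets \<nu>" for E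
    unfolding \<rho>_def by (rule emeasure_distr_T[OF adm that])
  have s\<rho>: "sets \<rho> = sets \<nu>"
    by (simp add: \<rho>_def)
  define F where "F = rel_interior ` {\<tau>. \<tau> facet_of P} \<union> U_set \<Delta> h \<Psi> ` {\<sigma>. \<sigma> facet_of \<Delta>}"
  have finF: "finite F"
    unfolding F_def using finite_facets finite_facets_P by simp
  have piece: "emeasure \<rho> E = emeasure \<nu> E" if G: "G \<in> F" and E: "E \<in> sets \<nu>" "E \<subseteq> G" for E G
  proof -
    have Eb: "E \<in> sets borel"
      using E(1) sets_nu_iff by blast
    from G consider \<tau> where "\<tau> facet_of P" "G = rel_interior \<tau>" | \<sigma> where "\<sigma> facet_of \<Delta>" "G = U_set \<Delta> h \<Psi> \<sigma>"
      unfolding F_def by blast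
    then show ?thesis
    proof cases
      case 1
      obtain \<sigma> where \<sigma>: "\<sigma> facet_of \<Delta>" "primitive_normal P \<tau> \<in> \<sigma>"
        using AM_facetE[OF facet_P(1)[OF 1(1)]] .
      have "E \<subseteq> rel_interior \<tau>"
        using E(2) 1(2) by simp
      then show ?thesis
        unfolding \<rho>[OF E(1)] MA_facet[OF adm 1(1) \<sigma> Eb \<open>E \<subseteq> rel_interior \<tau>\<close>, symmetric]
        by (intro MA1 conjI 1(1) \<sigma> E(1))
    next
      case 2
      \<comment> \<open>Any point of the facet serves: by \<open>MA_U_set\<close> the measure of the
        subgradient image does not depend on it.\<close>
      obtain m where m: "m \<in> \<sigma>"
        using chart_base[OF 2(1)] by blast
      have "E \<subseteq> U_set \<Delta> h \<Psi> \<sigma>"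
        using E(2) 2(2) by simp
      then show ?thesis
        unfolding \<rho>[OF E(1)] MA_U_set[OF adm 2(1) m Eb \<open>E \<subseteq> U_set \<Delta> h \<Psi> \<sigma>\<close>, symmetric]
        by (intro MA2 conjI 2(1) m E(1))
    qed
  qed
  have F_sets: "G \<in> sets \<nu>" if "G \<in> F" for G
    using that U_set_borel[OF adm] rel_interior_facet_P U_set_iff[OF adm] unfolding F_def sets_nu_iff by blast
  have union: "emeasure \<rho> E = emeasure \<nu> E" if "H \<subseteq> F" "E \<in> sets \<nu>" "E \<subseteq> \<Union>H" for H E
    using finite_subset[OF that(1) finF] that
  proof (induction H arbitrary: E rule: finite_induct)
    case (insert G H)
    have G: "G \<in> sets \<nu>" "G \<in> F"
      using insert.prems(1) F_sets by auto
    have "emeasure \<rho> (E \<inter> G) = emeasure \<nu> (E \<inter> G)"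
      using piece[OF G(2)] insert.prems(2) G(1) by auto
    moreover have "emeasure \<rho> (E - G) = emeasure \<nu> (E - G)"
      using insert.IH[of "E - G"] insert.prems G(1) by auto
    moreover have "emeasure M E = emeasure M (E \<inter> G) + emeasure M (E - G)" if "sets M = sets \<nu>" for M
      using insert.prems(2) G(1) that by (subst plus_emeasure) (auto intro!: arg_cong[where f = "emeasure M"])
    ultimately show ?case
      using s\<rho> by metis
  qed simp
  have "B - Sing \<Delta> h \<Psi> \<subseteq> \<Union>F"
    unfolding Sing_def bdB_sing_def F_def by blast
  then have off: "emeasure \<rho> E = emeasure \<nu> E" if "E \<in> sets \<nu>" "E \<inter> Sing \<Delta> h \<Psi> = {}" for E
    using union[of F E] that sets_nu_iff by blast
  have Sing: "Sing \<Delta> h \<Psi> \<in> sets \<nu>" "B \<in> sets \<nu>"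
    using Sing_borel[OF adm] B_borel by (auto simp: sets_nu_iff)
  have split: "emeasure M E = emeasure M (E \<inter> Sing \<Delta> h \<Psi>) + emeasure M (E - Sing \<Delta> h \<Psi>)"
    if "sets M = sets \<nu>" "E \<in> sets \<nu>" for M E
    using that Sing(1) by (subst plus_emeasure) (auto intro!: arg_cong[where f = "emeasure M"])
  have "emeasure \<rho> B = emeasure \<nu> B"
  proof -
    have "T \<Psi> -` B \<inter> space mu = A"
      using T_in_B[OF adm] space_mu by auto
    then show ?thesis
      unfolding \<rho>_def nu_mass by (simp add: emeasure_distr[OF T_transport_measurable[OF adm] Sing(2)])
  qed
  also have "\<dots> = emeasure \<nu> (B - Sing \<Delta> h \<Psi>)"
    using split[OF refl Sing(2)] null Sing_borel(2)[OF adm] by (simp add: Int_absorb1)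
  also have "\<dots> = emeasure \<rho> (B - Sing \<Delta> h \<Psi>)"
    using Sing by (intro off[symmetric]) auto
  finally have "emeasure \<rho> (Sing \<Delta> h \<Psi>) + emeasure \<rho> (B - Sing \<Delta> h \<Psi>) = 0 + emeasure \<rho> (B - Sing \<Delta> h \<Psi>)"
    using split[OF s\<rho> Sing(2)] Sing_borel(2)[OF adm] by (simp add: Int_absorb1)
  moreover have "emeasure \<rho> (B - Sing \<Delta> h \<Psi>) \<noteq> top"
  proof -
    have "emeasure \<rho> (B - Sing \<Delta> h \<Psi>) = emeasure \<nu> (B - Sing \<Delta> h \<Psi>)"
      using Sing by (intro off) auto
    then show ?thesis
      using finite_measure.emeasure_finite[OF finite_measure_nu] by simp
  qed
  ultimately have \<rho>0: "emeasure \<rho> (Sing \<Delta> h \<Psi>) = 0"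
    using ennreal_add_left_cancel[of "emeasure \<rho> (B - Sing \<Delta> h \<Psi>)" "emeasure \<rho> (Sing \<Delta> h \<Psi>)" 0]
    by (simp add: add.commute)
  have "\<rho> = \<nu>"
  proof (rule measure_eqI[OF s\<rho>])
    fix E assume "E \<in> sets \<rho>"
    then have E: "E \<in> sets \<nu>"
      using s\<rho> by simp
    have "emeasure \<rho> (E \<inter> Sing \<Delta> h \<Psi>) = 0" "emeasure \<nu> (E \<inter> Sing \<Delta> h \<Psi>) = 0"
      using emeasure_mono[of "E \<inter> Sing \<Delta> h \<Psi>" "Sing \<Delta> h \<Psi>" \<rho>]
        emeasure_mono[of "E \<inter> Sing \<Delta> h \<Psi>" "Sing \<Delta> h \<Psi>" \<nu>] \<rho>0 null Sing(1) s\<rho>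
      by auto
    moreover have "emeasure \<rho> (E - Sing \<Delta> h \<Psi>) = emeasure \<nu> (E - Sing \<Delta> h \<Psi>)"
      using E Sing(1) by (intro off) auto
    ultimately show "emeasure \<rho> E = emeasure \<nu> E"
      using split[OF s\<rho> E] split[OF refl E] by simp
  qed
  then show ?thesis
    by (simp add: \<rho>_def)
qed

theorem MA_if_supported_plan:
  assumes kp: "kantorovich_potential \<Delta> h b \<nu> \<Psi>" and ex: "exists_supported_optimal_plan \<Delta> h b \<nu>"
  shows "solves_MA \<Delta> h b \<nu> (c_extension \<Delta> h \<Psi>)"
proof (rule solves_MA_if_distr_T)
  let ?\<Psi> = "c_extension \<Delta> h \<Psi>"
  have adm: "adm \<Psi>"
    using kp adm_c_convex unfolding kantorovich_potential_def by blast
  show P: "?\<Psi> \<in> P_class \<Delta>"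
    by (rule c_extension_P_class[OF adm])
  obtain \<gamma> where \<gamma>: "optimal_plan mu \<nu> \<gamma>" "AE z in \<gamma>. z \<in> support_set \<Delta> h"
    using ex unfolding exists_supported_optimal_plan_def by blast
  have "AE z in \<gamma>. rel ?\<Psi> (fst z) (snd z)"
    using optimal_contact_potential[OF \<gamma>(1) kp] \<gamma>(2)
    by eventually_elim (auto simp: rel_def con_cong[OF c_extension_eq[OF adm]])
  then show "distr mu \<nu> (T ?\<Psi>) = \<nu>"
    using \<gamma>(1) unfolding optimal_plan_def by (intro distr_T_if_plan adm_P_class[OF P]) auto
qed

theorem supported_plan_if_MA:
  assumes "solves_MA \<Delta> h b \<nu> \<Psi>" "emeasure \<nu> (Sing \<Delta> h \<Psi>) = 0"
  shows "exists_supported_optimal_plan \<Delta> h b \<nu>"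
proof -
  have adm: "adm \<Psi>"
    using assms(1) adm_P_class by (simp add: solves_MA_def)
  obtain \<gamma> where \<gamma>: "transport_plan mu \<nu> \<gamma>" "AE z in \<gamma>. rel \<Psi> (fst z) (snd z)"
    using plan_if_distr_T[OF adm distr_T_if_solves_MA[OF assms]] by blast
  have "AE z in \<gamma>. con \<Psi> (fst z) (snd z)" "AE z in \<gamma>. z \<in> support_set \<Delta> h"
    using \<gamma>(2) by (eventually_elim, auto simp: rel_def)+
  then show ?thesis
    unfolding exists_supported_optimal_plan_def using optimal_if_con[OF \<gamma>(1) adm] by blast
qed

text \<open>Both plans are optimal, so \<open>con_transfer\<close> makes the first plan consist of
  contact pairs of the second potential as well. Almost every \<open>m\<close> therefore has a
  common contact point.\<close>

theorem MA_unique: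
  assumes MA: "solves_MA \<Delta> h b \<nu> \<Psi>" "emeasure \<nu> (Sing \<Delta> h \<Psi>) = 0"
    and MA': "solves_MA \<Delta> h b \<nu> \<Psi>'" "emeasure \<nu> (Sing \<Delta> h \<Psi>') = 0"
  shows "Sing \<Delta> h \<Psi> = Sing \<Delta> h \<Psi>' \<and> (\<exists>c. \<forall>n\<in>B. \<Psi> n - \<Psi>' n = c)"
proof -
  have adm: "adm \<Psi>" "adm \<Psi>'"
    using MA(1) MA'(1) adm_P_class by (auto simp: solves_MA_def)
  obtain \<gamma> where \<gamma>: "transport_plan mu \<nu> \<gamma>" "AE z in \<gamma>. rel \<Psi> (fst z) (snd z)"
    using plan_if_distr_T[OF adm(1) distr_T_if_solves_MA[OF MA]] by blast
  obtain \<gamma>' where \<gamma>': "transport_plan mu \<nu> \<gamma>'" "AE z in \<gamma>'. rel \<Psi>' (fst z) (snd z)"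
    using plan_if_distr_T[OF adm(2) distr_T_if_solves_MA[OF MA']] by blast
  have con: "AE z in \<gamma>. con \<Psi> (fst z) (snd z)" "AE z in \<gamma>'. con \<Psi>' (fst z) (snd z)"
    using \<gamma>(2) \<gamma>'(2) by (auto simp: rel_def elim: eventually_mono)
  have con': "AE z in \<gamma>. con \<Psi>' (fst z) (snd z)"
    by (rule con_transfer[OF optimal_if_con[OF \<gamma>(1) adm(1) con(1)] \<gamma>'(1) adm(2) con(2)])
  have S: "{m \<in> space mu. \<exists>n. con \<Psi> m n \<and> con \<Psi>' m n} \<in> sets mu"
    using borel_compact[OF compact_common_contact[OF adm]] unfolding space_mu sets_mu_iff by auto
  have "AE z in \<gamma>. \<exists>n. con \<Psi> (fst z) n \<and> con \<Psi>' (fst z) n"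
    using con(1) con' by eventually_elim blast
  then have "AE m in distr \<gamma> mu fst. \<exists>n. con \<Psi> m n \<and> con \<Psi>' m n"
    by (subst AE_distr_iff[OF planD(5)[OF \<gamma>(1)] S])
  then have "AE m in mu. \<exists>n. con \<Psi> m n \<and> con \<Psi>' m n"
    unfolding planD(2)[OF \<gamma>(1)] .
  then obtain c where c: "\<And>n. n \<in> B \<Longrightarrow> \<Psi> n - \<Psi>' n = c"
    using potentials_differ_by_constant[OF adm] by blast
  then show ?thesis
    using Sing_cong[OF adm c] by blast
qed

end

theorem theorem2:
  fixes \<Delta> :: "(real ^ 'n) set"
    and h :: "real ^ 'n \<Rightarrow> int"
    and b :: "(real ^ 'n) set \<Rightarrow> 'k::finite \<Rightarrow> real ^ 'n"
    and \<nu> :: "(real ^ 'n) measure"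
  assumes dim: "CARD('n) = CARD('k) + 1"
    and refl: "reflexive_polytope \<Delta>"
    and height: "height_function \<Delta> h"
    and bases: "facet_bases \<Delta> b"
    and nu_sets: "sets \<nu> = sets (restrict_space borel (bdB \<Delta> h))"
    and nu_mass: "emeasure \<nu> (bdB \<Delta> h) = emeasure (mu_M \<Delta> b) (bdA \<Delta>)"
  shows "(\<forall>\<Psi>. kantorovich_potential \<Delta> h b \<nu> \<Psi> \<and> exists_supported_optimal_plan \<Delta> h b \<nu>
            \<longrightarrow> solves_MA \<Delta> h b \<nu> (c_extension \<Delta> h \<Psi>))
       \<and> (\<forall>\<Psi>. solves_MA \<Delta> h b \<nu> \<Psi> \<and> emeasure \<nu> (Sing \<Delta> h \<Psi>) = 0
            \<longrightarrow> exists_supported_optimal_plan \<Delta> h b \<nu> \<and>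
                (\<forall>\<Psi>'. solves_MA \<Delta> h b \<nu> \<Psi>' \<and> emeasure \<nu> (Sing \<Delta> h \<Psi>') = 0
                   \<longrightarrow> Sing \<Delta> h \<Psi> = Sing \<Delta> h \<Psi>' \<and>
                       (\<exists>c. \<forall>n\<in>bdB \<Delta> h. \<Psi> n - \<Psi>' n = c)))"
proof -
  interpret reflexive_transport \<Delta> h b \<nu>
    by unfold_locales (fact dim refl height bases nu_sets nu_mass)+
  show ?thesis
    using MA_if_supported_plan supported_plan_if_MA MA_unique by blast
qed

end
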